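(* Let $k:\mathcal P\otimes\mathcal Q\to\mathbb R$ be differentiable at $P_0\otimes Q_0$ with canonical gradient $\widetilde k=\widetilde k_1\circ\pi_1+\widetilde k_2\circ\pi_2$, $\|\widetilde k\|_{L_2(P_0\otimes Q_0)}\neq0$, let $\alpha\in(0,1)$, and let $(n_1)_n,(n_2)_n\subset\mathbb N$ satisfy $n_1+n_2=n$ for all $n$ and $\lim_{n\to\infty}\frac{n_2}n=d\in(0,1)$. Suppose $$K(P_0\otimes Q_0,\mathcal P\otimes\mathcal Q)=T(P_0\otimes Q_0,\mathcal P\otimes\mathcal Q).$$ Let $\psi_n=1$ if $T_n>c$ and $\psi_n=0$ if $T_n\le c$, where $$T_n=\frac{\sqrt n}{n_1}\sum_{i=1}^{n_1}\widetilde k_1(\omega_{1,i})+\frac{\sqrt n}{n_2}\sum_{j=1}^{n_2}\widetilde k_2(\omega_{2,j}),\qquad c=u_{1-\alpha}\Bigl(\frac1{1-d}\int\widetilde k_1^2\,dP_0+\frac1d\int\widetilde k_2^2\,dQ_0\Bigr)^{1/2}.$$ Then $(\psi_n)_n$ is asymptotically optimal within the set of all asymptotically level-$\alpha$-similar test sequences for $\mathcal H_1$ against $\mathcal K_1$.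
   Context: $\mathcal P,\mathcal Q$ are nonempty families of probability measures on $(\Omega_1,\mathcal A_1)$, $(\Omega_2,\mathcal A_2)$; $\mathcal P\otimes\mathcal Q=\{P\otimes Q:P\in\mathcal P,Q\in\mathcal Q\}$; $(\omega_{1,1},\dots,\omega_{1,n_1},\omega_{2,1},\dots,\omega_{2,n_2})$ is the generic point of $\Omega_1^{n_1}\times\Omega_2^{n_2}$. $\Phi$ is the standard normal distribution function, $u_{1-\alpha}=\Phi^{-1}(1-\alpha)$; tests are measurable $[0,1]$-valued functions. $L_2^{(0)}(P)=\{h\in L_2(P):\int h\,dP=0\}$. With $dP/dQ$ the density quotient (a $[0,\infty]$-valued measurable $L$ with $P(A)=\int_AL\,dQ+P(A\cap\{L=\infty\})$, $Q(L<\infty)=1$), a curve $t\mapsto R_t$, $|t|<\varepsilon$, in a family $\mathcal R$ is $L_2(R_0)$-differentiable with tangent $g\in L_2(R_0)$ if $\|2((dR_t/dR_0)^{1/2}-1)-tg\|_{L_2(R_0)}=o(|t|)$ and $R_t(dR_t/dR_0=\infty)=o(t^2)$ as $t\to0$. The tangent cone $K(R,\mathcal R)$ is the set of tangents of all such curves in $\mathcal R$ with $R_0=R$; the tangent space $T(R,\mathcal R)$ is the $L_2(R)$-closure of its linear span. A functional $k$ on $\mathcal R$ is differentiable at $R\in\mathcal R$ with gradient $\dot k\in L_2^{(0)}(R)$ if $\lim_{t\downarrow0}t^{-1}(k(R_t)-k(R))=\int\dot kg\,dR$ for each $L_2$-differentiable curve in $\mathcal R$ with $R_0=R$ and tangent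 $g$; the canonical gradient is the unique gradient in $T(R,\mathcal R)$. At $P_0\otimes Q_0$ it decomposes uniquely as $\widetilde k(\omega_1,\omega_2)=\widetilde k_1(\omega_1)+\widetilde k_2(\omega_2)$ with $\widetilde k_1\in L_2^{(0)}(P_0)$, $\widetilde k_2\in L_2^{(0)}(Q_0)$. $\mathcal F_2$ is the set of all sequences $(P_{t_n}\otimes Q_{t_n})_n$ (identified with the sequences $(P_{t_n}^{n_1}\otimes Q_{t_n}^{n_2})_n$) such that $t_n\to0$, $\lim_nt_n\sqrt n>0$, and there are $\varepsilon>0$ and an $L_2(P_0\otimes Q_0)$-differentiable curve $f:(-\varepsilon,\varepsilon)\to\mathcal P\otimes\mathcal Q$, $t\mapsto P_t\otimes Q_t$ (through $P_0\otimes Q_0$ at $t=0$) with $f(t_n)=P_{t_n}\otimes Q_{t_n}$ for all $n$. For an element of $\mathcal F_2$ put $\vartheta=\lim_n\sqrt n(k(P_{t_n}\otimes Q_{t_n})-k(P_0\otimes Q_0))$. $\mathcal K_1$ (implicit alternatives) is the set of elements of $\mathcal F_2$ with $\vartheta>0$, $\mathcal H_1$ (implicit hypotheses) the set of those with $\vartheta\le0$. A sequence of tests $\varphi_n$ on $\Omega_1^{n_1}\times\Omega_2^{n_2}$ is asymptotically level-$\alpha$-similar for $\mathcal H_1$ against $\mathcal K_1$ if $\lim_n\int\varphi_n\,dP_{t_n}^{n_1}\otimes Q_{t_n}^{n_2}=\alpha$ for all elements of $\mathcal H_1$ with $\vartheta=0$. "$(\psi_n)$ is asymptotically optimal" in this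 class means: $(\psi_n)$ belongs to the class, and for every $(\varphi_n)$ in the class, $\limsup_n\int\varphi_n\,dP_{t_n}^{n_1}\otimes Q_{t_n}^{n_2}\le\lim_n\int\psi_n\,dP_{t_n}^{n_1}\otimes Q_{t_n}^{n_2}$ for all elements of $\mathcal K_1$ and $\liminf_n\int\varphi_n\,dP_{t_n}^{n_1}\otimes Q_{t_n}^{n_2}\ge\lim_n\int\psi_n\,dP_{t_n}^{n_1}\otimes Q_{t_n}^{n_2}$ for all elements of $\mathcal H_1$ (the limits for $\psi_n$ existing). *)

theory Defs
  imports "HOL-Probability.Probability" "HOL-Library.Landau_Symbols"
begin

(* Elements of L2 are represented by measurable functions, not by equivalence classes.
   Every notion below is invariant under changes on null sets. *)

definition L2 :: "'a measure \<Rightarrow> ('a \<Rightarrow> real) set" where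
  "L2 M = {f \<in> borel_measurable M. integrable M (\<lambda>x. (f x)\<^sup>2)}"

definition L2_norm :: "'a measure \<Rightarrow> ('a \<Rightarrow> real) \<Rightarrow> real" where
  "L2_norm M f = sqrt (\<integral>x. (f x)\<^sup>2 \<partial>M)"

definition L2_centered :: "'a measure \<Rightarrow> ('a \<Rightarrow> real) set" where
  "L2_centered M = {f \<in> L2 M. (\<integral>x. f x \<partial>M) = 0}"

definition product_family :: "'a measure set \<Rightarrow> 'b measure set \<Rightarrow> ('a \<times> 'b) measure set" where
  "product_family \<P> \<Q> = {P \<Otimes>\<^sub>M Q | P Q. P \<in> \<P> \<and> Q \<in> \<Q>}"

(* L is a version of dP/dQ; it is unique up to (P+Q)-null sets. *)
definition is_density_quotient :: "'a measure \<Rightarrow> 'a measure \<Rightarrow> ('a \<Rightarrow> ennreal) \<Rightarrow> bool" where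
  "is_density_quotient P Q L \<longleftrightarrow>
     L \<in> borel_measurable Q \<and>
     (\<forall>A\<in>sets Q. emeasure P A =
        (\<integral>\<^sup>+x\<in>A. L x \<partial>Q) + emeasure P (A \<inter> {x \<in> space Q. L x = \<infinity>})) \<and>
     emeasure Q {x \<in> space Q. L x < \<infinity>} = 1"

(* The curve is a function on all reals of which only the values on (-\<epsilon>,\<epsilon>) matter.
   By the uniqueness of density quotients the choice of the versions L t is irrelevant;
   enn2real is harmless since L t is finite (R 0)-almost everywhere. *)
definition L2_differentiable :: "real \<Rightarrow> (real \<Rightarrow> 'a measure) \<Rightarrow> ('a \<Rightarrow> real) \<Rightarrow> bool" where
  "L2_differentiable \<epsilon> R g \<longleftrightarrow>
     \<epsilon> > 0 \<and> g \<in> L2 (R 0) \<and>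
     (\<exists>L. (\<forall>t. \<bar>t\<bar> < \<epsilon> \<longrightarrow> is_density_quotient (R t) (R 0) (L t)) \<and>
          (\<lambda>t. L2_norm (R 0) (\<lambda>x. 2 * (sqrt (enn2real (L t x)) - 1) - t * g x))
             \<in> o[at 0](\<lambda>t. \<bar>t\<bar>) \<and>
          (\<lambda>t. measure (R t) {x \<in> space (R 0). L t x = \<infinity>}) \<in> o[at 0](\<lambda>t. t\<^sup>2))"

definition L2_differentiable_curve_in ::
    "'a measure set \<Rightarrow> 'a measure \<Rightarrow> real \<Rightarrow> (real \<Rightarrow> 'a measure) \<Rightarrow> ('a \<Rightarrow> real) \<Rightarrow> bool" where
  "L2_differentiable_curve_in \<R> R0 \<epsilon> R g \<longleftrightarrow>
     (\<forall>t. \<bar>t\<bar> < \<epsilon> \<longrightarrow> R t \<in> \<R>) \<and> R 0 = R0 \<and> L2_differentiable \<epsilon> R g"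

definition tangent_cone :: "'a measure \<Rightarrow> 'a measure set \<Rightarrow> ('a \<Rightarrow> real) set" where
  "tangent_cone R0 \<R> = {g. \<exists>\<epsilon> R. L2_differentiable_curve_in \<R> R0 \<epsilon> R g}"

definition linear_span :: "('a \<Rightarrow> real) set \<Rightarrow> ('a \<Rightarrow> real) set" where
  "linear_span S = {(\<lambda>x. \<Sum>i<m. c i * g i x) | (m::nat) c g. \<forall>i<m. g i \<in> S}"

definition L2_closure :: "'a measure \<Rightarrow> ('a \<Rightarrow> real) set \<Rightarrow> ('a \<Rightarrow> real) set" where
  "L2_closure M S = {g \<in> L2 M. \<forall>e>0. \<exists>h\<in>S. L2_norm M (\<lambda>x. g x - h x) < e}"

definition tangent_space :: "'a measure \<Rightarrow> 'a measure set \<Rightarrow> ('a \<Rightarrow> real) set" where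
  "tangent_space R0 \<R> = L2_closure R0 (linear_span (tangent_cone R0 \<R>))"

definition is_gradient ::
    "('a measure \<Rightarrow> real) \<Rightarrow> 'a measure \<Rightarrow> 'a measure set \<Rightarrow> ('a \<Rightarrow> real) \<Rightarrow> bool" where
  "is_gradient k R0 \<R> kdot \<longleftrightarrow>
     kdot \<in> L2_centered R0 \<and>
     (\<forall>\<epsilon> R g. L2_differentiable_curve_in \<R> R0 \<epsilon> R g \<longrightarrow>
        ((\<lambda>t. (k (R t) - k R0) / t) \<longlongrightarrow> (\<integral>x. kdot x * g x \<partial>R0)) (at_right 0))"

definition is_canonical_gradient ::
    "('a measure \<Rightarrow> real) \<Rightarrow> 'a measure \<Rightarrow> 'a measure set \<Rightarrow> ('a \<Rightarrow> real) \<Rightarrow> bool" where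
  "is_canonical_gradient k R0 \<R> kt \<longleftrightarrow> is_gradient k R0 \<R> kt \<and> kt \<in> tangent_space R0 \<R>"

(* A sequence of product measures is represented by the two sequences of its factors,
   which it determines. *)
type_synonym ('a, 'b) prod_seq = "(nat \<Rightarrow> 'a measure) \<times> (nat \<Rightarrow> 'b measure)"

definition local_sequences ::
    "'a measure set \<Rightarrow> 'b measure set \<Rightarrow> 'a measure \<Rightarrow> 'b measure \<Rightarrow> ('a, 'b) prod_seq set" where
  "local_sequences \<P> \<Q> P0 Q0 =
     {(Ps, Qs). (\<forall>n. Ps n \<in> \<P> \<and> Qs n \<in> \<Q>) \<and>
        (\<exists>t \<tau> \<epsilon> f g.
           t \<longlonglongrightarrow> 0 \<and> (\<lambda>n. t n * sqrt (real n)) \<longlonglongrightarrow> \<tau> \<and> \<tau> > 0 \<and>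
           L2_differentiable_curve_in (product_family \<P> \<Q>) (P0 \<Otimes>\<^sub>M Q0) \<epsilon> f g \<and>
           (\<forall>n. \<bar>t n\<bar> < \<epsilon> \<and> f (t n) = Ps n \<Otimes>\<^sub>M Qs n))}"

(* The limit exists for local sequences as soon as k is differentiable at P0 \<Otimes> Q0. *)
definition local_parameter ::
    "(('a \<times> 'b) measure \<Rightarrow> real) \<Rightarrow> 'a measure \<Rightarrow> 'b measure \<Rightarrow> ('a, 'b) prod_seq \<Rightarrow> real" where
  "local_parameter k P0 Q0 s =
     lim (\<lambda>n. sqrt (real n) * (k (fst s n \<Otimes>\<^sub>M snd s n) - k (P0 \<Otimes>\<^sub>M Q0)))"

definition implicit_alternatives where
  "implicit_alternatives k \<P> \<Q> P0 Q0 =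
     {s \<in> local_sequences \<P> \<Q> P0 Q0. local_parameter k P0 Q0 s > 0}"

definition implicit_hypotheses where
  "implicit_hypotheses k \<P> \<Q> P0 Q0 =
     {s \<in> local_sequences \<P> \<Q> P0 Q0. local_parameter k P0 Q0 s \<le> 0}"

definition two_sample_product ::
    "nat \<Rightarrow> nat \<Rightarrow> 'a measure \<Rightarrow> 'b measure \<Rightarrow> ((nat \<Rightarrow> 'a) \<times> (nat \<Rightarrow> 'b)) measure" where
  "two_sample_product m1 m2 P Q = PiM {1..m1} (\<lambda>_. P) \<Otimes>\<^sub>M PiM {1..m2} (\<lambda>_. Q)"

type_synonym ('a, 'b) test_seq = "nat \<Rightarrow> (nat \<Rightarrow> 'a) \<times> (nat \<Rightarrow> 'b) \<Rightarrow> real"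

definition test_sequences ::
    "'a measure \<Rightarrow> 'b measure \<Rightarrow> (nat \<Rightarrow> nat) \<Rightarrow> (nat \<Rightarrow> nat) \<Rightarrow> ('a, 'b) test_seq set" where
  "test_sequences M1 M2 n1 n2 =
     {\<phi>. \<forall>n. \<phi> n \<in> borel_measurable (two_sample_product (n1 n) (n2 n) M1 M2) \<and>
             \<phi> n ` space (two_sample_product (n1 n) (n2 n) M1 M2) \<subseteq> {0..1}}"

definition power_seq ::
    "(nat \<Rightarrow> nat) \<Rightarrow> (nat \<Rightarrow> nat) \<Rightarrow> ('a, 'b) prod_seq \<Rightarrow> ('a, 'b) test_seq \<Rightarrow> nat \<Rightarrow> real" where
  "power_seq n1 n2 s \<phi> n =
     (\<integral>x. \<phi> n x \<partial>two_sample_product (n1 n) (n2 n) (fst s n) (snd s n))"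

definition asymp_similar_tests where
  "asymp_similar_tests M1 M2 n1 n2 k \<P> \<Q> P0 Q0 \<alpha> =
     {\<phi> \<in> test_sequences M1 M2 n1 n2.
        \<forall>s \<in> implicit_hypotheses k \<P> \<Q> P0 Q0.
          local_parameter k P0 Q0 s = 0 \<longrightarrow> power_seq n1 n2 s \<phi> \<longlonglongrightarrow> \<alpha>}"

definition asymp_optimal ::
    "(nat \<Rightarrow> nat) \<Rightarrow> (nat \<Rightarrow> nat) \<Rightarrow> ('a, 'b) prod_seq set \<Rightarrow> ('a, 'b) prod_seq set \<Rightarrow>
     ('a, 'b) test_seq set \<Rightarrow> ('a, 'b) test_seq \<Rightarrow> bool" where
  "asymp_optimal n1 n2 H K C \<psi> \<longleftrightarrow>
     \<psi> \<in> C \<and>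
     (\<forall>s \<in> H \<union> K. convergent (power_seq n1 n2 s \<psi>)) \<and>
     (\<forall>\<phi>\<in>C.
        (\<forall>s\<in>K. limsup (\<lambda>n. ereal (power_seq n1 n2 s \<phi> n)) \<le> ereal (lim (power_seq n1 n2 s \<psi>))) \<and>
        (\<forall>s\<in>H. liminf (\<lambda>n. ereal (power_seq n1 n2 s \<phi> n)) \<ge> ereal (lim (power_seq n1 n2 s \<psi>))))"

definition test_statistic ::
    "('a \<Rightarrow> real) \<Rightarrow> ('b \<Rightarrow> real) \<Rightarrow> nat \<Rightarrow> nat \<Rightarrow> nat \<Rightarrow> (nat \<Rightarrow> 'a) \<times> (nat \<Rightarrow> 'b) \<Rightarrow> real" where
  "test_statistic k1 k2 n m1 m2 \<omega> =
     sqrt (real n) / real m1 * (\<Sum>i=1..m1. k1 (fst \<omega> i)) +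
     sqrt (real n) / real m2 * (\<Sum>j=1..m2. k2 (snd \<omega> j))"

definition std_normal_quantile :: "real \<Rightarrow> real" where
  "std_normal_quantile = inv (cdf std_normal_distribution)"

end

(* Along a local sequence with tangent G = (G1, G2) and sample fractions 1 - d and d, a linear
   statistic of the sample is asymptotically normal; its characteristic function can be expanded
   directly under the local sequence, so no contiguity argument is needed. This gives the limiting
   power of the proposed test. For the bound on an arbitrary competitor, subtract from G the multiple
   of the least favourable direction h = k1 / (1 - d) + k2 / d that carries the whole derivative of k.
   As the tangent cone is a linear space, the result is the tangent of a sequence s' with parameter 0.
   Tilting the density of s' by exp (sum of h / sqrt n), with h truncated, yields square roots of
   densities with the same first order expansion as those of s, hence products that are close to those
   of s in total variation. The likelihood ratio of the tilted density is monotone in the test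
   statistic, so the bound is the Neyman-Pearson lemma for two sequences. *)

theory Submission
  imports Defs "HOL-Real_Asymp.Real_Asymp"
begin

section \<open>Square-integrable functions\<close>

text \<open>In the limit, tangents are compared by the inner product
  \<open>(1 - d) * <G1, H1> + d * <G2, H2>\<close>, weighted by the sample fractions, while the
  derivative of \<open>k\<close> is the unweighted form \<open><k1, G1> + <k2, G2>\<close>. Its
  representer for the weighted product is \<open>(k1 / (1 - d), k2 / d)\<close>, with squared norm
  \<open>\<sigma>\<^sup>2\<close>; in general this is no multiple of the canonical gradient, so
  \<open>k1\<close> and \<open>k2\<close> have to be tangents separately. Freezing one factor of a
  product curve shows that they are.

  Two obstacles shape the rest. The measures of the families need not be dominated by
  \<open>P0\<close> and \<open>Q0\<close>, so the work is done with densities of absolutely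
  continuous parts; their missing mass is o(1/n) per observation and hence o(1) for the whole
  sample. Tangents have only second moments, so \<open>exp (h / sqrt n)\<close> need not be
  integrable; the truncation level is therefore fixed from the tolerated error before n grows. The
  tilted densities need not come from the families, they only have to be close to those of
  \<open>s\<close>. The bound for \<open>s\<close> uses the level of the competitor along
  \<open>s'\<close> alone, and applied to \<open>1 - \<phi>\<close> it yields the claim on the
  hypotheses.\<close>

lemma L2_measurable: "f \<in> L2 M \<Longrightarrow> f \<in> borel_measurable M"
  and L2_integrable_square: "f \<in> L2 M \<Longrightarrow> integrable M (\<lambda>x. (f x)\<^sup>2)"
  by (auto simp: L2_def)

lemma L2_norm_nonneg [simp]: "0 \<le> L2_norm M f"
  by (simp add: L2_norm_def)

lemma L2_norm_power2: "(L2_norm M f)\<^sup>2 = (\<integral>x. (f x)\<^sup>2 \<partial>M)"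
  by (simp add: L2_norm_def)

lemma L2_integrable_mult:
  assumes "f \<in> L2 M" "g \<in> L2 M" shows "integrable M (\<lambda>x. f x * g x)"
proof (rule Bochner_Integration.integrable_bound[where f = "\<lambda>x. (f x)\<^sup>2 + (g x)\<^sup>2"])
  have "\<bar>a * b\<bar> \<le> a\<^sup>2 + b\<^sup>2" for a b :: real
  proof -
    have "2 * (\<bar>a\<bar> * \<bar>b\<bar>) \<le> a\<^sup>2 + b\<^sup>2"
      using sum_squares_bound[of "\<bar>a\<bar>" "\<bar>b\<bar>"] by simp
    moreover have "0 \<le> \<bar>a\<bar> * \<bar>b\<bar>" by simp
    ultimately show ?thesis by (simp only: abs_mult)
  qed
  then show "AE x in M. norm (f x * g x) \<le> norm ((f x)\<^sup>2 + (g x)\<^sup>2)" by simp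
qed (use assms in \<open>auto simp: L2_def\<close>)

lemma L2_scale: assumes "f \<in> L2 M" shows "(\<lambda>x. c * f x) \<in> L2 M"
  using assms by (auto simp: L2_def power_mult_distrib)

lemma L2_add: assumes "f \<in> L2 M" "g \<in> L2 M" shows "(\<lambda>x. f x + g x) \<in> L2 M"
proof -
  have "integrable M (\<lambda>x. (f x)\<^sup>2 + (g x)\<^sup>2 + 2 * (f x * g x))"
    using assms L2_integrable_mult[OF assms] by (auto simp: L2_def)
  then show ?thesis
    using assms by (auto simp: L2_def power2_sum algebra_simps)
qed

lemma L2_diff: assumes "f \<in> L2 M" "g \<in> L2 M" shows "(\<lambda>x. f x - g x) \<in> L2 M"
  using L2_add[OF assms(1) L2_scale[OF assms(2), of "-1"]] by simp

text \<open>Keeping both coefficients \<open>s\<close> and \<open>t\<close> in the nonnegative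
  quadratic form avoids a quotient by \<open>C\<close>, which may be 0.\<close>

lemma L2_Cauchy_Schwarz:
  assumes f: "f \<in> L2 M" and g: "g \<in> L2 M"
  shows "\<bar>\<integral>x. f x * g x \<partial>M\<bar> \<le> L2_norm M f * L2_norm M g"
proof -
  define A B C where "A = (\<integral>x. (f x)\<^sup>2 \<partial>M)" and "B = (\<integral>x. f x * g x \<partial>M)" and "C = (\<integral>x. (g x)\<^sup>2 \<partial>M)"
  have nn: "0 \<le> s\<^sup>2 * A - 2 * s * t * B + t\<^sup>2 * C" for s t
  proof -
    have "0 \<le> (\<integral>x. (s * f x - t * g x)\<^sup>2 \<partial>M)" by simp
    also have "\<dots> = (\<integral>x. s\<^sup>2 * (f x)\<^sup>2 - 2 * s * t * (f x * g x) + t\<^sup>2 * (g x)\<^sup>2 \<partial>M)"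
      by (intro Bochner_Integration.integral_cong) (auto simp: power2_eq_square algebra_simps)
    also have "\<dots> = s\<^sup>2 * A - 2 * s * t * B + t\<^sup>2 * C"
      unfolding A_def B_def C_def
      using L2_integrable_mult[OF f g] L2_integrable_square[OF f] L2_integrable_square[OF g] by simp
    finally show ?thesis .
  qed
  have A0: "A \<ge> 0" and C0: "C \<ge> 0" by (auto simp: A_def C_def)
  have "B\<^sup>2 \<le> A * C"
  proof (cases "C = 0")
    case True
    have "B = 0"
    proof (rule ccontr)
      assume "B \<noteq> 0"
      \<comment> \<open>For \<open>C = 0\<close> this choice makes the form equal to
        \<open>A - (A + 1) = -1\<close>.\<close>
      with nn[of 1 "(A + 1) / (2 * B)"] True show False by (simp add: field_simps)
    qed
    with True show ?thesis by simp
  next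
    case False
    with C0 have "C > 0" by simp
    \<comment> \<open>The minimiser \<open>t = B / C\<close> for \<open>s = 1\<close>, scaled by
      \<open>C\<close>.\<close>
    from nn[of C B] have "0 \<le> C * (A * C - B\<^sup>2)"
      by (simp add: power2_eq_square algebra_simps)
    with \<open>C > 0\<close> show ?thesis by (simp add: zero_le_mult_iff)
  qed
  then have "sqrt (B\<^sup>2) \<le> sqrt (A * C)" by (rule real_sqrt_le_mono)
  then show ?thesis by (simp add: L2_norm_def A_def B_def C_def real_sqrt_mult)
qed

lemma L2_norm_scale: "L2_norm M (\<lambda>x. c * f x) = \<bar>c\<bar> * L2_norm M f"
  by (simp add: L2_norm_def power_mult_distrib real_sqrt_mult)

lemma L2_norm_minus_commute: "L2_norm M (\<lambda>x. f x - g x) = L2_norm M (\<lambda>x. g x - f x)"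
  by (simp add: L2_norm_def power2_commute)

lemma L2_norm_triangle:
  assumes f: "f \<in> L2 M" and g: "g \<in> L2 M"
  shows "L2_norm M (\<lambda>x. f x + g x) \<le> L2_norm M f + L2_norm M g"
proof (rule power2_le_imp_le)
  have "(L2_norm M (\<lambda>x. f x + g x))\<^sup>2 = (\<integral>x. (f x)\<^sup>2 + (g x)\<^sup>2 + 2 * (f x * g x) \<partial>M)"
    unfolding L2_norm_power2
    by (intro Bochner_Integration.integral_cong) (auto simp: power2_eq_square algebra_simps)
  also have "\<dots> = (L2_norm M f)\<^sup>2 + (L2_norm M g)\<^sup>2 + 2 * (\<integral>x. f x * g x \<partial>M)"
    using L2_integrable_mult[OF f g] L2_integrable_square[OF f] L2_integrable_square[OF g]
    by (simp add: L2_norm_power2)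
  also have "\<dots> \<le> (L2_norm M f)\<^sup>2 + (L2_norm M g)\<^sup>2 + 2 * (L2_norm M f * L2_norm M g)"
    using L2_Cauchy_Schwarz[OF f g] by simp
  also have "\<dots> = (L2_norm M f + L2_norm M g)\<^sup>2" by (simp add: power2_sum)
  finally show "(L2_norm M (\<lambda>x. f x + g x))\<^sup>2 \<le> (L2_norm M f + L2_norm M g)\<^sup>2" .
qed (simp add: add_nonneg_nonneg)

lemma L2_norm_triangle_diff:
  assumes f: "f \<in> L2 M" and g: "g \<in> L2 M" and h: "h \<in> L2 M"
  shows "L2_norm M (\<lambda>x. f x - h x) \<le> L2_norm M (\<lambda>x. f x - g x) + L2_norm M (\<lambda>x. g x - h x)"
  using L2_norm_triangle[OF L2_diff[OF f g] L2_diff[OF g h]] by simp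

lemma L2_norm_cong_AE:
  assumes "f \<in> borel_measurable M" "g \<in> borel_measurable M" "AE x in M. f x = g x"
  shows "L2_norm M f = L2_norm M g"
  unfolding L2_norm_def using assms by (auto intro!: arg_cong[where f = sqrt] integral_cong_AE)

lemma L2_norm_zero_AE:
  assumes "f \<in> L2 M" "L2_norm M f = 0" shows "AE x in M. f x = 0"
  using assms integral_nonneg_eq_0_iff_AE[of M "\<lambda>x. (f x)\<^sup>2"] by (auto simp: L2_def L2_norm_def)

lemma L2_bounded_mult:
  assumes f: "f \<in> L2 M" and b: "b \<in> borel_measurable M" "\<And>x. \<bar>b x\<bar> \<le> c"
  shows "(\<lambda>x. b x * f x) \<in> L2 M" "L2_norm M (\<lambda>x. b x * f x) \<le> c * L2_norm M f"
proof -
  \<comment> \<open>The bound is assumed at every element of the type, so any instance gives the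
    sign of \<open>c\<close>.\<close>
  have c: "0 \<le> c" using b(2)[of undefined] by linarith
  have le: "(b x * f x)\<^sup>2 \<le> (c * f x)\<^sup>2" for x
    by (metis abs_mult abs_of_nonneg b(2) c mult_right_mono abs_ge_zero abs_le_square_iff)
  have i: "integrable M (\<lambda>x. (c * f x)\<^sup>2)" using L2_integrable_square[OF L2_scale[OF f]] .
  have i2: "integrable M (\<lambda>x. (b x * f x)\<^sup>2)"
    by (rule Bochner_Integration.integrable_bound[OF i]) (use b f le in \<open>auto simp: L2_def\<close>)
  then show "(\<lambda>x. b x * f x) \<in> L2 M" using b f by (auto simp: L2_def)
  have "L2_norm M (\<lambda>x. b x * f x) \<le> L2_norm M (\<lambda>x. c * f x)"
    unfolding L2_norm_def by (intro real_sqrt_le_mono integral_mono i i2 le)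
  then show "L2_norm M (\<lambda>x. b x * f x) \<le> c * L2_norm M f" using c by (simp add: L2_norm_scale)
qed

lemma (in finite_measure) L2_const: "(\<lambda>x. c) \<in> L2 M"
  by (simp add: L2_def)

lemma (in finite_measure) L2_bounded:
  assumes "b \<in> borel_measurable M" "\<And>x. \<bar>b x\<bar> \<le> c" shows "b \<in> L2 M"
  using L2_bounded_mult(1)[OF L2_const[of 1] assms] by simp

lemma (in finite_measure) L2_imp_integrable: "f \<in> L2 M \<Longrightarrow> integrable M f"
  using L2_integrable_mult[OF _ L2_const[of 1]] by simp

lemma (in prob_space) L2_norm_const: "L2_norm M (\<lambda>x. c) = \<bar>c\<bar>"
  by (simp add: L2_norm_def prob_space)

lemma (in prob_space) abs_integral_le_L2_norm: "f \<in> L2 M \<Longrightarrow> \<bar>\<integral>x. f x \<partial>M\<bar> \<le> L2_norm M f"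
  using L2_Cauchy_Schwarz[OF _ L2_const[of 1], of f] by (simp add: L2_norm_const)

section \<open>Convergence in L2 along a filter\<close>

text \<open>Membership in L2 is demanded explicitly, because \<open>L2_norm\<close> rests on the
  Bochner integral, which is 0 for a square that is not integrable; a small norm alone would say
  nothing. The filter is a parameter since curves live on \<open>at 0\<close> and local sequences on
  \<open>sequentially\<close>.\<close>

definition L2_tendsto :: "'a measure \<Rightarrow> 'i filter \<Rightarrow> ('i \<Rightarrow> 'a \<Rightarrow> real) \<Rightarrow> ('a \<Rightarrow> real) \<Rightarrow> bool" where
  "L2_tendsto M F D G \<longleftrightarrow> (\<forall>i. D i \<in> L2 M) \<and> G \<in> L2 M \<and>
     ((\<lambda>i. L2_norm M (\<lambda>x. D i x - G x)) \<longlongrightarrow> 0) F"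

lemma L2_tendstoD:
  assumes "L2_tendsto M F D G"
  shows "D i \<in> L2 M" "G \<in> L2 M" "((\<lambda>i. L2_norm M (\<lambda>x. D i x - G x)) \<longlongrightarrow> 0) F"
  using assms by (auto simp: L2_tendsto_def)

lemma L2_tendsto_const: "G \<in> L2 M \<Longrightarrow> L2_tendsto M F (\<lambda>i. G) G"
  by (auto simp: L2_tendsto_def L2_norm_def)

lemma L2_tendsto_bound:
  assumes "\<And>i. D i \<in> L2 M" "G \<in> L2 M" "(b \<longlongrightarrow> 0) F"
    "\<forall>\<^sub>F i in F. L2_norm M (\<lambda>x. D i x - G x) \<le> b i"
  shows "L2_tendsto M F D G"
  using assms by (auto simp: L2_tendsto_def intro: tendsto_sandwich[OF _ assms(4) tendsto_const])

text \<open>The usual way in which expansions are proved below: compare with a simpler family whose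
  limit is known and bound the distance by a null sequence.\<close>

lemma L2_tendsto_perturb:
  assumes D: "L2_tendsto M F D G" and E: "\<And>i. E i \<in> L2 M"
    and b: "(b \<longlongrightarrow> 0) F" "\<forall>\<^sub>F i in F. L2_norm M (\<lambda>x. E i x - D i x) \<le> b i"
  shows "L2_tendsto M F E G"
proof (rule L2_tendsto_bound[OF E])
  show "((\<lambda>i. b i + L2_norm M (\<lambda>x. D i x - G x)) \<longlongrightarrow> 0) F"
    using tendsto_add[OF b(1) L2_tendstoD(3)[OF D]] by simp
  show "\<forall>\<^sub>F i in F. L2_norm M (\<lambda>x. E i x - G x) \<le> b i + L2_norm M (\<lambda>x. D i x - G x)"
    using b(2)
  proof eventually_elim
    case (elim i)
    then show ?case
      using L2_norm_triangle_diff[OF E[of i] L2_tendstoD(1,2)[OF D], of i] by linarith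
  qed
qed (rule L2_tendstoD(2)[OF D])

lemma L2_tendsto_add:
  assumes D: "L2_tendsto M F D G" and E: "L2_tendsto M F E H"
  shows "L2_tendsto M F (\<lambda>i x. D i x + E i x) (\<lambda>x. G x + H x)"
proof (rule L2_tendsto_bound)
  show "((\<lambda>i. L2_norm M (\<lambda>x. D i x - G x) + L2_norm M (\<lambda>x. E i x - H x)) \<longlongrightarrow> 0) F"
    using tendsto_add[OF L2_tendstoD(3)[OF D] L2_tendstoD(3)[OF E]] by simp
  show "\<forall>\<^sub>F i in F. L2_norm M (\<lambda>x. D i x + E i x - (G x + H x))
          \<le> L2_norm M (\<lambda>x. D i x - G x) + L2_norm M (\<lambda>x. E i x - H x)"
    using L2_norm_triangle[OF L2_diff[OF L2_tendstoD(1,2)[OF D]] L2_diff[OF L2_tendstoD(1,2)[OF E]]]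
    by (intro always_eventually) (simp add: algebra_simps)
qed (use D E in \<open>auto intro: L2_add simp: L2_tendsto_def\<close>)

lemma L2_norm_diff_le:
  assumes "f \<in> L2 M" "g \<in> L2 M"
  shows "\<bar>L2_norm M f - L2_norm M g\<bar> \<le> L2_norm M (\<lambda>x. f x - g x)"
  using L2_norm_triangle[OF L2_diff[OF assms] assms(2)]
    L2_norm_triangle[OF L2_diff[OF assms(2,1)] assms(1)] L2_norm_minus_commute[of M f g]
  by simp

lemma L2_tendsto_norm:
  assumes D: "L2_tendsto M F D G" shows "((\<lambda>i. L2_norm M (D i)) \<longlongrightarrow> L2_norm M G) F"
proof (rule Lim_transform2[OF tendsto_const])
  show "((\<lambda>i. L2_norm M G - L2_norm M (D i)) \<longlongrightarrow> 0) F"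
    by (rule Lim_null_comparison[OF _ L2_tendstoD(3)[OF D]])
       (use L2_norm_diff_le[OF L2_tendstoD(1,2)[OF D]] in \<open>auto simp: abs_minus_commute\<close>)
qed

lemma L2_tendsto_scale:
  assumes D: "L2_tendsto M F D G" and c: "(c \<longlongrightarrow> c0) F"
  shows "L2_tendsto M F (\<lambda>i x. c i * D i x) (\<lambda>x. c0 * G x)"
proof -
  have "L2_tendsto M F (\<lambda>i x. c0 * D i x) (\<lambda>x. c0 * G x)"
  proof (rule L2_tendsto_bound)
    show "((\<lambda>i. \<bar>c0\<bar> * L2_norm M (\<lambda>x. D i x - G x)) \<longlongrightarrow> 0) F"
      using tendsto_mult_left[OF L2_tendstoD(3)[OF D], of "\<bar>c0\<bar>"] by simp
    show "\<forall>\<^sub>F i in F. L2_norm M (\<lambda>x. c0 * D i x - c0 * G x) \<le> \<bar>c0\<bar> * L2_norm M (\<lambda>x. D i x - G x)"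
      by (simp add: L2_norm_scale flip: right_diff_distrib)
  qed (use D in \<open>auto intro: L2_scale simp: L2_tendsto_def\<close>)
  then show ?thesis
  proof (rule L2_tendsto_perturb)
    show "((\<lambda>i. \<bar>c i - c0\<bar> * L2_norm M (D i)) \<longlongrightarrow> 0) F"
      using tendsto_mult[OF tendsto_rabs[OF Lim_null[THEN iffD1, OF c]] L2_tendsto_norm[OF D]] by simp
    show "\<forall>\<^sub>F i in F. L2_norm M (\<lambda>x. c i * D i x - c0 * D i x) \<le> \<bar>c i - c0\<bar> * L2_norm M (D i)"
      by (simp add: L2_norm_scale flip: left_diff_distrib)
  qed (use D in \<open>auto intro: L2_scale simp: L2_tendsto_def\<close>)
qed

lemma L2_tendsto_inner:
  assumes D: "L2_tendsto M F D G" and E: "L2_tendsto M F E H"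
  shows "((\<lambda>i. \<integral>x. D i x * E i x \<partial>M) \<longlongrightarrow> (\<integral>x. G x * H x \<partial>M)) F"
proof -
  note d = L2_tendstoD(1,2)[OF D] and e = L2_tendstoD(1,2)[OF E]
  define b where "b i = L2_norm M (\<lambda>x. D i x - G x) * L2_norm M (E i) +
      L2_norm M G * L2_norm M (\<lambda>x. E i x - H x)" for i
  have "(b \<longlongrightarrow> 0 * L2_norm M H + L2_norm M G * 0) F"
    unfolding b_def by (intro tendsto_intros L2_tendsto_norm[OF E] L2_tendstoD(3)[OF D] L2_tendstoD(3)[OF E])
  then have b: "(b \<longlongrightarrow> 0) F" by simp
  have *: "\<bar>(\<integral>x. D i x * E i x \<partial>M) - (\<integral>x. G x * H x \<partial>M)\<bar> \<le> b i" for i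
  proof -
    have "(\<integral>x. D i x * E i x \<partial>M) - (\<integral>x. G x * H x \<partial>M) = (\<integral>x. D i x * E i x - G x * H x \<partial>M)"
      using L2_integrable_mult[OF d(1)[of i] e(1)[of i]] L2_integrable_mult[OF d(2) e(2)] by simp
    also have "\<dots> = (\<integral>x. (D i x - G x) * E i x + G x * (E i x - H x) \<partial>M)"
      by (simp add: algebra_simps)
    also have "\<dots> = (\<integral>x. (D i x - G x) * E i x \<partial>M) + (\<integral>x. G x * (E i x - H x) \<partial>M)"
      using L2_integrable_mult[OF L2_diff[OF d] e(1), of i i] L2_integrable_mult[OF d(2) L2_diff[OF e], of i] by simp
    finally show ?thesis
      using L2_Cauchy_Schwarz[OF L2_diff[OF d] e(1), of i i] L2_Cauchy_Schwarz[OF d(2) L2_diff[OF e], of i]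
      unfolding b_def by linarith
  qed
  show ?thesis
    by (rule Lim_transform2[OF tendsto_const], rule Lim_null_comparison[OF _ b]) (use * in \<open>auto simp: abs_minus_commute\<close>)
qed

lemma (in finite_measure) L2_tendsto_integral:
  assumes "L2_tendsto M F D G"
  shows "((\<lambda>i. \<integral>x. D i x \<partial>M) \<longlongrightarrow> (\<integral>x. G x \<partial>M)) F"
  using L2_tendsto_inner[OF assms L2_tendsto_const[OF L2_const[of 1]]] by simp

lemma L2_tendsto_unique:
  assumes D: "L2_tendsto M F D G" and E: "L2_tendsto M F D H" and F: "F \<noteq> bot"
  shows "AE x in M. G x = H x"
proof -
  note l = L2_tendstoD(2)[OF D] L2_tendstoD(2)[OF E]
  have "L2_norm M (\<lambda>x. G x - H x) \<le> 0"
  proof (rule tendsto_le[OF F _ tendsto_const])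
    show "((\<lambda>i. L2_norm M (\<lambda>x. D i x - G x) + L2_norm M (\<lambda>x. D i x - H x)) \<longlongrightarrow> 0) F"
      using tendsto_add[OF L2_tendstoD(3)[OF D] L2_tendstoD(3)[OF E]] by simp
    show "\<forall>\<^sub>F i in F. L2_norm M (\<lambda>x. G x - H x)
        \<le> L2_norm M (\<lambda>x. D i x - G x) + L2_norm M (\<lambda>x. D i x - H x)"
      using L2_norm_triangle_diff[OF l(1) L2_tendstoD(1)[OF D] l(2)] L2_norm_minus_commute[of M G]
      by (intro always_eventually) simp
  qed
  then have "L2_norm M (\<lambda>x. G x - H x) = 0" using L2_norm_nonneg by (rule antisym)
  from L2_norm_zero_AE[OF L2_diff[OF l] this] show ?thesis by simp
qed

lemma L2_tendsto_cong_AE: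
  assumes D: "L2_tendsto M F D G" and H: "H \<in> borel_measurable M" and eq: "AE x in M. G x = H x"
  shows "L2_tendsto M F D H"
proof -
  note G = L2_tendstoD(2)[OF D]
  have HL: "H \<in> L2 M"
    unfolding L2_def using G H eq
    by (auto simp: L2_def intro: integrable_cong_AE_imp[of M "\<lambda>x. (G x)\<^sup>2"])
  have "L2_norm M (\<lambda>x. D i x - G x) = L2_norm M (\<lambda>x. D i x - H x)" for i
    using L2_measurable[OF L2_tendstoD(1)[OF D, of i]] L2_measurable[OF G] H eq
    by (intro L2_norm_cong_AE) auto
  with D HL show ?thesis by (simp add: L2_tendsto_def)
qed

lemma L2_tendsto_cong_eventually:
  assumes D: "L2_tendsto M F D G" and "\<And>i. E i \<in> L2 M" and ev: "\<forall>\<^sub>F i in F. E i = D i"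
  shows "L2_tendsto M F E G"
proof (rule L2_tendsto_perturb[OF D _ tendsto_const])
  show "\<forall>\<^sub>F i in F. L2_norm M (\<lambda>x. E i x - D i x) \<le> 0"
    using ev by eventually_elim (simp add: L2_norm_def)
qed fact

lemma L2_tendsto_compose:
  assumes D: "L2_tendsto M F D G" and t: "filterlim t F F'"
  shows "L2_tendsto M F' (\<lambda>i. D (t i)) G"
  using D filterlim_compose[OF L2_tendstoD(3)[OF D] t] by (auto simp: L2_tendsto_def)

text \<open>Supplies the truncated directions for the exponential tilt: boundedness makes the
  exponential integrable, and centering keeps the tangent of the tilted density centered. The bound
  may depend on \<open>m\<close>.\<close>

lemma (in prob_space) L2_centered_bounded_dense:
  assumes h: "h \<in> L2_centered M"
  obtains hs :: "nat \<Rightarrow> 'a \<Rightarrow> real" where "L2_tendsto M sequentially hs h"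
    "\<And>m. (\<integral>x. hs m x \<partial>M) = 0" "\<And>m. \<exists>B. \<forall>x. \<bar>hs m x\<bar> \<le> B"
proof -
  have hL: "h \<in> L2 M" and h0: "(\<integral>x. h x \<partial>M) = 0" using h by (auto simp: L2_centered_def)
  note [measurable] = L2_measurable[OF hL]
  define tr where "tr m x = max (- real m) (min (real m) (h x))" for m x
  have [measurable]: "tr m \<in> borel_measurable M" for m unfolding tr_def by simp
  have bd: "\<bar>tr m x\<bar> \<le> real m" for m x unfolding tr_def by auto
  have trL: "tr m \<in> L2 M" for m by (rule L2_bounded[OF _ bd]) simp
  have "(\<lambda>m. \<integral>x. (tr m x - h x)\<^sup>2 \<partial>M) \<longlonglongrightarrow> (\<integral>x. 0 \<partial>M)"
  proof (rule integral_dominated_convergence)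
    show "integrable M (\<lambda>x. (h x)\<^sup>2)" using L2_integrable_square[OF hL] .
    show "AE x in M. (\<lambda>m. (tr m x - h x)\<^sup>2) \<longlonglongrightarrow> 0"
    proof (intro AE_I2 tendsto_eventually)
      fix x
      obtain k :: nat where "\<bar>h x\<bar> \<le> real k" using real_arch_simple by blast
      then show "\<forall>\<^sub>F m in sequentially. (tr m x - h x)\<^sup>2 = 0"
        unfolding eventually_sequentially tr_def by (intro exI[of _ k]) auto
    qed
    have "\<bar>tr m x - h x\<bar> \<le> \<bar>h x\<bar>" for m x unfolding tr_def by auto
    then show "AE x in M. norm ((tr m x - h x)\<^sup>2) \<le> (h x)\<^sup>2" for m
      by (simp add: abs_le_square_iff)
  qed auto
  then have "(\<lambda>m. L2_norm M (\<lambda>x. tr m x - h x)) \<longlonglongrightarrow> 0"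
    unfolding L2_norm_def using tendsto_real_sqrt by fastforce
  then have t: "L2_tendsto M sequentially tr h" using trL hL by (simp add: L2_tendsto_def)
  \<comment> \<open>Truncation destroys centering, but the means tend to the mean 0 of
    \<open>h\<close>, so they can be subtracted at a vanishing cost.\<close>
  have e: "(\<lambda>m. expectation (tr m)) \<longlonglongrightarrow> 0" using L2_tendsto_integral[OF t] h0 by simp
  show ?thesis
  proof (rule that[of "\<lambda>m x. tr m x - expectation (tr m)"])
    show "L2_tendsto M sequentially (\<lambda>m x. tr m x - expectation (tr m)) h"
      by (rule L2_tendsto_perturb[OF t L2_diff[OF trL L2_const] tendsto_rabs_zero[OF e]])
         (simp add: L2_norm_const)
    show "expectation (\<lambda>x. tr m x - expectation (tr m)) = 0" for m
      using L2_imp_integrable[OF trL[of m]] by (simp add: prob_space)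
    show "\<exists>B. \<forall>x. \<bar>tr m x - expectation (tr m)\<bar> \<le> B" for m
    proof (intro exI allI)
      fix x show "\<bar>tr m x - expectation (tr m)\<bar> \<le> real m + \<bar>expectation (tr m)\<bar>"
        using bd[of m x] by linarith
    qed
  qed
qed

section \<open>Densities of absolutely continuous parts\<close>

text \<open>\<open>a\<close> is a density of the part of \<open>P\<close> that is absolutely continuous with respect to \<open>P0\<close>.\<close>

definition ac_density :: "'a measure \<Rightarrow> 'a measure \<Rightarrow> ('a \<Rightarrow> real) \<Rightarrow> bool" where
  "ac_density P P0 a \<longleftrightarrow> sets P = sets P0 \<and> a \<in> borel_measurable P0 \<and> (\<forall>x. 0 \<le> a x) \<and>
     (\<exists>N\<in>sets P0. emeasure P0 N = 0 \<and>
        density P (indicator (space P0 - N)) = density P0 (\<lambda>x. ennreal (a x)))"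

lemma ac_densityD:
  assumes "ac_density P P0 a"
  shows "sets P = sets P0" "a \<in> borel_measurable P0" "0 \<le> a x"
  using assms by (auto simp: ac_density_def)

lemma ac_densityE_density:
  assumes "ac_density P P0 a"
  obtains N where "N \<in> sets P0" "emeasure P0 N = 0"
    "density P (indicator (space P0 - N)) = density P0 (\<lambda>x. ennreal (a x))"
  using assms by (auto simp: ac_density_def)

lemma ac_density_nn_integral:
  assumes "ac_density P P0 a"
  shows "\<exists>N\<in>sets P0. emeasure P0 N = 0 \<and> (\<forall>F\<in>borel_measurable P0.
      (\<integral>\<^sup>+x. F x * indicator (space P0 - N) x \<partial>P) = (\<integral>\<^sup>+x. F x * ennreal (a x) \<partial>P0))"
proof -
  note [measurable] = ac_densityD(2)[OF assms]
  note [simp, measurable_cong] = ac_densityD(1)[OF assms]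
  obtain N where N: "N \<in> sets P0" "emeasure P0 N = 0"
    "density P (indicator (space P0 - N)) = density P0 (\<lambda>x. ennreal (a x))"
    by (rule ac_densityE_density[OF assms])
  note [measurable] = N(1)
  show ?thesis
  proof (intro bexI[OF _ N(1)] conjI N(2) ballI)
    fix F :: "'a \<Rightarrow> ennreal" assume [measurable]: "F \<in> borel_measurable P0"
    have "(\<integral>\<^sup>+x. F x \<partial>density P (indicator (space P0 - N))) = (\<integral>\<^sup>+x. F x \<partial>density P0 (\<lambda>x. ennreal (a x)))"
      by (simp only: N(3))
    then show "(\<integral>\<^sup>+x. F x * indicator (space P0 - N) x \<partial>P) = (\<integral>\<^sup>+x. F x * ennreal (a x) \<partial>P0)"
      by (simp add: nn_integral_density mult.commute)
  qed
qed

text \<open>The mass that \<open>a\<close> lacks is exactly the mass of the singular part. This is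
  why the condition on the set where the density quotient is infinite can later be stated as
  \<open>1 - (\<integral>x. a x \<partial>P0)\<close>, without mentioning that set.\<close>

lemma ac_density_mass:
  assumes ac: "ac_density P P0 a" and P: "prob_space P"
    and N: "N \<in> sets P0"
      "density P (indicator (space P0 - N)) = density P0 (\<lambda>x. ennreal (a x))"
  shows "(\<integral>x. a x \<partial>P0) = 1 - measure P N"
proof -
  interpret P: prob_space P by fact
  have s: "sets P = sets P0" by (rule ac_densityD(1)[OF ac])
  then have sp: "space P = space P0" by (rule sets_eq_imp_space_eq)
  note [measurable] = ac_densityD(2)[OF ac] N(1)
  have "(\<integral>\<^sup>+x. 1 \<partial>density P0 (\<lambda>x. ennreal (a x))) = (\<integral>\<^sup>+x. 1 \<partial>density P (indicator (space P0 - N)))"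
    by (simp only: N(2))
  then have "(\<integral>\<^sup>+x. ennreal (a x) \<partial>P0) = (\<integral>\<^sup>+x. indicator (space P0 - N) x \<partial>P)"
    using s by (simp add: nn_integral_density del: nn_integral_const nn_integral_indicator)
  also have "\<dots> = emeasure P (space P0 - N)" using s by (intro nn_integral_indicator) auto
  also have "\<dots> = ennreal (1 - measure P N)"
    using P.prob_compl[of N] N(1) s sp by (simp add: P.emeasure_eq_measure)
  finally have "(\<integral>\<^sup>+x. ennreal (a x) \<partial>P0) = ennreal (1 - measure P N)" .
  then show ?thesis
    using ac_densityD(3)[OF ac] by (subst integral_eq_nn_integral) auto
qed

lemma ac_density_integrable:
  assumes ac: "ac_density P P0 a" and P: "prob_space P"
  shows "integrable P0 a" "(\<integral>x. a x \<partial>P0) \<le> 1"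
proof -
  interpret P: prob_space P by fact
  obtain N where N: "N \<in> sets P0" "emeasure P0 N = 0"
    "\<And>F. F \<in> borel_measurable P0 \<Longrightarrow>
      (\<integral>\<^sup>+x. F x * indicator (space P0 - N) x \<partial>P) = (\<integral>\<^sup>+x. F x * ennreal (a x) \<partial>P0)"
    using ac_density_nn_integral[OF ac] by blast
  have "(\<integral>\<^sup>+x. ennreal (a x) \<partial>P0) = (\<integral>\<^sup>+x. indicator (space P0 - N) x \<partial>P)"
    using N(3)[of "\<lambda>_. 1"] by simp
  also have "\<dots> \<le> (\<integral>\<^sup>+x. 1 \<partial>P)" by (intro nn_integral_mono) (auto split: split_indicator)
  also have "\<dots> = 1" by (simp add: P.emeasure_space_1)
  finally have le: "(\<integral>\<^sup>+x. ennreal (a x) \<partial>P0) \<le> 1" .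
  then show i: "integrable P0 a"
    using ac_densityD[OF ac] by (intro integrableI_bounded) (auto simp: order_le_less_trans[OF _ ennreal_one_less_top])
  have "ennreal (\<integral>x. a x \<partial>P0) \<le> 1"
    using le nn_integral_eq_integral[OF i] ac_densityD(3)[OF ac] by simp
  then show "(\<integral>x. a x \<partial>P0) \<le> 1" by (simp add: ennreal_le_1)
qed

text \<open>Replacing \<open>P\<close> by its absolutely continuous part costs at most the singular
  mass. The integrand may take values in a Banach space because the lemma serves real tests as well
  as complex exponentials.\<close>

lemma ac_density_test_integral:
  assumes ac: "ac_density P P0 a" and P: "prob_space P"
    and \<phi>: "\<phi> \<in> borel_measurable P0" "\<And>x. x \<in> space P0 \<Longrightarrow> norm (\<phi> x) \<le> 1"
  shows "norm ((\<integral>x. \<phi> x \<partial>P) - (\<integral>x. a x *\<^sub>R (\<phi> x :: 'b :: {banach, second_countable_topology}) \<partial>P0)) \<le> 1 - (\<integral>x. a x \<partial>P0)"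
    "integrable P0 (\<lambda>x. a x *\<^sub>R \<phi> x)"
proof -
  interpret P: prob_space P by fact
  obtain N where N: "N \<in> sets P0" "emeasure P0 N = 0"
    "density P (indicator (space P0 - N)) = density P0 (\<lambda>x. ennreal (a x))"
    by (rule ac_densityE_density[OF ac])
  have s: "sets P = sets P0" by (rule ac_densityD(1)[OF ac])
  then have sp: "space P = space P0" by (rule sets_eq_imp_space_eq)
  note [simp, measurable_cong] = s
  note [measurable] = ac_densityD(2)[OF ac] N(1) \<phi>(1)
  note a0 = ac_densityD(3)[OF ac]
  have ip: "integrable P \<phi>"
    by (rule P.integrable_const_bound[where B = 1]) (use \<phi>(2) sp in auto)
  have "(\<integral>x. a x *\<^sub>R \<phi> x \<partial>P0) = (\<integral>x. \<phi> x \<partial>density P0 (\<lambda>x. ennreal (a x)))"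
    using a0 by (subst integral_density) auto
  also have "\<dots> = (\<integral>x. \<phi> x \<partial>density P (\<lambda>x. ennreal (indicator (space P0 - N) x)))"
    by (simp add: N(3)[symmetric] ennreal_indicator)
  also have "\<dots> = (\<integral>x. indicator (space P0 - N) x *\<^sub>R \<phi> x \<partial>P)"
    by (subst integral_density) auto
  finally have "(\<integral>x. \<phi> x \<partial>P) - (\<integral>x. a x *\<^sub>R \<phi> x \<partial>P0) = (\<integral>x. \<phi> x - indicator (space P0 - N) x *\<^sub>R \<phi> x \<partial>P)"
    using ip by (subst Bochner_Integration.integral_diff)
      (auto intro!: integrable_mult_indicator)
  also have "norm \<dots> \<le> (\<integral>x. indicator N x \<partial>P)"
  proof (rule order_trans[OF integral_norm_bound integral_mono])
    show "integrable P (\<lambda>x. norm (\<phi> x - indicator (space P0 - N) x *\<^sub>R \<phi> x))"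
      using ip by (auto intro!: integrable_norm integrable_mult_indicator Bochner_Integration.integrable_diff)
    show "integrable P (indicator N :: _ \<Rightarrow> real)" by (simp add: P.emeasure_eq_measure)
    fix x assume "x \<in> space P"
    then show "norm (\<phi> x - indicator (space P0 - N) x *\<^sub>R \<phi> x) \<le> indicator N x"
      using \<phi>(2) sp by (auto split: split_indicator)
  qed
  also have "(\<integral>x. indicator N x \<partial>P) = measure P N"
    using sets.sets_into_space[OF N(1)] sp by (simp add: Int_absorb2)
  also have "\<dots> = 1 - (\<integral>x. a x \<partial>P0)" using ac_density_mass[OF ac P N(1,3)] by simp
  finally show "norm ((\<integral>x. \<phi> x \<partial>P) - (\<integral>x. a x *\<^sub>R \<phi> x \<partial>P0)) \<le> 1 - (\<integral>x. a x \<partial>P0)" .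
  show "integrable P0 (\<lambda>x. a x *\<^sub>R \<phi> x)"
    by (rule Bochner_Integration.integrable_bound[OF ac_density_integrable(1)[OF ac P]])
       (use \<phi> a0 in \<open>auto intro!: mult_left_le\<close>)
qed

text \<open>Each density comes with its own exceptional set. Both sets are \<open>P0\<close>-null,
  so the indicator of the complement of the other one may be inserted under \<open>P0\<close>; after
  passing to \<open>P\<close> the two indicators occur symmetrically.\<close>

lemma ac_density_unique:
  assumes ac: "ac_density P P0 a" "ac_density P P0 b" and P0: "prob_space P0"
  shows "AE x in P0. a x = b x"
proof -
  interpret P0: prob_space P0 by fact
  have s: "sets P = sets P0" by (rule ac_densityD(1)[OF ac(1)])
  then have sp: "space P = space P0" by (rule sets_eq_imp_space_eq)
  note [simp, measurable_cong] = s
  note [measurable] = ac_densityD(2)[OF ac(1)] ac_densityD(2)[OF ac(2)]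
  obtain N where N: "N \<in> sets P0" "emeasure P0 N = 0"
    "\<And>F. F \<in> borel_measurable P0 \<Longrightarrow>
      (\<integral>\<^sup>+x. F x * indicator (space P0 - N) x \<partial>P) = (\<integral>\<^sup>+x. F x * ennreal (a x) \<partial>P0)"
    using ac_density_nn_integral[OF ac(1)] by blast
  obtain N' where N': "N' \<in> sets P0" "emeasure P0 N' = 0"
    "\<And>F. F \<in> borel_measurable P0 \<Longrightarrow>
      (\<integral>\<^sup>+x. F x * indicator (space P0 - N') x \<partial>P) = (\<integral>\<^sup>+x. F x * ennreal (b x) \<partial>P0)"
    using ac_density_nn_integral[OF ac(2)] by blast
  note [measurable] = N(1) N'(1)
  have ae: "AE x in P0. x \<notin> N \<and> x \<notin> N'"
    using AE_not_in[of N P0] AE_not_in[of N' P0] N N' by (auto simp: null_sets_def)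
  have "density P0 (\<lambda>x. ennreal (a x)) = density P0 (\<lambda>x. ennreal (b x))"
  proof (rule measure_eqI)
    fix A assume "A \<in> sets (density P0 (\<lambda>x. ennreal (a x)))"
    then have [measurable]: "A \<in> sets P0" by simp
    have "(\<integral>\<^sup>+x. ennreal (a x) * indicator A x \<partial>P0)
        = (\<integral>\<^sup>+x. (indicator (space P0 - N') x * indicator A x) * ennreal (a x) \<partial>P0)"
      using ae by (intro nn_integral_cong_AE) (auto split: split_indicator)
    also have "\<dots> = (\<integral>\<^sup>+x. (indicator (space P0 - N') x * indicator A x) * indicator (space P0 - N) x \<partial>P)"
      by (subst N(3)) auto
    also have "\<dots> = (\<integral>\<^sup>+x. (indicator (space P0 - N) x * indicator A x) * indicator (space P0 - N') x \<partial>P)"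
      by (simp add: mult_ac)
    also have "\<dots> = (\<integral>\<^sup>+x. (indicator (space P0 - N) x * indicator A x) * ennreal (b x) \<partial>P0)"
      by (subst N'(3)) auto
    also have "\<dots> = (\<integral>\<^sup>+x. ennreal (b x) * indicator A x \<partial>P0)"
      using ae by (intro nn_integral_cong_AE) (auto split: split_indicator)
    finally show "emeasure (density P0 (\<lambda>x. ennreal (a x))) A = emeasure (density P0 (\<lambda>x. ennreal (b x))) A"
      by (simp add: emeasure_density)
  qed simp
  then have "AE x in P0. ennreal (a x) = ennreal (b x)"
    by (subst (asm) P0.density_unique_iff) auto
  then show ?thesis
    using ac_densityD(3)[OF ac(1)] ac_densityD(3)[OF ac(2)] by auto
qed

lemma ac_density_refl: "ac_density P P (\<lambda>_. 1)"
  unfolding ac_density_def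
proof (intro conjI bexI[of _ "{}"])
  show "density P (indicator (space P - {})) = density P (\<lambda>x. ennreal 1)"
    by (rule density_cong) auto
qed auto

lemma ac_density_pair:
  assumes ac: "ac_density P P0 a" "ac_density Q Q0 b"
    and P: "prob_space P" "prob_space P0" and Q: "prob_space Q" "prob_space Q0"
  shows "ac_density (P \<Otimes>\<^sub>M Q) (P0 \<Otimes>\<^sub>M Q0) (\<lambda>\<omega>. a (fst \<omega>) * b (snd \<omega>))"
proof -
  interpret P: prob_space P by fact
  interpret P0: prob_space P0 by fact
  interpret Q: prob_space Q by fact
  interpret Q0: prob_space Q0 by fact
  note s = ac_densityD(1)[OF ac(1)] ac_densityD(1)[OF ac(2)]
  note sp = s[THEN sets_eq_imp_space_eq]
  note [simp, measurable_cong] = s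
  note [measurable] = ac_densityD(2)[OF ac(1)] ac_densityD(2)[OF ac(2)]
  note a0 = ac_densityD(3)[OF ac(1)] and b0 = ac_densityD(3)[OF ac(2)]
  obtain N where N: "N \<in> sets P0" "emeasure P0 N = 0"
    "density P (indicator (space P0 - N)) = density P0 (\<lambda>x. ennreal (a x))"
    by (rule ac_densityE_density[OF ac(1)])
  obtain N' where N': "N' \<in> sets Q0" "emeasure Q0 N' = 0"
    "density Q (indicator (space Q0 - N')) = density Q0 (\<lambda>x. ennreal (b x))"
    by (rule ac_densityE_density[OF ac(2)])
  note [measurable] = N(1) N'(1)
  let ?N = "N \<times> space Q0 \<union> space P0 \<times> N'"
  have fin: "sigma_finite_measure (density Q0 (\<lambda>x. ennreal (b x)))"
    unfolding N'(3)[symmetric] using N'(1)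
    by (intro finite_measure.sigma_finite_measure Q.finite_measure_restricted) auto
  have "emeasure (P0 \<Otimes>\<^sub>M Q0) ?N \<le> emeasure (P0 \<Otimes>\<^sub>M Q0) (N \<times> space Q0) + emeasure (P0 \<Otimes>\<^sub>M Q0) (space P0 \<times> N')"
    by (intro emeasure_subadditive) auto
  also have "\<dots> = 0" by (simp add: Q0.emeasure_pair_measure_Times N(2) N'(2))
  finally have null: "emeasure (P0 \<Otimes>\<^sub>M Q0) ?N = 0" by simp
  have "density (P \<Otimes>\<^sub>M Q) (indicator (space (P0 \<Otimes>\<^sub>M Q0) - ?N))
      = density (P \<Otimes>\<^sub>M Q) (\<lambda>(x, y). indicator (space P0 - N) x * indicator (space Q0 - N') y)"
    by (rule density_cong) (auto intro!: AE_I2 simp: space_pair_measure sp indicator_def)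
  also have "\<dots> = density P (indicator (space P0 - N)) \<Otimes>\<^sub>M density Q (indicator (space Q0 - N'))"
    by (rule pair_measure_density[symmetric]) (auto simp: Q.sigma_finite_measure N'(3) fin)
  also have "\<dots> = density P0 (\<lambda>x. ennreal (a x)) \<Otimes>\<^sub>M density Q0 (\<lambda>x. ennreal (b x))"
    by (simp only: N(3) N'(3))
  also have "\<dots> = density (P0 \<Otimes>\<^sub>M Q0) (\<lambda>(x, y). ennreal (a x) * ennreal (b y))"
    by (rule pair_measure_density) (auto simp: Q0.sigma_finite_measure fin)
  also have "\<dots> = density (P0 \<Otimes>\<^sub>M Q0) (\<lambda>\<omega>. ennreal (a (fst \<omega>) * b (snd \<omega>)))"
    by (rule density_cong) (auto simp: ennreal_mult a0 b0)
  finally show ?thesis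
    unfolding ac_density_def using null a0 b0 s
    by (auto intro!: bexI[of _ ?N] sets_pair_measure_cong)
qed

text \<open>Change of measure one coordinate at a time. Its use has the indicator of the complement
  of the exceptional set as \<open>u\<close> and the density as \<open>v\<close>. The integrand
  \<open>F\<close> is arbitrary because the induction step applies the hypothesis to a partial
  integral of \<open>F\<close>.\<close>

lemma nn_integral_PiM_change:
  fixes u v :: "'a \<Rightarrow> ennreal"
  assumes P: "prob_space P" "prob_space P0" and s: "sets P = sets P0"
    and uv: "u \<in> borel_measurable P0" "v \<in> borel_measurable P0"
    and eq: "\<And>G. G \<in> borel_measurable P0 \<Longrightarrow> (\<integral>\<^sup>+x. G x * u x \<partial>P) = (\<integral>\<^sup>+x. G x * v x \<partial>P0)"
    and I: "finite I"
    and F: "F \<in> borel_measurable (PiM I (\<lambda>_. P0))"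
  shows "(\<integral>\<^sup>+\<omega>. F \<omega> * (\<Prod>i\<in>I. u (\<omega> i)) \<partial>PiM I (\<lambda>_. P)) = (\<integral>\<^sup>+\<omega>. F \<omega> * (\<Prod>i\<in>I. v (\<omega> i)) \<partial>PiM I (\<lambda>_. P0))"
  using I F
proof (induction I arbitrary: F)
  case empty
  have "space P \<noteq> {}" "space P0 \<noteq> {}" using P by (auto simp: prob_space.not_empty)
  then show ?case by (simp add: PiM_empty nn_integral_count_space_finite)
next
  case (insert i I)
  interpret P: prob_space P by fact
  interpret P0: prob_space P0 by fact
  interpret S: product_sigma_finite "\<lambda>_. P"
    by (simp add: product_sigma_finite_def P.sigma_finite_measure)
  interpret S0: product_sigma_finite "\<lambda>_. P0"
    by (simp add: product_sigma_finite_def P0.sigma_finite_measure)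
  note [simp, measurable_cong] = s sets_PiM_cong[OF refl s]
  note [measurable] = uv insert.prems
  note [simp] = insert.hyps
  have p: "(\<Prod>j\<in>I. u ((x(i := y)) j)) = (\<Prod>j\<in>I. u (x j))" "(\<Prod>j\<in>I. v ((x(i := y)) j)) = (\<Prod>j\<in>I. v (x j))" for x y
    using insert.hyps by (auto intro!: prod.cong)
  have m1: "(\<lambda>y. F (x(i := y))) \<in> borel_measurable P0" if "x \<in> space (PiM I (\<lambda>_. P0))" for x
    using that by measurable
  have sp: "space (PiM I (\<lambda>_. P)) = space (PiM I (\<lambda>_. P0))"
    by (rule sets_eq_imp_space_eq) simp
  have "(\<integral>\<^sup>+\<omega>. F \<omega> * (\<Prod>i\<in>insert i I. u (\<omega> i)) \<partial>PiM (insert i I) (\<lambda>_. P))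
      = (\<integral>\<^sup>+x. \<integral>\<^sup>+y. F (x(i := y)) * (u y * (\<Prod>j\<in>I. u (x j))) \<partial>P \<partial>PiM I (\<lambda>_. P))"
    by (subst S.product_nn_integral_insert) (auto simp: p simp del: fun_upd_apply simp add: fun_upd_same)
  also have "\<dots> = (\<integral>\<^sup>+x. (\<integral>\<^sup>+y. F (x(i := y)) * u y \<partial>P) * (\<Prod>j\<in>I. u (x j)) \<partial>PiM I (\<lambda>_. P))"
    using m1 by (intro nn_integral_cong) (simp add: nn_integral_multc sp flip: mult.assoc)
  also have "\<dots> = (\<integral>\<^sup>+x. (\<integral>\<^sup>+y. F (x(i := y)) * v y \<partial>P0) * (\<Prod>j\<in>I. u (x j)) \<partial>PiM I (\<lambda>_. P))"
    using m1 by (intro nn_integral_cong) (simp add: sp eq)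
  also have "\<dots> = (\<integral>\<^sup>+x. (\<integral>\<^sup>+y. F (x(i := y)) * v y \<partial>P0) * (\<Prod>j\<in>I. v (x j)) \<partial>PiM I (\<lambda>_. P0))"
    by (rule insert.IH) measurable
  also have "\<dots> = (\<integral>\<^sup>+x. \<integral>\<^sup>+y. F (x(i := y)) * (v y * (\<Prod>j\<in>I. v (x j))) \<partial>P0 \<partial>PiM I (\<lambda>_. P0))"
    using m1 by (intro nn_integral_cong) (simp add: nn_integral_multc flip: mult.assoc)
  also have "\<dots> = (\<integral>\<^sup>+\<omega>. F \<omega> * (\<Prod>i\<in>insert i I. v (\<omega> i)) \<partial>PiM (insert i I) (\<lambda>_. P0))"
    by (subst S0.product_nn_integral_insert) (auto simp: p simp del: fun_upd_apply simp add: fun_upd_same)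
  finally show ?case .
qed

lemma ac_density_PiM:
  assumes ac: "ac_density P P0 a" and P: "prob_space P" "prob_space P0" and I: "finite I"
  shows "ac_density (PiM I (\<lambda>_. P)) (PiM I (\<lambda>_. P0)) (\<lambda>\<omega>. \<Prod>i\<in>I. a (\<omega> i))"
proof -
  interpret P: prob_space P by fact
  interpret P0: prob_space P0 by fact
  note s = ac_densityD(1)[OF ac]
  note [simp, measurable_cong] = s sets_PiM_cong[OF refl s]
  note [measurable] = ac_densityD(2)[OF ac]
  note a0 = ac_densityD(3)[OF ac]
  obtain N where N: "N \<in> sets P0" "emeasure P0 N = 0"
    "\<And>F. F \<in> borel_measurable P0 \<Longrightarrow>
      (\<integral>\<^sup>+x. F x * indicator (space P0 - N) x \<partial>P) = (\<integral>\<^sup>+x. F x * ennreal (a x) \<partial>P0)"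
    using ac_density_nn_integral[OF ac] by blast
  note [measurable] = N(1)
  let ?M = "PiM I (\<lambda>_. P0)" and ?M' = "PiM I (\<lambda>_. P)"
  let ?N = "{\<omega> \<in> space ?M. \<exists>i\<in>I. \<omega> i \<in> N}"
  have sp: "space ?M' = space ?M" by (rule sets_eq_imp_space_eq) simp
  have N_sets [measurable]: "?N \<in> sets ?M" using I by measurable
  have "AE \<omega> in ?M. \<forall>i\<in>I. \<omega> i \<notin> N"
  proof (rule AE_finite_allI[OF I])
    fix i assume "i \<in> I"
    have "AE x in P0. x \<notin> N" using AE_not_in[of N P0] N by (auto simp: null_sets_def)
    then show "AE \<omega> in ?M. \<omega> i \<notin> N"
      by (rule AE_PiM_component[of I "\<lambda>_. P0" i, OF P0.prob_space_axioms \<open>i \<in> I\<close>])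
  qed
  then have null: "emeasure ?M ?N = 0"
    by (subst AE_iff_measurable[OF N_sets, symmetric, where P = "\<lambda>\<omega>. \<forall>i\<in>I. \<omega> i \<notin> N"]) auto
  have "density ?M' (indicator (space ?M - ?N)) = density ?M (\<lambda>\<omega>. ennreal (\<Prod>i\<in>I. a (\<omega> i)))"
  proof (rule measure_eqI)
    fix A assume "A \<in> sets (density ?M' (indicator (space ?M - ?N)))"
    then have A [measurable]: "A \<in> sets ?M" by simp
    have "emeasure (density ?M' (indicator (space ?M - ?N))) A
        = (\<integral>\<^sup>+\<omega>. indicator A \<omega> * (\<Prod>i\<in>I. indicator (space P0 - N) (\<omega> i)) \<partial>?M')"
      using A sets.sets_into_space[OF A] I
      by (subst emeasure_density)
         (auto intro!: nn_integral_cong simp: prod_zero_iff sp space_PiM PiE_iff prod.neutral split: split_indicator)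
    also have "\<dots> = (\<integral>\<^sup>+\<omega>. indicator A \<omega> * (\<Prod>i\<in>I. ennreal (a (\<omega> i))) \<partial>?M)"
      by (rule nn_integral_PiM_change[OF P s _ _ _ I]) (auto simp: N(3))
    also have "\<dots> = emeasure (density ?M (\<lambda>\<omega>. ennreal (\<Prod>i\<in>I. a (\<omega> i)))) A"
      by (subst emeasure_density) (auto intro!: nn_integral_cong simp: prod_ennreal a0 mult.commute)
    finally show "emeasure (density ?M' (indicator (space ?M - ?N))) A
        = emeasure (density ?M (\<lambda>\<omega>. ennreal (\<Prod>i\<in>I. a (\<omega> i)))) A" .
  qed simp
  then show ?thesis
    unfolding ac_density_def using null a0 by (auto intro!: bexI[of _ ?N] prod_nonneg)
qed

text \<open>Lebesgue decomposition, via Radon--Nikodym derivatives with respect to \<open>P + P0\<close>.\<close>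

lemma ac_density_exists:
  assumes P: "prob_space P" "prob_space P0" and s: "sets P = sets P0"
  shows "\<exists>a. ac_density P P0 a"
proof -
  interpret P: prob_space P by fact
  interpret P0: prob_space P0 by fact
  note sp = sets_eq_imp_space_eq[OF s]
  \<comment> \<open>The sum of the two measures dominates both, so Radon-Nikodym applies to each of
    them.\<close>
  define \<mu> where "\<mu> = measure_of (space P0) (sets P0) (\<lambda>A. emeasure P A + emeasure P0 A)"
  have s\<mu> [simp, measurable_cong]: "sets \<mu> = sets P0" and sp\<mu> [simp]: "space \<mu> = space P0"
    by (auto simp: \<mu>_def sets.sets_measure_of_eq)
  note [simp, measurable_cong] = s
  have em: "emeasure \<mu> A = emeasure P A + emeasure P0 A" if "A \<in> sets P0" for A
    unfolding \<mu>_def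
  proof (rule emeasure_measure_of_sigma)
    show "sigma_algebra (space P0) (sets P0)" by (rule sets.sigma_algebra_axioms)
    show "positive (sets P0) (\<lambda>A. emeasure P A + emeasure P0 A)" by (simp add: positive_def)
    show "countably_additive (sets P0) (\<lambda>A. emeasure P A + emeasure P0 A)"
    proof (rule countably_additiveI)
      fix A :: "nat \<Rightarrow> 'a set"
      assume A: "range A \<subseteq> sets P0" "disjoint_family A"
      show "(\<Sum>i. emeasure P (A i) + emeasure P0 (A i)) = emeasure P (\<Union>i. A i) + emeasure P0 (\<Union>i. A i)"
        using A s by (simp add: suminf_emeasure flip: suminf_add)
    qed
  qed fact
  interpret \<mu>: finite_measure \<mu>
    by (rule finite_measureI) (simp add: em sp[symmetric] P.emeasure_space_1 del: sp\<mu>, simp add: em P0.emeasure_space_1 P.emeasure_space_1[unfolded sp])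
  have dens: "\<exists>p. p \<in> borel_measurable P0 \<and> (\<forall>x. 0 \<le> p x) \<and> R = density \<mu> (\<lambda>x. ennreal (p x))"
    if R: "prob_space R" "sets R = sets P0" and le: "\<And>A. A \<in> sets P0 \<Longrightarrow> emeasure R A \<le> emeasure \<mu> A" for R
  proof -
    interpret R: prob_space R by fact
    have sR: "sets R = sets \<mu>" using R(2) by simp
    have ac: "absolutely_continuous \<mu> R"
      unfolding absolutely_continuous_def
    proof
      fix A assume "A \<in> null_sets \<mu>"
      then show "A \<in> null_sets R" using le[of A] R(2) by (auto simp: null_sets_def)
    qed
    obtain D where "AE x in \<mu>. RN_deriv \<mu> R x = ennreal (D x)"
      using \<mu>.real_RN_deriv[OF R.finite_measure_axioms ac sR] by blast
    then have ae: "AE x in \<mu>. RN_deriv \<mu> R x = ennreal (enn2real (RN_deriv \<mu> R x))" by auto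
    define p where "p x = enn2real (RN_deriv \<mu> R x)" for x
    have p: "p \<in> borel_measurable \<mu>" unfolding p_def by measurable
    have "R = density \<mu> (RN_deriv \<mu> R)" using \<mu>.density_RN_deriv[OF ac] R(2) by simp
    also have "\<dots> = density \<mu> (\<lambda>x. ennreal (p x))"
      using p ae by (intro density_cong) (auto simp: p_def)
    finally show ?thesis using p by (auto intro!: exI[of _ p] simp: p_def)
  qed
  obtain p where [measurable]: "p \<in> borel_measurable P0" and p0: "\<And>x. 0 \<le> p x"
    and p: "P = density \<mu> (\<lambda>x. ennreal (p x))"
  proof -
    have "\<exists>p. p \<in> borel_measurable P0 \<and> (\<forall>x. 0 \<le> p x) \<and> P = density \<mu> (\<lambda>x. ennreal (p x))"
      by (rule dens[OF P(1) s]) (simp add: em)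
    then show ?thesis by (elim exE conjE) (rule that; (assumption | erule spec))
  qed
  obtain q where [measurable]: "q \<in> borel_measurable P0" and q0: "\<And>x. 0 \<le> q x"
    and q: "P0 = density \<mu> (\<lambda>x. ennreal (q x))"
  proof -
    have "\<exists>p. p \<in> borel_measurable P0 \<and> (\<forall>x. 0 \<le> p x) \<and> P0 = density \<mu> (\<lambda>x. ennreal (p x))"
      by (rule dens[OF P(2) refl]) (simp add: em)
    then show ?thesis by (elim exE conjE) (rule that; (assumption | erule spec))
  qed
  let ?N = "{x \<in> space P0. q x = 0}"
  have "emeasure P0 ?N = emeasure (density \<mu> (\<lambda>x. ennreal (q x))) ?N" by (simp only: q[symmetric])
  also have "\<dots> = (\<integral>\<^sup>+x. 0 \<partial>\<mu>)"
    by (subst emeasure_density) (auto intro!: nn_integral_cong simp del: nn_integral_const split: split_indicator)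
  finally have null: "emeasure P0 ?N = 0" by simp
  have "density P (indicator (space P0 - ?N)) = density (density \<mu> (\<lambda>x. ennreal (p x))) (indicator (space P0 - ?N))"
    by (simp only: p[symmetric])
  also have "\<dots> = density \<mu> (\<lambda>x. ennreal (p x) * indicator (space P0 - ?N) x)"
    by (rule density_density_eq) auto
  \<comment> \<open>On the exceptional set \<open>q\<close> vanishes, so both sides are 0 there
    whatever value the division by zero takes.\<close>
  also have "\<dots> = density \<mu> (\<lambda>x. ennreal (q x) * ennreal (p x / q x))"
    by (rule density_cong) (auto split: split_indicator simp: p0 q0 simp flip: ennreal_mult)
  also have "\<dots> = density (density \<mu> (\<lambda>x. ennreal (q x))) (\<lambda>x. ennreal (p x / q x))"
    by (rule density_density_eq[symmetric]) auto
  also have "\<dots> = density P0 (\<lambda>x. ennreal (p x / q x))" by (simp only: q[symmetric])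
  finally have "ac_density P P0 (\<lambda>x. p x / q x)"
    unfolding ac_density_def using null p0 q0 by (auto intro!: bexI[of _ ?N])
  then show ?thesis by blast
qed

text \<open>Passage from the density quotient of the definitions to a real-valued density; the set
  where \<open>L\<close> is infinite is the exceptional set and carries the singular part.\<close>

lemma density_quotient_imp_ac_density:
  assumes L: "is_density_quotient P P0 L" and P0: "prob_space P0" and s: "sets P = sets P0"
  shows "ac_density P P0 (\<lambda>x. enn2real (L x))"
    "prob_space P \<Longrightarrow> measure P {x \<in> space P0. L x = \<infinity>} = 1 - (\<integral>x. enn2real (L x) \<partial>P0)"
proof -
  interpret P0: prob_space P0 by fact
  note [simp, measurable_cong] = s
  have [measurable]: "L \<in> borel_measurable P0"
    and eq: "\<And>A. A \<in> sets P0 \<Longrightarrow> emeasure P A =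
        (\<integral>\<^sup>+x\<in>A. L x \<partial>P0) + emeasure P (A \<inter> {x \<in> space P0. L x = \<infinity>})"
    and one: "emeasure P0 {x \<in> space P0. L x < \<infinity>} = 1"
    using L by (auto simp: is_density_quotient_def)
  let ?N = "{x \<in> space P0. L x = \<infinity>}"
  have ae: "AE x in P0. L x < \<infinity>"
    by (rule P0.AE_prob_1[of "{x \<in> space P0. L x < \<infinity>}", THEN AE_mp]) (use one in \<open>auto simp: P0.emeasure_eq_measure\<close>)
  then have null: "emeasure P0 ?N = 0"
    by (subst AE_iff_measurable[symmetric, where P = "\<lambda>x. L x < \<infinity>"]) (auto simp: not_less top_unique)
  have N_sets: "?N \<in> sets P0" by simp
  have d: "density P (indicator (space P0 - ?N)) = density P0 (\<lambda>x. ennreal (enn2real (L x)))"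
  proof (rule measure_eqI)
    fix A assume "A \<in> sets (density P (indicator (space P0 - ?N)))"
    then have A [measurable]: "A \<in> sets P0" by simp
    have "emeasure (density P (indicator (space P0 - ?N))) A = (\<integral>\<^sup>+x. indicator (A - ?N) x \<partial>P)"
      using sets.sets_into_space[OF A]
      by (subst emeasure_density) (auto intro!: nn_integral_cong simp del: nn_integral_indicator split: split_indicator)
    also have "\<dots> = emeasure P (A - ?N)" by (rule nn_integral_indicator) simp
    also have "\<dots> = (\<integral>\<^sup>+x\<in>A - ?N. L x \<partial>P0)"
    proof -
      have "(A - ?N) \<inter> ?N = {}" by blast
      then show ?thesis by (simp only: eq[of "A - ?N"] sets.Diff[OF A N_sets] emeasure_empty add_0_right)
    qed
    also have "\<dots> = (\<integral>\<^sup>+x. ennreal (enn2real (L x)) * indicator A x \<partial>P0)"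
      using ae by (intro nn_integral_cong_AE) (auto split: split_indicator)
    also have "\<dots> = emeasure (density P0 (\<lambda>x. ennreal (enn2real (L x)))) A"
      by (subst emeasure_density) auto
    finally show "emeasure (density P (indicator (space P0 - ?N))) A
       = emeasure (density P0 (\<lambda>x. ennreal (enn2real (L x)))) A" .
  qed simp
  show ac: "ac_density P P0 (\<lambda>x. enn2real (L x))"
    unfolding ac_density_def using null d by (auto intro!: bexI[of _ ?N])
  assume "prob_space P"
  from ac_density_mass[OF ac this _ d] show "measure P ?N = 1 - (\<integral>x. enn2real (L x) \<partial>P0)" by simp
qed

text \<open>The way back, needed to exhibit newly built curves as L2-differentiable. The value
  infinity on the exceptional set records the singular part; \<open>enn2real\<close> sends it to 0,
  hence equality only almost everywhere.\<close>

lemma ac_density_imp_density_quotient: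
  assumes ac: "ac_density P P0 a" and P: "prob_space P" "prob_space P0"
  obtains L where "is_density_quotient P P0 L" "AE x in P0. enn2real (L x) = a x"
proof -
  interpret P: prob_space P by fact
  interpret P0: prob_space P0 by fact
  note s = ac_densityD(1)[OF ac]
  note [simp, measurable_cong] = s
  note [measurable] = ac_densityD(2)[OF ac]
  obtain N where N: "N \<in> sets P0" "emeasure P0 N = 0"
    "\<And>F. F \<in> borel_measurable P0 \<Longrightarrow>
      (\<integral>\<^sup>+x. F x * indicator (space P0 - N) x \<partial>P) = (\<integral>\<^sup>+x. F x * ennreal (a x) \<partial>P0)"
    using ac_density_nn_integral[OF ac] by blast
  note [measurable] = N(1)
  have ae: "AE x in P0. x \<notin> N" using AE_not_in[of N P0] N by (auto simp: null_sets_def)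
  define L where "L x = (if x \<in> N then \<infinity> else ennreal (a x))" for x
  have [measurable]: "L \<in> borel_measurable P0" unfolding L_def by measurable
  have inf: "{x \<in> space P0. L x = \<infinity>} = N" using sets.sets_into_space[OF N(1)] by (auto simp: L_def)
  show ?thesis
  proof
    show "is_density_quotient P P0 L"
      unfolding is_density_quotient_def inf
    proof (intro conjI ballI)
      fix A assume A [measurable]: "A \<in> sets P0"
      have "(\<integral>\<^sup>+x\<in>A. L x \<partial>P0) = (\<integral>\<^sup>+x. indicator A x * ennreal (a x) \<partial>P0)"
        using ae by (intro nn_integral_cong_AE) (auto simp: L_def split: split_indicator)
      also have "\<dots> = (\<integral>\<^sup>+x. indicator A x * indicator (space P0 - N) x \<partial>P)" by (subst N(3)) auto
      also have "\<dots> = (\<integral>\<^sup>+x. indicator (A - N) x \<partial>P)"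
        using sets.sets_into_space[OF A] by (intro nn_integral_cong) (auto split: split_indicator)
      also have "\<dots> = emeasure P (A - N)" by (rule nn_integral_indicator) simp
      finally have "(\<integral>\<^sup>+x\<in>A. L x \<partial>P0) = emeasure P (A - N)" .
      moreover have "emeasure P A = emeasure P (A - N) + emeasure P (A \<inter> N)"
        by (subst plus_emeasure) (auto intro!: arg_cong[where f = "emeasure P"])
      ultimately show "emeasure P A = (\<integral>\<^sup>+x\<in>A. L x \<partial>P0) + emeasure P (A \<inter> N)" by simp
    next
      have "AE x in P0. x \<in> {x \<in> space P0. L x < \<infinity>}"
        using ae by (auto simp: L_def)
      then show "emeasure P0 {x \<in> space P0. L x < \<infinity>} = 1"
        by (subst P0.emeasure_eq_1_AE) auto
    qed simp
    show "AE x in P0. enn2real (L x) = a x"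
      using ae ac_densityD(3)[OF ac] by (auto simp: L_def)
  qed
qed

section \<open>Hellinger differentiability of product measures\<close>

lemma pair_integral_mult:
  fixes f :: "'a \<Rightarrow> 'c :: {real_normed_field, banach, second_countable_topology}" and g :: "'b \<Rightarrow> 'c"
  assumes P: "prob_space P" and Q: "prob_space Q" and f: "integrable P f" and g: "integrable Q g"
  shows "integrable (P \<Otimes>\<^sub>M Q) (\<lambda>\<omega>. f (fst \<omega>) * g (snd \<omega>))"
    "(\<integral>\<omega>. f (fst \<omega>) * g (snd \<omega>) \<partial>(P \<Otimes>\<^sub>M Q)) = (\<integral>x. f x \<partial>P) * (\<integral>y. g y \<partial>Q)"
proof -
  interpret P: prob_space P by fact
  interpret Q: prob_space Q by fact
  interpret PQ: pair_sigma_finite P Q ..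
  note [measurable] = borel_measurable_integrable[OF f] borel_measurable_integrable[OF g]
  show i: "integrable (P \<Otimes>\<^sub>M Q) (\<lambda>\<omega>. f (fst \<omega>) * g (snd \<omega>))"
  proof (rule PQ.Fubini_integrable)
    show "integrable P (\<lambda>x. \<integral>y. norm (f (fst (x, y)) * g (snd (x, y))) \<partial>Q)"
      using f by (simp add: norm_mult)
    show "AE x in P. integrable Q (\<lambda>y. f (fst (x, y)) * g (snd (x, y)))"
      using g by simp
  qed simp
  have "(\<integral>\<omega>. f (fst \<omega>) * g (snd \<omega>) \<partial>(P \<Otimes>\<^sub>M Q)) = (\<integral>x. \<integral>y. f x * g y \<partial>Q \<partial>P)"
    using PQ.integral_fst'[OF i] by simp
  then show "(\<integral>\<omega>. f (fst \<omega>) * g (snd \<omega>) \<partial>(P \<Otimes>\<^sub>M Q)) = (\<integral>x. f x \<partial>P) * (\<integral>y. g y \<partial>Q)"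
    by simp
qed

lemma pair_L2_mult:
  assumes P: "prob_space P" and Q: "prob_space Q" and f: "f \<in> L2 P" and g: "g \<in> L2 Q"
  shows "(\<lambda>\<omega>. f (fst \<omega>) * g (snd \<omega>)) \<in> L2 (P \<Otimes>\<^sub>M Q)"
    "L2_norm (P \<Otimes>\<^sub>M Q) (\<lambda>\<omega>. f (fst \<omega>) * g (snd \<omega>)) = L2_norm P f * L2_norm Q g"
  using pair_integral_mult[OF P Q L2_integrable_square[OF f] L2_integrable_square[OF g]]
    L2_measurable[OF f] L2_measurable[OF g]
  by (auto simp: L2_def L2_norm_def power_mult_distrib real_sqrt_mult)

lemma pair_L2_fst:
  assumes P: "prob_space P" and Q: "prob_space Q" and f: "f \<in> L2 P"
  shows "(\<lambda>\<omega>. f (fst \<omega>)) \<in> L2 (P \<Otimes>\<^sub>M Q)"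
    "L2_norm (P \<Otimes>\<^sub>M Q) (\<lambda>\<omega>. f (fst \<omega>)) = L2_norm P f"
proof -
  interpret Q: prob_space Q by fact
  show "(\<lambda>\<omega>. f (fst \<omega>)) \<in> L2 (P \<Otimes>\<^sub>M Q)" "L2_norm (P \<Otimes>\<^sub>M Q) (\<lambda>\<omega>. f (fst \<omega>)) = L2_norm P f"
    using pair_L2_mult[OF P Q f Q.L2_const[of 1]] by (auto simp: Q.L2_norm_const)
qed

lemma pair_L2_snd:
  assumes P: "prob_space P" and Q: "prob_space Q" and g: "g \<in> L2 Q"
  shows "(\<lambda>\<omega>. g (snd \<omega>)) \<in> L2 (P \<Otimes>\<^sub>M Q)"
    "L2_norm (P \<Otimes>\<^sub>M Q) (\<lambda>\<omega>. g (snd \<omega>)) = L2_norm Q g"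
proof -
  interpret P: prob_space P by fact
  show "(\<lambda>\<omega>. g (snd \<omega>)) \<in> L2 (P \<Otimes>\<^sub>M Q)" "L2_norm (P \<Otimes>\<^sub>M Q) (\<lambda>\<omega>. g (snd \<omega>)) = L2_norm Q g"
    using pair_L2_mult[OF P Q P.L2_const[of 1] g] by (auto simp: P.L2_norm_const)
qed

lemma L2_tendsto_fst:
  assumes P: "prob_space P" and Q: "prob_space Q" and D: "L2_tendsto P F D G"
  shows "L2_tendsto (P \<Otimes>\<^sub>M Q) F (\<lambda>i \<omega>. D i (fst \<omega>)) (\<lambda>\<omega>. G (fst \<omega>))"
  using L2_tendstoD[OF D] pair_L2_fst(1)[OF P Q] pair_L2_fst(2)[OF P Q L2_diff[OF L2_tendstoD(1,2)[OF D]]]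
  by (simp add: L2_tendsto_def)

lemma L2_tendsto_snd:
  assumes P: "prob_space P" and Q: "prob_space Q" and D: "L2_tendsto Q F D G"
  shows "L2_tendsto (P \<Otimes>\<^sub>M Q) F (\<lambda>i \<omega>. D i (snd \<omega>)) (\<lambda>\<omega>. G (snd \<omega>))"
  using L2_tendstoD[OF D] pair_L2_snd(1)[OF P Q] pair_L2_snd(2)[OF P Q L2_diff[OF L2_tendstoD(1,2)[OF D]]]
  by (simp add: L2_tendsto_def)

lemma L2_tendsto_swap:
  assumes P: "prob_space P" and Q: "prob_space Q" and D: "L2_tendsto (P \<Otimes>\<^sub>M Q) F D G"
  shows "L2_tendsto (Q \<Otimes>\<^sub>M P) F (\<lambda>i \<omega>. D i (snd \<omega>, fst \<omega>)) (\<lambda>\<omega>. G (snd \<omega>, fst \<omega>))"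
proof -
  interpret P: prob_space P by fact
  interpret Q: prob_space Q by fact
  interpret PQ: pair_sigma_finite P Q ..
  interpret QP: pair_sigma_finite Q P ..
  have L: "(\<lambda>\<omega>. f (snd \<omega>, fst \<omega>)) \<in> L2 (Q \<Otimes>\<^sub>M P)" if f: "f \<in> L2 (P \<Otimes>\<^sub>M Q)" for f
    using PQ.integrable_product_swap[OF L2_integrable_square[OF f]] L2_measurable[OF f]
    by (auto simp: L2_def split_beta')
  have n: "L2_norm (Q \<Otimes>\<^sub>M P) (\<lambda>\<omega>. f (snd \<omega>, fst \<omega>)) = L2_norm (P \<Otimes>\<^sub>M Q) f" if f: "f \<in> L2 (P \<Otimes>\<^sub>M Q)" for f
    using PQ.integral_product_swap[of "\<lambda>\<omega>. (f \<omega>)\<^sup>2"] L2_measurable[OF f]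
    by (simp add: L2_norm_def split_beta')
  show ?thesis
    using L2_tendstoD[OF D] L n[OF L2_diff[OF L2_tendstoD(1,2)[OF D]]]
    by (auto simp: L2_tendsto_def)
qed

text \<open>Jensen's inequality in each section, as Cauchy-Schwarz against the constant 1.
  Integrating out a coordinate is thus a contraction, which lets L2 limits pass to
  marginals.\<close>

lemma marginal_L2:
  assumes P: "prob_space P" and Q: "prob_space Q" and f: "f \<in> L2 (P \<Otimes>\<^sub>M Q)"
  shows "(\<lambda>x. \<integral>y. f (x, y) \<partial>Q) \<in> L2 P"
    "L2_norm P (\<lambda>x. \<integral>y. f (x, y) \<partial>Q) \<le> L2_norm (P \<Otimes>\<^sub>M Q) f"
    "AE x in P. integrable Q (\<lambda>y. f (x, y))"
proof -
  interpret P: prob_space P by fact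
  interpret Q: prob_space Q by fact
  interpret PQ: pair_sigma_finite P Q ..
  note [measurable] = L2_measurable[OF f]
  have i: "integrable P (\<lambda>x. \<integral>y. (f (x, y))\<^sup>2 \<partial>Q)"
    using PQ.integrable_fst'[OF L2_integrable_square[OF f]] .
  have ae: "AE x in P. integrable Q (\<lambda>y. (f (x, y))\<^sup>2)"
    using PQ.AE_integrable_fst'[OF L2_integrable_square[OF f]] .
  have sec: "AE x in P. (\<lambda>y. f (x, y)) \<in> L2 Q"
    using ae AE_space by eventually_elim (auto simp: L2_def)
  show int: "AE x in P. integrable Q (\<lambda>y. f (x, y))"
    using sec by eventually_elim (rule Q.L2_imp_integrable)
  have le: "AE x in P. (\<integral>y. f (x, y) \<partial>Q)\<^sup>2 \<le> (\<integral>y. (f (x, y))\<^sup>2 \<partial>Q)"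
    using sec
  proof eventually_elim
    case (elim x)
    have "\<bar>\<integral>y. f (x, y) \<partial>Q\<bar> \<le> \<bar>L2_norm Q (\<lambda>y. f (x, y))\<bar>"
      using Q.abs_integral_le_L2_norm[OF elim] by simp
    then have "(\<integral>y. f (x, y) \<partial>Q)\<^sup>2 \<le> (L2_norm Q (\<lambda>y. f (x, y)))\<^sup>2"
      by (rule abs_le_square_iff[THEN iffD1])
    then show ?case by (simp only: L2_norm_power2)
  qed
  have i2: "integrable P (\<lambda>x. (\<integral>y. f (x, y) \<partial>Q)\<^sup>2)"
    by (rule Bochner_Integration.integrable_bound[OF i]) (use le in \<open>auto elim!: eventually_mono\<close>)
  then show "(\<lambda>x. \<integral>y. f (x, y) \<partial>Q) \<in> L2 P"
    by (auto simp: L2_def)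
  show "L2_norm P (\<lambda>x. \<integral>y. f (x, y) \<partial>Q) \<le> L2_norm (P \<Otimes>\<^sub>M Q) f"
    unfolding L2_norm_def PQ.integral_fst'[OF L2_integrable_square[OF f], symmetric]
    by (intro real_sqrt_le_mono integral_mono_AE i i2 le)
qed

lemma L2_tendsto_marginal:
  assumes P: "prob_space P" and Q: "prob_space Q" and D: "L2_tendsto (P \<Otimes>\<^sub>M Q) F D G"
  shows "L2_tendsto P F (\<lambda>i x. \<integral>y. D i (x, y) \<partial>Q) (\<lambda>x. \<integral>y. G (x, y) \<partial>Q)"
proof (rule L2_tendsto_bound[OF _ _ L2_tendstoD(3)[OF D]])
  note m = marginal_L2[OF P Q]
  show "\<forall>\<^sub>F i in F. L2_norm P (\<lambda>x. (\<integral>y. D i (x, y) \<partial>Q) - (\<integral>y. G (x, y) \<partial>Q))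
      \<le> L2_norm (P \<Otimes>\<^sub>M Q) (\<lambda>x. D i x - G x)"
  proof (intro always_eventually allI)
    fix i
    have "AE x in P. (\<integral>y. D i (x, y) \<partial>Q) - (\<integral>y. G (x, y) \<partial>Q) = (\<integral>y. D i (x, y) - G (x, y) \<partial>Q)"
      using m(3)[OF L2_tendstoD(1)[OF D, of i]] m(3)[OF L2_tendstoD(2)[OF D]]
      by eventually_elim simp
    then have "L2_norm P (\<lambda>x. (\<integral>y. D i (x, y) \<partial>Q) - (\<integral>y. G (x, y) \<partial>Q))
        = L2_norm P (\<lambda>x. \<integral>y. D i (x, y) - G (x, y) \<partial>Q)"
      by (intro L2_norm_cong_AE L2_measurable[OF m(1)] L2_measurable[OF L2_diff] m(1) L2_diff L2_tendstoD(1,2)[OF D]) auto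
    also have "\<dots> \<le> L2_norm (P \<Otimes>\<^sub>M Q) (\<lambda>x. D i x - G x)"
      by (rule m(2)[OF L2_diff[OF L2_tendstoD(1,2)[OF D]]])
    finally show "L2_norm P (\<lambda>x. (\<integral>y. D i (x, y) \<partial>Q) - (\<integral>y. G (x, y) \<partial>Q))
      \<le> L2_norm (P \<Otimes>\<^sub>M Q) (\<lambda>x. D i x - G x)" .
  qed
qed (use marginal_L2[OF P Q] L2_tendstoD[OF D] in auto)

text \<open>A tangent is centered because the square of \<open>z i\<close> has mass \<open>1 + o(t i)\<close>.\<close>

lemma tangent_mass:
  assumes M: "prob_space M" and D: "L2_tendsto M F (\<lambda>i x. 2 * (z i x - 1) / t i) G"
    and z: "\<And>i. z i \<in> L2 M"
    and t: "(t \<longlongrightarrow> 0) F" "\<forall>\<^sub>F i in F. t i \<noteq> 0" and F: "F \<noteq> bot"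
    and mass: "((\<lambda>i. (1 - (\<integral>x. (z i x)\<^sup>2 \<partial>M)) / t i) \<longlongrightarrow> 0) F"
  shows "(\<integral>x. G x \<partial>M) = 0" "((\<lambda>i. ((\<integral>x. z i x \<partial>M) - 1) / t i) \<longlongrightarrow> 0) F"
proof -
  interpret prob_space M by fact
  let ?D = "\<lambda>i x. 2 * (z i x - 1) / t i"
  \<comment> \<open>Integrate \<open>z\<^sup>2 = (1 + t * D / 2)\<^sup>2\<close>. The mass defect is
    o(t) and the norms of \<open>D\<close> converge, so the mean of \<open>D\<close> tends to
    0.\<close>
  have eq: "(\<integral>x. ?D i x \<partial>M) = - ((1 - (\<integral>x. (z i x)\<^sup>2 \<partial>M)) / t i) - t i / 4 * (L2_norm M (?D i))\<^sup>2"
    if "t i \<noteq> 0" for i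
  proof -
    note D' = L2_tendstoD(1)[OF D, of i]
    have "(\<integral>x. (z i x)\<^sup>2 \<partial>M) = (\<integral>x. 1 + t i * ?D i x + (t i)\<^sup>2 / 4 * (?D i x)\<^sup>2 \<partial>M)"
      using that by (intro Bochner_Integration.integral_cong) (auto simp: power2_eq_square field_simps)
    also have "\<dots> = 1 + t i * (\<integral>x. ?D i x \<partial>M) + (t i)\<^sup>2 / 4 * (L2_norm M (?D i))\<^sup>2"
      using L2_imp_integrable[OF D'] L2_integrable_square[OF D']
      by (simp add: prob_space L2_norm_power2 del: times_divide_eq_right times_divide_eq_left)
    finally show ?thesis using that by (simp add: power2_eq_square field_simps)
  qed
  have "((\<lambda>i. - ((1 - (\<integral>x. (z i x)\<^sup>2 \<partial>M)) / t i) - t i / 4 * (L2_norm M (?D i))\<^sup>2)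
      \<longlongrightarrow> - 0 - 0 / 4 * (L2_norm M G)\<^sup>2) F"
    by (intro tendsto_intros mass t L2_tendsto_norm[OF D]) simp
  moreover have "\<forall>\<^sub>F i in F. - ((1 - (\<integral>x. (z i x)\<^sup>2 \<partial>M)) / t i) - t i / 4 * (L2_norm M (?D i))\<^sup>2 = (\<integral>x. ?D i x \<partial>M)"
    using t(2) by eventually_elim (rule eq[symmetric])
  ultimately have "((\<lambda>i. \<integral>x. ?D i x \<partial>M) \<longlongrightarrow> - 0 - 0 / 4 * (L2_norm M G)\<^sup>2) F"
    by (rule Lim_transform_eventually)
  then have D0: "((\<lambda>i. \<integral>x. ?D i x \<partial>M) \<longlongrightarrow> 0) F" by simp
  from tendsto_unique[OF F L2_tendsto_integral[OF D] D0] show "(\<integral>x. G x \<partial>M) = 0" .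
  have "(\<integral>x. ?D i x \<partial>M) / 2 = ((\<integral>x. z i x \<partial>M) - 1) / t i" for i
  proof -
    have "(\<integral>x. ?D i x \<partial>M) = (\<integral>x. 2 / t i * (z i x - 1) \<partial>M)" by simp
    also have "\<dots> = 2 / t i * ((\<integral>x. z i x \<partial>M) - 1)"
      using L2_imp_integrable[OF z[of i]]
      by (simp add: prob_space del: times_divide_eq_right times_divide_eq_left)
    finally have e: "(\<integral>x. ?D i x \<partial>M) = 2 / t i * ((\<integral>x. z i x \<partial>M) - 1)" .
    show ?thesis unfolding e by (cases "t i = 0") (simp_all add: field_simps)
  qed
  then show "((\<lambda>i. ((\<integral>x. z i x \<partial>M) - 1) / t i) \<longlongrightarrow> 0) F"
    using tendsto_divide[OF D0 tendsto_const[of 2]] by simp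
qed

lemma product_expansion:
  assumes P: "prob_space P" and Q: "prob_space Q"
    and X: "L2_tendsto P F (\<lambda>i \<omega>. 2 * (x i \<omega> - 1) / t i) g"
    and Y: "L2_tendsto Q F (\<lambda>i \<omega>. 2 * (y i \<omega> - 1) / t i) h"
    and t: "(t \<longlongrightarrow> 0) F"
  shows "L2_tendsto (P \<Otimes>\<^sub>M Q) F (\<lambda>i \<omega>. 2 * (x i (fst \<omega>) * y i (snd \<omega>) - 1) / t i)
           (\<lambda>\<omega>. g (fst \<omega>) + h (snd \<omega>))"
proof -
  let ?X = "\<lambda>i \<omega>. 2 * (x i \<omega> - 1) / t i" and ?Y = "\<lambda>i \<omega>. 2 * (y i \<omega> - 1) / t i"
  \<comment> \<open>Multiply \<open>1 + t * X / 2\<close> by \<open>1 + t * Y / 2\<close>. The norm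
    of the cross term factorises under the product measure and carries a factor
    \<open>t\<close>.\<close>
  have eq: "2 * (x i (fst \<omega>) * y i (snd \<omega>) - 1) / t i =
      (?X i (fst \<omega>) + ?Y i (snd \<omega>)) + t i / 2 * (?X i (fst \<omega>) * ?Y i (snd \<omega>))" for i \<omega>
    by (cases "t i = 0") (auto simp: field_simps)
  note XY = pair_L2_mult[OF P Q L2_tendstoD(1)[OF X] L2_tendstoD(1)[OF Y]]
  have S: "L2_tendsto (P \<Otimes>\<^sub>M Q) F (\<lambda>i \<omega>. ?X i (fst \<omega>) + ?Y i (snd \<omega>)) (\<lambda>\<omega>. g (fst \<omega>) + h (snd \<omega>))"
    by (rule L2_tendsto_add[OF L2_tendsto_fst[OF P Q X] L2_tendsto_snd[OF P Q Y]])
  show ?thesis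
    unfolding eq
  proof (rule L2_tendsto_perturb[OF S])
    show "(\<lambda>\<omega>. ?X i (fst \<omega>) + ?Y i (snd \<omega>) + t i / 2 * (?X i (fst \<omega>) * ?Y i (snd \<omega>))) \<in> L2 (P \<Otimes>\<^sub>M Q)" for i
      by (rule L2_add[OF L2_tendstoD(1)[OF S] L2_scale[OF XY(1)]])
    have "((\<lambda>i. \<bar>t i / 2\<bar> * (L2_norm P (?X i) * L2_norm Q (?Y i))) \<longlongrightarrow> \<bar>0 / 2\<bar> * (L2_norm P g * L2_norm Q h)) F"
      by (intro tendsto_intros t L2_tendsto_norm[OF X] L2_tendsto_norm[OF Y]) simp
    then show "((\<lambda>i. \<bar>t i / 2\<bar> * (L2_norm P (?X i) * L2_norm Q (?Y i))) \<longlongrightarrow> 0) F" by simp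
    show "\<forall>\<^sub>F i in F. L2_norm (P \<Otimes>\<^sub>M Q) (\<lambda>\<omega>. ?X i (fst \<omega>) + ?Y i (snd \<omega>) +
          t i / 2 * (?X i (fst \<omega>) * ?Y i (snd \<omega>)) - (?X i (fst \<omega>) + ?Y i (snd \<omega>)))
        \<le> \<bar>t i / 2\<bar> * (L2_norm P (?X i) * L2_norm Q (?Y i))"
      using XY(2) by (simp add: L2_norm_scale[of _ "t _ / 2"] del: times_divide_eq_right times_divide_eq_left)
  qed
qed

text \<open>Integrating out the second coordinate turns the root \<open>x i * y i\<close> into
  \<open>m i * x i\<close> with \<open>m i\<close> the mean of \<open>y i\<close>. The extra factor
  is harmless: both means are at most 1 and their product is \<open>1 + o(t)\<close>, so each of
  them is \<open>1 + o(t)\<close>.\<close>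

lemma marginal_expansion:
  assumes P: "prob_space P" and Q: "prob_space Q"
    and x: "\<And>i. x i \<in> L2 P" "\<And>i \<omega>. 0 \<le> x i \<omega>" "\<And>i. L2_norm P (x i) \<le> 1"
    and y: "\<And>i. y i \<in> L2 Q" "\<And>i \<omega>. 0 \<le> y i \<omega>" "\<And>i. L2_norm Q (y i) \<le> 1"
    and D: "L2_tendsto (P \<Otimes>\<^sub>M Q) F (\<lambda>i \<omega>. 2 * (x i (fst \<omega>) * y i (snd \<omega>) - 1) / t i) g"
    and mass: "((\<lambda>i. ((\<integral>\<omega>. x i \<omega> \<partial>P) * (\<integral>\<omega>. y i \<omega> \<partial>Q) - 1) / t i) \<longlongrightarrow> 0) F"
  shows "L2_tendsto P F (\<lambda>i \<omega>. 2 * (x i \<omega> - 1) / t i) (\<lambda>\<omega>. \<integral>\<omega>'. g (\<omega>, \<omega>') \<partial>Q)"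
proof -
  interpret P: prob_space P by fact
  interpret Q: prob_space Q by fact
  define l m where "l i = (\<integral>\<omega>. x i \<omega> \<partial>P)" and "m i = (\<integral>\<omega>. y i \<omega> \<partial>Q)" for i
  have l: "0 \<le> l i" "l i \<le> 1" and m: "0 \<le> m i" "m i \<le> 1" for i
    using x(2)[of i] y(2)[of i] P.abs_integral_le_L2_norm[OF x(1)[of i]] x(3)[of i]
      Q.abs_integral_le_L2_norm[OF y(1)[of i]] y(3)[of i]
    unfolding l_def m_def by (auto simp: integral_nonneg_AE)
  have eq: "(\<integral>\<omega>'. 2 * (x i \<omega> * y i \<omega>' - 1) / t i \<partial>Q) = 2 * (m i * x i \<omega> - 1) / t i" for i \<omega>
    using Q.L2_imp_integrable[OF y(1)[of i]] by (simp add: Q.prob_space m_def mult.commute)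
  from L2_tendsto_marginal[OF P Q D]
  have "L2_tendsto P F (\<lambda>i \<omega>. 2 * (m i * x i \<omega> - 1) / t i) (\<lambda>\<omega>. \<integral>\<omega>'. g (\<omega>, \<omega>') \<partial>Q)"
    by (simp only: fst_conv snd_conv eq)
  then show ?thesis
  proof (rule L2_tendsto_perturb)
    show "(\<lambda>\<omega>. 2 * (x i \<omega> - 1) / t i) \<in> L2 P" for i
      using L2_scale[OF L2_diff[OF x(1)[of i] P.L2_const[of 1]], of "2 / t i"] by simp
    show "((\<lambda>i. 2 * \<bar>(l i * m i - 1) / t i\<bar>) \<longlongrightarrow> 0) F"
      using tendsto_mult_left[OF tendsto_rabs_zero[OF mass], of 2] by (simp add: l_def m_def)
    show "\<forall>\<^sub>F i in F. L2_norm P (\<lambda>\<omega>. 2 * (x i \<omega> - 1) / t i - 2 * (m i * x i \<omega> - 1) / t i)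
        \<le> 2 * \<bar>(l i * m i - 1) / t i\<bar>"
    proof (intro always_eventually allI)
      fix i
      have eq: "2 * (x i \<omega> - 1) / t i - 2 * (m i * x i \<omega> - 1) / t i = 2 * (1 - m i) / t i * x i \<omega>" for \<omega>
        by (cases "t i = 0") (auto simp: field_simps)
      \<comment> \<open>From \<open>l i \<le> 1\<close>: the defect of one mean is at most the
        defect of the product.\<close>
      have "l i * m i \<le> m i" using l[of i] m[of i] by (simp add: mult_left_le_one_le)
      then have "\<bar>1 - m i\<bar> \<le> \<bar>l i * m i - 1\<bar>" using m[of i] by simp
      then have le: "\<bar>(1 - m i) / t i\<bar> \<le> \<bar>(l i * m i - 1) / t i\<bar>"
        by (simp add: abs_divide divide_right_mono)
      have "L2_norm P (\<lambda>\<omega>. 2 * (x i \<omega> - 1) / t i - 2 * (m i * x i \<omega> - 1) / t i)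
          = \<bar>2 * (1 - m i) / t i\<bar> * L2_norm P (x i)"
        unfolding eq by (rule L2_norm_scale)
      also have "\<dots> \<le> \<bar>2 * (1 - m i) / t i\<bar>"
        using x(3)[of i] by (intro mult_left_le) auto
      also have "\<dots> = 2 * \<bar>(1 - m i) / t i\<bar>"
        by (simp only: times_divide_eq_right[symmetric] abs_mult abs_numeral)
      also note le
      finally show "L2_norm P (\<lambda>\<omega>. 2 * (x i \<omega> - 1) / t i - 2 * (m i * x i \<omega> - 1) / t i)
        \<le> 2 * \<bar>(l i * m i - 1) / t i\<bar>" by simp
    qed
  qed
qed

text \<open>Hellinger differentiability of \<open>R\<close> along an arbitrary filter and scale; curves use
  \<open>at 0\<close> with scale \<open>t\<close>, local sequences use \<open>sequentially\<close> with scale \<open>1 / sqrt n\<close>.\<close>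

definition sqrt_differentiable ::
    "'a measure \<Rightarrow> 'i filter \<Rightarrow> ('i \<Rightarrow> real) \<Rightarrow> ('i \<Rightarrow> 'a measure) \<Rightarrow> ('i \<Rightarrow> 'a \<Rightarrow> real) \<Rightarrow> ('a \<Rightarrow> real) \<Rightarrow> bool" where
  "sqrt_differentiable P0 F t R a g \<longleftrightarrow>
     prob_space P0 \<and> (\<forall>i. prob_space (R i) \<and> ac_density (R i) P0 (a i)) \<and>
     L2_tendsto P0 F (\<lambda>i x. 2 * (sqrt (a i x) - 1) / t i) g \<and>
     ((\<lambda>i. (1 - (\<integral>x. a i x \<partial>P0)) / (t i)\<^sup>2) \<longlongrightarrow> 0) F"

lemma sqrt_differentiableD:
  assumes "sqrt_differentiable P0 F t R a g"
  shows "prob_space P0" "prob_space (R i)" "ac_density (R i) P0 (a i)"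
    "L2_tendsto P0 F (\<lambda>i x. 2 * (sqrt (a i x) - 1) / t i) g"
    "((\<lambda>i. (1 - (\<integral>x. a i x \<partial>P0)) / (t i)\<^sup>2) \<longlongrightarrow> 0) F"
  using assms by (auto simp: sqrt_differentiable_def)

lemma ac_density_sqrt_L2:
  assumes ac: "ac_density P P0 a" and P: "prob_space P"
  shows "(\<lambda>x. sqrt (a x)) \<in> L2 P0" "(\<integral>x. (sqrt (a x))\<^sup>2 \<partial>P0) = (\<integral>x. a x \<partial>P0)"
    "L2_norm P0 (\<lambda>x. sqrt (a x)) \<le> 1"
  using ac_density_integrable[OF assms] ac_densityD[OF ac]
  by (auto simp: L2_def L2_norm_def)

lemma tendsto_mass_first_order:
  assumes "((\<lambda>i. f i / (t i)\<^sup>2) \<longlongrightarrow> 0) F" and t: "(t \<longlongrightarrow> (0::real)) F"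
  shows "((\<lambda>i. f i / t i) \<longlongrightarrow> (0::real)) F"
proof -
  have "t i * (f i / (t i)\<^sup>2) = f i / t i" for i by (simp add: power2_eq_square)
  then show ?thesis using tendsto_mult[OF t assms(1)] by simp
qed

lemma sqrt_differentiable_centered:
  assumes R: "sqrt_differentiable P0 F t R a g"
    and t: "(t \<longlongrightarrow> 0) F" "\<forall>\<^sub>F i in F. t i \<noteq> 0" and F: "F \<noteq> bot"
  shows "g \<in> L2_centered P0" "((\<lambda>i. ((\<integral>x. sqrt (a i x) \<partial>P0) - 1) / t i) \<longlongrightarrow> 0) F"
proof -
  note r = sqrt_differentiableD[OF R]
  note s = ac_density_sqrt_L2[OF r(3,2)]
  note m = tangent_mass[OF r(1,4) s(1) t F, unfolded s(2), OF tendsto_mass_first_order[OF r(5) t(1)]]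
  show "g \<in> L2_centered P0" using m(1) L2_tendstoD(2)[OF r(4)] by (simp add: L2_centered_def)
  show "((\<lambda>i. ((\<integral>x. sqrt (a i x) \<partial>P0) - 1) / t i) \<longlongrightarrow> 0) F" by (rule m(2))
qed

lemma sqrt_differentiable_product:
  assumes P: "sqrt_differentiable P0 F t P a g" and Q: "sqrt_differentiable Q0 F t Q b h"
    and t: "(t \<longlongrightarrow> 0) F"
  shows "sqrt_differentiable (P0 \<Otimes>\<^sub>M Q0) F t (\<lambda>i. P i \<Otimes>\<^sub>M Q i)
    (\<lambda>i \<omega>. a i (fst \<omega>) * b i (snd \<omega>)) (\<lambda>\<omega>. g (fst \<omega>) + h (snd \<omega>))"
proof -
  note p = sqrt_differentiableD[OF P] and q = sqrt_differentiableD[OF Q]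
  have pr: "prob_space (P0 \<Otimes>\<^sub>M Q0)" "prob_space (P i \<Otimes>\<^sub>M Q i)" for i
    by (intro prob_space_pair p q)+
  note ia = ac_density_integrable[OF p(3,2)] and ib = ac_density_integrable[OF q(3,2)]
  have "((\<lambda>i. (1 - (\<integral>x. a i x \<partial>P0)) / (t i)\<^sup>2 + (1 - (\<integral>x. b i x \<partial>Q0)) / (t i)\<^sup>2) \<longlongrightarrow> 0) F"
    using tendsto_add[OF p(5) q(5)] by simp
  note lim = this
  have bounds: "0 \<le> (1 - (\<integral>\<omega>. a i (fst \<omega>) * b i (snd \<omega>) \<partial>(P0 \<Otimes>\<^sub>M Q0))) / (t i)\<^sup>2"
    "(1 - (\<integral>\<omega>. a i (fst \<omega>) * b i (snd \<omega>) \<partial>(P0 \<Otimes>\<^sub>M Q0))) / (t i)\<^sup>2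
        \<le> (1 - (\<integral>x. a i x \<partial>P0)) / (t i)\<^sup>2 + (1 - (\<integral>x. b i x \<partial>Q0)) / (t i)\<^sup>2" for i
  proof -
    define A B where "A = (\<integral>x. a i x \<partial>P0)" and "B = (\<integral>x. b i x \<partial>Q0)"
    have AB: "0 \<le> A" "A \<le> 1" "0 \<le> B" "B \<le> 1"
      using ia(2)[of i] ib(2)[of i] ac_densityD(3)[OF p(3)[of i]] ac_densityD(3)[OF q(3)[of i]]
      by (auto simp: A_def B_def integral_nonneg_AE)
    have e: "(\<integral>\<omega>. a i (fst \<omega>) * b i (snd \<omega>) \<partial>(P0 \<Otimes>\<^sub>M Q0)) = A * B"
      using pair_integral_mult(2)[OF p(1) q(1) ia(1) ib(1)] by (simp add: A_def B_def)
    have "0 \<le> 1 - A * B" using AB by (simp add: mult_le_one)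
    moreover have "1 - A * B \<le> (1 - A) + (1 - B)"
      using mult_nonneg_nonneg[of "1 - A" "1 - B"] AB by (simp add: algebra_simps)
    ultimately show "0 \<le> (1 - (\<integral>\<omega>. a i (fst \<omega>) * b i (snd \<omega>) \<partial>(P0 \<Otimes>\<^sub>M Q0))) / (t i)\<^sup>2"
      "(1 - (\<integral>\<omega>. a i (fst \<omega>) * b i (snd \<omega>) \<partial>(P0 \<Otimes>\<^sub>M Q0))) / (t i)\<^sup>2
        \<le> (1 - (\<integral>x. a i x \<partial>P0)) / (t i)\<^sup>2 + (1 - (\<integral>x. b i x \<partial>Q0)) / (t i)\<^sup>2"
      unfolding e A_def[symmetric] B_def[symmetric] add_divide_distrib[symmetric]
      by (simp_all add: divide_right_mono)
  qed
  have mass: "((\<lambda>i. (1 - (\<integral>\<omega>. a i (fst \<omega>) * b i (snd \<omega>) \<partial>(P0 \<Otimes>\<^sub>M Q0))) / (t i)\<^sup>2) \<longlongrightarrow> 0) F"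
    by (rule tendsto_sandwich[OF always_eventually always_eventually tendsto_const lim])
       (intro allI bounds)+
  show ?thesis
    unfolding sqrt_differentiable_def
  proof (intro conjI allI pr mass ac_density_pair p q)
    show "L2_tendsto (P0 \<Otimes>\<^sub>M Q0) F (\<lambda>i \<omega>. 2 * (sqrt (a i (fst \<omega>) * b i (snd \<omega>)) - 1) / t i)
        (\<lambda>\<omega>. g (fst \<omega>) + h (snd \<omega>))"
      using product_expansion[OF p(1) q(1) p(4) q(4) t] by (simp only: real_sqrt_mult)
  qed
qed

text \<open>Differentiability of the product says nothing a priori about its factors, so their
  densities come from Lebesgue decomposition. By uniqueness of densities their product is
  \<open>c\<close> almost everywhere, and the marginal expansion applies to each coordinate.
  Multiplying the two marginal expansions again and comparing L2 limits shows that \<open>g\<close>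
  is a sum of functions of one coordinate.\<close>

lemma sqrt_differentiable_marginals:
  assumes R: "sqrt_differentiable (P0 \<Otimes>\<^sub>M Q0) F t (\<lambda>i. P i \<Otimes>\<^sub>M Q i) c g"
    and P: "prob_space P0" "\<And>i. prob_space (P i)" "\<And>i. sets (P i) = sets P0"
    and Q: "prob_space Q0" "\<And>i. prob_space (Q i)" "\<And>i. sets (Q i) = sets Q0"
    and t: "(t \<longlongrightarrow> 0) F" "\<forall>\<^sub>F i in F. t i \<noteq> 0" and F: "F \<noteq> bot"
  obtains a b g1 g2 where "sqrt_differentiable P0 F t P a g1" "sqrt_differentiable Q0 F t Q b g2"
    "AE \<omega> in P0 \<Otimes>\<^sub>M Q0. g \<omega> = g1 (fst \<omega>) + g2 (snd \<omega>)"
proof -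
  note r = sqrt_differentiableD[OF R]
  obtain a where a: "\<And>i. ac_density (P i) P0 (a i)"
    using ac_density_exists[OF P(2,1,3)] by metis
  obtain b where b: "\<And>i. ac_density (Q i) Q0 (b i)"
    using ac_density_exists[OF Q(2,1,3)] by metis
  have ab: "ac_density (P i \<Otimes>\<^sub>M Q i) (P0 \<Otimes>\<^sub>M Q0) (\<lambda>\<omega>. a i (fst \<omega>) * b i (snd \<omega>))" for i
    by (rule ac_density_pair[OF a b P(2,1) Q(2,1)])
  have ceq: "AE \<omega> in P0 \<Otimes>\<^sub>M Q0. c i \<omega> = a i (fst \<omega>) * b i (snd \<omega>)" for i
    by (rule ac_density_unique[OF r(3) ab r(1)])
  define x where "x i \<omega> = sqrt (a i \<omega>)" for i \<omega>
  define y where "y i \<omega> = sqrt (b i \<omega>)" for i \<omega>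
  have x: "x i \<in> L2 P0" "(\<integral>\<omega>. (x i \<omega>)\<^sup>2 \<partial>P0) = (\<integral>\<omega>. a i \<omega> \<partial>P0)" "L2_norm P0 (x i) \<le> 1" "0 \<le> x i \<omega>" for i \<omega>
    using ac_density_sqrt_L2[OF a P(2)] ac_densityD(3)[OF a] by (auto simp: x_def[abs_def])
  have y: "y i \<in> L2 Q0" "(\<integral>\<omega>. (y i \<omega>)\<^sup>2 \<partial>Q0) = (\<integral>\<omega>. b i \<omega> \<partial>Q0)" "L2_norm Q0 (y i) \<le> 1" "0 \<le> y i \<omega>" for i \<omega>
    using ac_density_sqrt_L2[OF b Q(2)] ac_densityD(3)[OF b] by (auto simp: y_def[abs_def])
  note xy = pair_L2_mult[OF P(1) Q(1) x(1) y(1)]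
  interpret P0: prob_space P0 by fact
  interpret Q0: prob_space Q0 by fact
  interpret PQ: prob_space "P0 \<Otimes>\<^sub>M Q0" by (rule r(1))
  have DL: "(\<lambda>\<omega>. 2 * (x i (fst \<omega>) * y i (snd \<omega>) - 1) / t i) \<in> L2 (P0 \<Otimes>\<^sub>M Q0)" for i
    using L2_scale[OF L2_diff[OF xy(1)[of i i] PQ.L2_const[of 1]], of "2 / t i"] by simp
  have D: "L2_tendsto (P0 \<Otimes>\<^sub>M Q0) F (\<lambda>i \<omega>. 2 * (x i (fst \<omega>) * y i (snd \<omega>) - 1) / t i) g"
  proof (rule L2_tendsto_perturb[OF r(4) DL tendsto_const])
    show "\<forall>\<^sub>F i in F. L2_norm (P0 \<Otimes>\<^sub>M Q0) (\<lambda>\<omega>. 2 * (x i (fst \<omega>) * y i (snd \<omega>) - 1) / t i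
        - 2 * (sqrt (c i \<omega>) - 1) / t i) \<le> 0"
    proof (intro always_eventually allI)
      fix i
      have "AE \<omega> in P0 \<Otimes>\<^sub>M Q0. 2 * (x i (fst \<omega>) * y i (snd \<omega>) - 1) / t i
        - 2 * (sqrt (c i \<omega>) - 1) / t i = 0"
        using ceq[of i] by eventually_elim (simp add: x_def y_def real_sqrt_mult)
      then have "L2_norm (P0 \<Otimes>\<^sub>M Q0) (\<lambda>\<omega>. 2 * (x i (fst \<omega>) * y i (snd \<omega>) - 1) / t i
        - 2 * (sqrt (c i \<omega>) - 1) / t i) = L2_norm (P0 \<Otimes>\<^sub>M Q0) (\<lambda>_. 0)"
        by (intro L2_norm_cong_AE L2_measurable[OF L2_diff[OF DL L2_tendstoD(1)[OF r(4)]]]) auto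
      then show "L2_norm (P0 \<Otimes>\<^sub>M Q0) (\<lambda>\<omega>. 2 * (x i (fst \<omega>) * y i (snd \<omega>) - 1) / t i
        - 2 * (sqrt (c i \<omega>) - 1) / t i) \<le> 0" by (simp add: L2_norm_def)
    qed
  qed
  have cint: "(\<integral>\<omega>. c i \<omega> \<partial>(P0 \<Otimes>\<^sub>M Q0)) = (\<integral>\<omega>. a i \<omega> \<partial>P0) * (\<integral>\<omega>. b i \<omega> \<partial>Q0)" for i
  proof -
    have "(\<integral>\<omega>. c i \<omega> \<partial>(P0 \<Otimes>\<^sub>M Q0)) = (\<integral>\<omega>. a i (fst \<omega>) * b i (snd \<omega>) \<partial>(P0 \<Otimes>\<^sub>M Q0))"
      by (intro integral_cong_AE ceq ac_densityD(2)[OF r(3)] ac_densityD(2)[OF ab])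
    then show ?thesis
      using pair_integral_mult(2)[OF P(1) Q(1) ac_density_integrable(1)[OF a P(2)] ac_density_integrable(1)[OF b Q(2)]]
      by simp
  qed
  have "(\<integral>\<omega>. (x i (fst \<omega>) * y i (snd \<omega>))\<^sup>2 \<partial>(P0 \<Otimes>\<^sub>M Q0)) = (\<integral>\<omega>. c i \<omega> \<partial>(P0 \<Otimes>\<^sub>M Q0))" for i
    using pair_integral_mult(2)[OF P(1) Q(1) L2_integrable_square[OF x(1)] L2_integrable_square[OF y(1)]]
    by (simp add: cint power_mult_distrib x(2) y(2))
  then have mass1: "((\<lambda>i. (1 - (\<integral>\<omega>. (x i (fst \<omega>) * y i (snd \<omega>))\<^sup>2 \<partial>(P0 \<Otimes>\<^sub>M Q0))) / t i) \<longlongrightarrow> 0) F"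
    using tendsto_mass_first_order[OF r(5) t(1)] by simp
  have mass: "((\<lambda>i. ((\<integral>\<omega>. x i \<omega> \<partial>P0) * (\<integral>\<omega>. y i \<omega> \<partial>Q0) - 1) / t i) \<longlongrightarrow> 0) F"
    using tangent_mass(2)[OF r(1) D xy(1) t F mass1]
      pair_integral_mult(2)[OF P(1) Q(1) P0.L2_imp_integrable[OF x(1)] Q0.L2_imp_integrable[OF y(1)]]
    by simp
  have X: "L2_tendsto P0 F (\<lambda>i \<omega>. 2 * (x i \<omega> - 1) / t i) (\<lambda>\<omega>. \<integral>\<omega>'. g (\<omega>, \<omega>') \<partial>Q0)"
    by (rule marginal_expansion[OF P(1) Q(1) x(1,4,3) y(1,4,3) D mass])
  have D': "L2_tendsto (Q0 \<Otimes>\<^sub>M P0) F (\<lambda>i \<omega>. 2 * (y i (fst \<omega>) * x i (snd \<omega>) - 1) / t i) (\<lambda>\<omega>. g (snd \<omega>, fst \<omega>))"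
    using L2_tendsto_swap[OF P(1) Q(1) D] by (simp add: mult.commute)
  have mass': "((\<lambda>i. ((\<integral>\<omega>. y i \<omega> \<partial>Q0) * (\<integral>\<omega>. x i \<omega> \<partial>P0) - 1) / t i) \<longlongrightarrow> 0) F"
    using mass by (simp add: mult.commute)
  have Y: "L2_tendsto Q0 F (\<lambda>i \<omega>. 2 * (y i \<omega> - 1) / t i) (\<lambda>\<omega>. \<integral>\<omega>'. g (\<omega>', \<omega>) \<partial>P0)"
    using marginal_expansion[OF Q(1) P(1) y(1,4,3) x(1,4,3) D' mass'] by simp
  have ae: "AE \<omega> in P0 \<Otimes>\<^sub>M Q0. g \<omega> = (\<integral>\<omega>'. g (fst \<omega>, \<omega>') \<partial>Q0) + (\<integral>\<omega>'. g (\<omega>', snd \<omega>) \<partial>P0)"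
    by (rule L2_tendsto_unique[OF D product_expansion[OF P(1) Q(1) X Y t(1)] F])
  \<comment> \<open>The mass of the product density is the product of two masses in
    \<open>[0, 1]\<close>, so each factor lacks at most what the product lacks.\<close>
  have le: "(1 - (\<integral>\<omega>. a i \<omega> \<partial>P0)) / (t i)\<^sup>2 \<le> (1 - (\<integral>\<omega>. c i \<omega> \<partial>(P0 \<Otimes>\<^sub>M Q0))) / (t i)\<^sup>2"
    "(1 - (\<integral>\<omega>. b i \<omega> \<partial>Q0)) / (t i)\<^sup>2 \<le> (1 - (\<integral>\<omega>. c i \<omega> \<partial>(P0 \<Otimes>\<^sub>M Q0))) / (t i)\<^sup>2"
    "0 \<le> (1 - (\<integral>\<omega>. a i \<omega> \<partial>P0)) / (t i)\<^sup>2" "0 \<le> (1 - (\<integral>\<omega>. b i \<omega> \<partial>Q0)) / (t i)\<^sup>2" for i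
  proof -
    have "0 \<le> (\<integral>\<omega>. a i \<omega> \<partial>P0)" "0 \<le> (\<integral>\<omega>. b i \<omega> \<partial>Q0)"
      using ac_densityD(3)[OF a[of i]] ac_densityD(3)[OF b[of i]] by (auto simp: integral_nonneg_AE)
    with ac_density_integrable(2)[OF a P(2), of i] ac_density_integrable(2)[OF b Q(2), of i]
    show "(1 - (\<integral>\<omega>. a i \<omega> \<partial>P0)) / (t i)\<^sup>2 \<le> (1 - (\<integral>\<omega>. c i \<omega> \<partial>(P0 \<Otimes>\<^sub>M Q0))) / (t i)\<^sup>2"
      "(1 - (\<integral>\<omega>. b i \<omega> \<partial>Q0)) / (t i)\<^sup>2 \<le> (1 - (\<integral>\<omega>. c i \<omega> \<partial>(P0 \<Otimes>\<^sub>M Q0))) / (t i)\<^sup>2"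
      "0 \<le> (1 - (\<integral>\<omega>. a i \<omega> \<partial>P0)) / (t i)\<^sup>2" "0 \<le> (1 - (\<integral>\<omega>. b i \<omega> \<partial>Q0)) / (t i)\<^sup>2"
      unfolding cint by (auto intro!: divide_right_mono simp: mult_left_le mult_left_le_one_le)
  qed
  have "((\<lambda>i. (1 - (\<integral>\<omega>. a i \<omega> \<partial>P0)) / (t i)\<^sup>2) \<longlongrightarrow> 0) F"
    by (rule tendsto_sandwich[OF _ _ tendsto_const r(5)]) (use le in auto)
  with X have 1: "sqrt_differentiable P0 F t P a (\<lambda>\<omega>. \<integral>\<omega>'. g (\<omega>, \<omega>') \<partial>Q0)"
    using P a by (simp add: sqrt_differentiable_def x_def)
  have "((\<lambda>i. (1 - (\<integral>\<omega>. b i \<omega> \<partial>Q0)) / (t i)\<^sup>2) \<longlongrightarrow> 0) F"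
    by (rule tendsto_sandwich[OF _ _ tendsto_const r(5)]) (use le in auto)
  with Y have 2: "sqrt_differentiable Q0 F t Q b (\<lambda>\<omega>. \<integral>\<omega>'. g (\<omega>', \<omega>) \<partial>P0)"
    using Q b by (simp add: sqrt_differentiable_def y_def)
  from that[OF 1 2 ae] show ?thesis .
qed

section \<open>Curves and tangent spaces\<close>

lemma sqrt_differentiable_const:
  assumes "prob_space P0" shows "sqrt_differentiable P0 F t (\<lambda>_. P0) (\<lambda>_ _. 1) (\<lambda>_. 0)"
proof -
  interpret prob_space P0 by fact
  show ?thesis
    unfolding sqrt_differentiable_def
    using assms by (simp add: prob_space ac_density_refl L2_tendsto_const[OF L2_const[of 0]])
qed

text \<open>A curve is meaningful only on \<open>(-\<epsilon>, \<epsilon>)\<close>, whereas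
  \<open>sqrt_differentiable\<close> makes demands at every index; \<open>R'\<close> therefore
  continues the curve by the constant \<open>R0\<close>, which does not affect limits at 0.\<close>

lemma L2_differentiable_imp_sqrt_differentiable:
  assumes R: "L2_differentiable \<epsilon> R g" and 0: "R 0 = R0"
    and pr: "\<And>t. \<bar>t\<bar> < \<epsilon> \<Longrightarrow> prob_space (R t) \<and> sets (R t) = sets R0"
    and R': "\<And>t. R' t = (if \<bar>t\<bar> < \<epsilon> then R t else R0)"
  obtains c where "sqrt_differentiable R0 (at 0) (\<lambda>t. t) R' c g"
proof -
  from R obtain L where \<epsilon>: "\<epsilon> > 0" and g: "g \<in> L2 R0"
    and L: "\<And>t. \<bar>t\<bar> < \<epsilon> \<Longrightarrow> is_density_quotient (R t) R0 (L t)"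
    and o1: "(\<lambda>t. L2_norm R0 (\<lambda>x. 2 * (sqrt (enn2real (L t x)) - 1) - t * g x)) \<in> o[at 0](\<lambda>t. \<bar>t\<bar>)"
    and o2: "(\<lambda>t. measure (R t) {x \<in> space R0. L t x = \<infinity>}) \<in> o[at 0](\<lambda>t. t\<^sup>2)"
    unfolding L2_differentiable_def 0 by blast
  have pr0: "prob_space R0" using pr[of 0] \<epsilon> 0 by simp
  then interpret R0: prob_space R0 .
  define c where "c t = (if \<bar>t\<bar> < \<epsilon> then (\<lambda>x. enn2real (L t x)) else (\<lambda>x. 1))" for t
  have prR': "prob_space (R' t)" for t using pr pr0 by (simp add: R')
  have ac: "ac_density (R' t) R0 (c t)" for t
    using density_quotient_imp_ac_density(1)[OF L pr0] pr by (simp add: R' c_def ac_density_refl)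
  note sq = ac_density_sqrt_L2[OF ac prR']
  have near: "\<forall>\<^sub>F t in at 0. \<bar>t\<bar> < \<epsilon> \<and> t \<noteq> 0"
    using \<epsilon> by (auto simp: eventually_at intro!: exI[of _ \<epsilon>])
  have D: "L2_tendsto R0 (at 0) (\<lambda>t x. 2 * (sqrt (c t x) - 1) / t) g"
  proof (rule L2_tendsto_bound[OF _ g smalloD_tendsto[OF o1]])
    show "(\<lambda>x. 2 * (sqrt (c t x) - 1) / t) \<in> L2 R0" for t
      using L2_scale[OF L2_diff[OF sq(1)[of t] R0.L2_const[of 1]], of "2 / t"] by simp
    show "\<forall>\<^sub>F t in at 0. L2_norm R0 (\<lambda>x. 2 * (sqrt (c t x) - 1) / t - g x)
      \<le> L2_norm R0 (\<lambda>x. 2 * (sqrt (enn2real (L t x)) - 1) - t * g x) / \<bar>t\<bar>"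
      using near
    proof eventually_elim
      case (elim t)
      have eq: "2 * (sqrt (c t x) - 1) / t - g x = 1 / t * (2 * (sqrt (enn2real (L t x)) - 1) - t * g x)" for x
        using elim by (simp add: c_def field_simps)
      show ?case unfolding eq L2_norm_scale by simp
    qed
  qed
  have "((\<lambda>t. (1 - (\<integral>x. c t x \<partial>R0)) / t\<^sup>2) \<longlongrightarrow> 0) (at 0)"
  proof (rule Lim_transform_eventually[OF smalloD_tendsto[OF o2]], use near in eventually_elim)
    case (elim t)
    then show ?case
      using density_quotient_imp_ac_density(2)[OF L[of t] pr0] pr[of t] by (simp add: c_def)
  qed
  then have "sqrt_differentiable R0 (at 0) (\<lambda>t. t) R' c g"
    using pr0 prR' ac D by (simp add: sqrt_differentiable_def)
  then show ?thesis by (rule that)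
qed

text \<open>\<open>R\<close> stays in the family for all real \<open>t\<close>, so the radius 1 is
  an arbitrary choice.\<close>

lemma sqrt_differentiable_imp_curve:
  assumes R: "sqrt_differentiable R0 (at 0) (\<lambda>t. t) R a g" and 0: "R 0 = R0" and fam: "\<And>t. R t \<in> \<R>"
  shows "L2_differentiable_curve_in \<R> R0 1 R g"
proof -
  note r = sqrt_differentiableD[OF R]
  have "\<exists>L. is_density_quotient (R t) R0 L \<and> (AE x in R0. enn2real (L x) = a t x)" for t
    using ac_density_imp_density_quotient[OF r(3) r(2) r(1)] by metis
  then obtain L where L: "\<And>t. is_density_quotient (R t) R0 (L t)" "\<And>t. AE x in R0. enn2real (L t x) = a t x"
    by metis
  note s = ac_densityD(1,2)[OF r(3)]
  have [measurable]: "L t \<in> borel_measurable R0" for t using L(1) by (simp add: is_density_quotient_def)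
  note [measurable] = s(2)
  have [measurable]: "g \<in> borel_measurable R0" using L2_measurable[OF L2_tendstoD(2)[OF r(4)]] .
  have nz: "\<forall>\<^sub>F t in at 0. t \<noteq> (0::real)" by (simp add: eventually_at_filter)
  have "(\<lambda>t. L2_norm R0 (\<lambda>x. 2 * (sqrt (enn2real (L t x)) - 1) - t * g x)) \<in> o[at 0](\<lambda>t. \<bar>t\<bar>)"
  proof (rule smalloI_tendsto)
    show "((\<lambda>t. L2_norm R0 (\<lambda>x. 2 * (sqrt (enn2real (L t x)) - 1) - t * g x) / \<bar>t\<bar>) \<longlongrightarrow> 0) (at 0)"
    proof (rule Lim_transform_eventually[OF L2_tendstoD(3)[OF r(4)]], use nz in eventually_elim)
      case (elim t)
      have eq: "2 * (sqrt (a t x) - 1) / t - g x = 1 / t * (2 * (sqrt (a t x) - 1) - t * g x)" for x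
        using elim by (simp add: field_simps)
      have "L2_norm R0 (\<lambda>x. 2 * (sqrt (a t x) - 1) - t * g x)
          = L2_norm R0 (\<lambda>x. 2 * (sqrt (enn2real (L t x)) - 1) - t * g x)"
        using L(2)[of t] by (intro L2_norm_cong_AE) auto
      then show ?case unfolding eq L2_norm_scale by simp
    qed
  qed (use nz in simp)
  moreover have "(\<lambda>t. measure (R t) {x \<in> space R0. L t x = \<infinity>}) \<in> o[at 0](\<lambda>t. t\<^sup>2)"
  proof (rule smalloI_tendsto)
    have "measure (R t) {x \<in> space R0. L t x = \<infinity>} = 1 - (\<integral>x. a t x \<partial>R0)" for t
    proof -
      have "(\<integral>x. enn2real (L t x) \<partial>R0) = (\<integral>x. a t x \<partial>R0)"
        by (intro integral_cong_AE L) auto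
      then show ?thesis using density_quotient_imp_ac_density(2)[OF L(1) r(1) s(1) r(2)] by simp
    qed
    then show "((\<lambda>t. measure (R t) {x \<in> space R0. L t x = \<infinity>} / t\<^sup>2) \<longlongrightarrow> 0) (at 0)"
      using r(5) by simp
  qed (use nz in simp)
  ultimately show ?thesis
    unfolding L2_differentiable_curve_in_def L2_differentiable_def 0
    using fam L2_tendstoD(2)[OF r(4)] L(1) by auto
qed

text \<open>Change of scale from \<open>t n\<close> to \<open>1 / sqrt n\<close>: difference
  quotients are multiplied by \<open>t n * sqrt n\<close>, which produces the factor
  \<open>\<tau>\<close> in the tangent, and mass defects by its square. Positivity of
  \<open>\<tau>\<close> keeps \<open>t n\<close> away from 0 eventually, as the filter
  \<open>at 0\<close> requires.\<close>

lemma sqrt_differentiable_subsequence: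
  assumes R: "sqrt_differentiable P0 (at 0) (\<lambda>t. t) R a g"
    and t: "t \<longlonglongrightarrow> 0" "(\<lambda>n. t n * sqrt (real n)) \<longlonglongrightarrow> \<tau>" "\<tau> > 0"
  shows "sqrt_differentiable P0 sequentially (\<lambda>n. 1 / sqrt (real n)) (\<lambda>n. R (t n)) (\<lambda>n. a (t n)) (\<lambda>x. \<tau> * g x)"
proof -
  note r = sqrt_differentiableD[OF R]
  interpret prob_space P0 by (rule r(1))
  have "\<forall>\<^sub>F n in sequentially. t n * sqrt (real n) > 0"
    using order_tendstoD(1)[OF t(2,3)] .
  then have nz: "\<forall>\<^sub>F n in sequentially. t n \<noteq> 0" by eventually_elim auto
  have fl: "filterlim t (at 0) sequentially"
    using t(1) nz by (auto simp: filterlim_at)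
  note sq = ac_density_sqrt_L2[OF r(3,2)]
  have "L2_tendsto P0 sequentially (\<lambda>n x. (t n * sqrt (real n)) * (2 * (sqrt (a (t n) x) - 1) / t n)) (\<lambda>x. \<tau> * g x)"
    by (rule L2_tendsto_scale[OF L2_tendsto_compose[OF r(4) fl] t(2)])
  then have "L2_tendsto P0 sequentially (\<lambda>n x. 2 * (sqrt (a (t n) x) - 1) / (1 / sqrt (real n))) (\<lambda>x. \<tau> * g x)"
  proof (rule L2_tendsto_cong_eventually)
    show "(\<lambda>x. 2 * (sqrt (a (t n) x) - 1) / (1 / sqrt (real n))) \<in> L2 P0" for n
      using L2_scale[OF L2_diff[OF sq(1)[of "t n"] L2_const[of 1]], of "2 / (1 / sqrt (real n))"]
      by (simp add: mult_ac)
    show "\<forall>\<^sub>F n in sequentially. (\<lambda>x. 2 * (sqrt (a (t n) x) - 1) / (1 / sqrt (real n))) =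
        (\<lambda>x. t n * sqrt (real n) * (2 * (sqrt (a (t n) x) - 1) / t n))"
      using nz by eventually_elim auto
  qed
  moreover have "(\<lambda>n. (1 - (\<integral>x. a (t n) x \<partial>P0)) / (1 / sqrt (real n))\<^sup>2) \<longlonglongrightarrow> 0"
  proof (rule Lim_transform_eventually)
    show "(\<lambda>n. (1 - (\<integral>x. a (t n) x \<partial>P0)) / (t n)\<^sup>2 * (t n * sqrt (real n))\<^sup>2) \<longlonglongrightarrow> 0"
      using tendsto_mult[OF filterlim_compose[OF r(5) fl] tendsto_power[OF t(2), of 2]] by simp
    show "\<forall>\<^sub>F n in sequentially. (1 - (\<integral>x. a (t n) x \<partial>P0)) / (t n)\<^sup>2 * (t n * sqrt (real n))\<^sup>2
        = (1 - (\<integral>x. a (t n) x \<partial>P0)) / (1 / sqrt (real n))\<^sup>2"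
      using nz by eventually_elim (simp add: power2_eq_square)
  qed
  ultimately show ?thesis using r by (simp add: sqrt_differentiable_def)
qed

section \<open>Linear structure of the tangent space\<close>

lemma tangent_cone_subset_L2: "tangent_cone R0 \<R> \<subseteq> L2 R0"
  by (auto simp: tangent_cone_def L2_differentiable_curve_in_def L2_differentiable_def)

lemma linear_span_combination:
  assumes "f \<in> linear_span S" "g \<in> linear_span S"
  shows "(\<lambda>x. \<alpha> * f x + \<beta> * g x) \<in> linear_span S"
proof -
  obtain m :: nat and c F where f: "f = (\<lambda>x. \<Sum>i<m. c i * F i x)" and F: "\<forall>i<m. F i \<in> S"
    using assms(1) unfolding linear_span_def by blast
  obtain m' :: nat and c' F' where g: "g = (\<lambda>x. \<Sum>i<m'. c' i * F' i x)" and F': "\<forall>i<m'. F' i \<in> S"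
    using assms(2) unfolding linear_span_def by blast
  define C where "C i = (if i < m then \<alpha> * c i else \<beta> * c' (i - m))" for i
  define H where "H i = (if i < m then F i else F' (i - m))" for i
  have split: "(\<Sum>i<m + m'. h i) = (\<Sum>i<m. h i) + (\<Sum>i<m'. h (m + i))" for h :: "nat \<Rightarrow> real"
    by (induction m') (auto simp: algebra_simps)
  have "(\<lambda>x. \<alpha> * f x + \<beta> * g x) = (\<lambda>x. \<Sum>i<m + m'. C i * H i x)"
    unfolding split by (simp add: f g C_def H_def sum_distrib_left mult.assoc)
  moreover have "\<forall>i<m + m'. H i \<in> S" using F F' by (auto simp: H_def)
  ultimately show ?thesis unfolding linear_span_def by blast
qed

lemma linear_span_subset_L2:
  assumes "S \<subseteq> L2 M" shows "linear_span S \<subseteq> L2 M"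
proof
  fix f assume "f \<in> linear_span S"
  then obtain m :: nat and c F where f: "f = (\<lambda>x. \<Sum>i<m. c i * F i x)" and F: "\<forall>i<m. F i \<in> S"
    by (auto simp: linear_span_def)
  have "(\<lambda>x. \<Sum>i<k. c i * F i x) \<in> L2 M" if "k \<le> m" for k
    using that
  proof (induction k)
    case 0
    then show ?case by (simp add: L2_def)
  next
    case (Suc k)
    then have "F k \<in> L2 M" using F assms by auto
    with Suc show ?case by (auto intro!: L2_add L2_scale)
  qed
  then show "f \<in> L2 M" by (simp add: f)
qed

lemma tangent_space_combination:
  assumes f: "f \<in> tangent_space R0 \<R>" and g: "g \<in> tangent_space R0 \<R>"
  shows "(\<lambda>x. \<alpha> * f x + \<beta> * g x) \<in> tangent_space R0 \<R>"
proof -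
  let ?S = "linear_span (tangent_cone R0 \<R>)"
  have S: "?S \<subseteq> L2 R0" by (rule linear_span_subset_L2[OF tangent_cone_subset_L2])
  have fL: "f \<in> L2 R0" and gL: "g \<in> L2 R0" using f g by (auto simp: tangent_space_def L2_closure_def)
  show ?thesis
    unfolding tangent_space_def L2_closure_def
  proof (intro CollectI conjI allI impI)
    show "(\<lambda>x. \<alpha> * f x + \<beta> * g x) \<in> L2 R0" by (intro L2_add L2_scale fL gL)
    fix e :: real assume e: "e > 0"
    \<comment> \<open>The summand 1 keeps the denominator positive when both coefficients are
      0.\<close>
    define \<delta> where "\<delta> = e / (\<bar>\<alpha>\<bar> + \<bar>\<beta>\<bar> + 1)"
    have \<delta>: "\<delta> > 0" using e by (simp add: \<delta>_def add_nonneg_pos)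
    obtain u where u: "u \<in> ?S" "L2_norm R0 (\<lambda>x. f x - u x) < \<delta>"
      using f \<delta> by (auto simp: tangent_space_def L2_closure_def)
    obtain v where v: "v \<in> ?S" "L2_norm R0 (\<lambda>x. g x - v x) < \<delta>"
      using g \<delta> by (auto simp: tangent_space_def L2_closure_def)
    have uL: "u \<in> L2 R0" and vL: "v \<in> L2 R0" using u v S by auto
    have "L2_norm R0 (\<lambda>x. \<alpha> * f x + \<beta> * g x - (\<alpha> * u x + \<beta> * v x))
        = L2_norm R0 (\<lambda>x. \<alpha> * (f x - u x) + \<beta> * (g x - v x))"
      by (simp add: algebra_simps)
    also have "\<dots> \<le> L2_norm R0 (\<lambda>x. \<alpha> * (f x - u x)) + L2_norm R0 (\<lambda>x. \<beta> * (g x - v x))"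
      by (intro L2_norm_triangle L2_scale L2_diff fL gL uL vL)
    also have "\<dots> \<le> \<bar>\<alpha>\<bar> * \<delta> + \<bar>\<beta>\<bar> * \<delta>"
      unfolding L2_norm_scale using u(2) v(2) by (intro add_mono mult_left_mono) auto
    also have "\<dots> < (\<bar>\<alpha>\<bar> + \<bar>\<beta>\<bar> + 1) * \<delta>" using \<delta> by (simp add: algebra_simps)
    also have "\<dots> = e" by (simp add: \<delta>_def add_nonneg_pos less_imp_neq[symmetric])
    finally show "\<exists>h\<in>?S. L2_norm R0 (\<lambda>x. \<alpha> * f x + \<beta> * g x - h x) < e"
      by (intro bexI[of _ "\<lambda>x. \<alpha> * u x + \<beta> * v x"] linear_span_combination u v)
  qed
qed

text \<open>Tangents are functions rather than classes, while decompositions into coordinates hold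
  only almost everywhere; this bridges the two.\<close>

lemma tangent_space_cong_AE:
  assumes f: "f \<in> tangent_space R0 \<R>" and g: "g \<in> borel_measurable R0" and eq: "AE x in R0. f x = g x"
  shows "g \<in> tangent_space R0 \<R>"
proof -
  have fL: "f \<in> L2 R0" using f by (auto simp: tangent_space_def L2_closure_def)
  have gL: "g \<in> L2 R0"
    using L2_tendstoD(2)[OF L2_tendsto_cong_AE[OF L2_tendsto_const[OF fL, of sequentially] g eq]] .
  have "L2_norm R0 (\<lambda>x. g x - h x) = L2_norm R0 (\<lambda>x. f x - h x)" if "h \<in> linear_span (tangent_cone R0 \<R>)" for h
  proof -
    have "h \<in> L2 R0" using that linear_span_subset_L2[OF tangent_cone_subset_L2] by auto
    then show ?thesis using L2_measurable[OF fL] g eq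
      by (intro L2_norm_cong_AE) (auto dest: L2_measurable)
  qed
  with f gL show ?thesis
    unfolding tangent_space_def L2_closure_def by fastforce
qed

section \<open>Sums of centered functions of one coordinate\<close>

lemma pair_centered_inner:
  assumes P: "prob_space P" and Q: "prob_space Q"
    and f: "f1 \<in> L2_centered P" "f2 \<in> L2_centered Q" and h: "h1 \<in> L2_centered P" "h2 \<in> L2_centered Q"
  shows "(\<integral>\<omega>. (f1 (fst \<omega>) + f2 (snd \<omega>)) * (h1 (fst \<omega>) + h2 (snd \<omega>)) \<partial>(P \<Otimes>\<^sub>M Q))
    = (\<integral>x. f1 x * h1 x \<partial>P) + (\<integral>y. f2 y * h2 y \<partial>Q)"
proof -
  interpret P: prob_space P by fact
  interpret Q: prob_space Q by fact
  have L: "f1 \<in> L2 P" "f2 \<in> L2 Q" "h1 \<in> L2 P" "h2 \<in> L2 Q"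
    and z: "(\<integral>x. f1 x \<partial>P) = 0" "(\<integral>x. f2 x \<partial>Q) = 0" "(\<integral>x. h1 x \<partial>P) = 0" "(\<integral>x. h2 x \<partial>Q) = 0"
    using f h by (auto simp: L2_centered_def)
  note i = P.L2_imp_integrable[OF L(1)] Q.L2_imp_integrable[OF L(2)] P.L2_imp_integrable[OF L(3)] Q.L2_imp_integrable[OF L(4)]
  have one: "integrable P (\<lambda>_. 1::real)" "integrable Q (\<lambda>_. 1::real)" by auto
  note a = pair_integral_mult[OF P Q L2_integrable_mult[OF L(1,3)] one(2)]
    and b = pair_integral_mult[OF P Q i(1) i(4)]
    and c = pair_integral_mult[OF P Q i(3) i(2)]
    and d = pair_integral_mult[OF P Q one(1) L2_integrable_mult[OF L(2,4)]]
  have "(\<integral>\<omega>. (f1 (fst \<omega>) + f2 (snd \<omega>)) * (h1 (fst \<omega>) + h2 (snd \<omega>)) \<partial>(P \<Otimes>\<^sub>M Q)) =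
    (\<integral>\<omega>. (f1 (fst \<omega>) * h1 (fst \<omega>) * 1 + f1 (fst \<omega>) * h2 (snd \<omega>))
      + (h1 (fst \<omega>) * f2 (snd \<omega>) + 1 * (f2 (snd \<omega>) * h2 (snd \<omega>))) \<partial>(P \<Otimes>\<^sub>M Q))"
    by (intro Bochner_Integration.integral_cong) (auto simp: algebra_simps)
  also have "\<dots> = (\<integral>x. f1 x * h1 x \<partial>P) + (\<integral>y. f2 y * h2 y \<partial>Q)"
    using a b c d by (simp add: z P.prob_space Q.prob_space)
  finally show ?thesis .
qed

text \<open>Functions of different coordinates are orthogonal when centered, so the squared norm of
  the difference is the sum of the two squared norms, and it vanishes.\<close>

lemma centered_decomposition_unique:
  assumes P: "prob_space P" and Q: "prob_space Q"
    and f: "f1 \<in> L2_centered P" "f2 \<in> L2_centered Q" and h: "h1 \<in> L2_centered P" "h2 \<in> L2_centered Q"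
    and eq: "AE \<omega> in P \<Otimes>\<^sub>M Q. f1 (fst \<omega>) + f2 (snd \<omega>) = h1 (fst \<omega>) + h2 (snd \<omega>)"
  shows "AE x in P. f1 x = h1 x" "AE y in Q. f2 y = h2 y"
proof -
  interpret P: prob_space P by fact
  interpret Q: prob_space Q by fact
  have d1: "(\<lambda>x. f1 x - h1 x) \<in> L2_centered P" and d2: "(\<lambda>x. f2 x - h2 x) \<in> L2_centered Q"
    using f h P.L2_imp_integrable Q.L2_imp_integrable by (auto simp: L2_centered_def L2_diff)
  have d: "(\<lambda>x. f1 x - h1 x) \<in> L2 P" "(\<lambda>x. f2 x - h2 x) \<in> L2 Q"
    using d1 d2 by (auto simp: L2_centered_def)
  have "(\<integral>\<omega>. ((f1 (fst \<omega>) - h1 (fst \<omega>)) + (f2 (snd \<omega>) - h2 (snd \<omega>))) * ((f1 (fst \<omega>) - h1 (fst \<omega>)) + (f2 (snd \<omega>) - h2 (snd \<omega>))) \<partial>(P \<Otimes>\<^sub>M Q)) = 0"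
    by (rule integral_eq_zero_AE) (use eq in eventually_elim, simp)
  then have "(L2_norm P (\<lambda>x. f1 x - h1 x))\<^sup>2 + (L2_norm Q (\<lambda>x. f2 x - h2 x))\<^sup>2 = 0"
    using pair_centered_inner[OF P Q d1 d2 d1 d2] unfolding L2_norm_power2 by (simp add: power2_eq_square)
  then have "L2_norm P (\<lambda>x. f1 x - h1 x) = 0" "L2_norm Q (\<lambda>x. f2 x - h2 x) = 0"
    by (auto simp: sum_power2_eq_zero_iff)
  from L2_norm_zero_AE[OF d(1) this(1)] L2_norm_zero_AE[OF d(2) this(2)]
  show "AE x in P. f1 x = h1 x" "AE y in Q. f2 y = h2 y" by auto
qed

lemma sqrt_differentiable_cong_AE:
  assumes "sqrt_differentiable P0 F t R a g" "h \<in> borel_measurable P0" "AE x in P0. g x = h x"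
  shows "sqrt_differentiable P0 F t R a h"
  using assms L2_tendsto_cong_AE[OF _ assms(2,3)] by (auto simp: sqrt_differentiable_def)

text \<open>The factors are recovered from rectangles with one full side. This identifies the
  factors of a local sequence with those chosen along a curve.\<close>

lemma pair_measure_factors_unique:
  assumes "prob_space P" "prob_space P'" "prob_space Q" "prob_space Q'"
    and s: "sets P = sets P'" "sets Q = sets Q'" and eq: "P \<Otimes>\<^sub>M Q = P' \<Otimes>\<^sub>M Q'"
  shows "P = P'" "Q = Q'"
proof -
  interpret P: prob_space P by fact
  interpret P': prob_space P' by fact
  interpret Q: prob_space Q by fact
  interpret Q': prob_space Q' by fact
  note sp = s[THEN sets_eq_imp_space_eq]
  show "P = P'"
  proof (rule measure_eqI[OF s(1)])
    fix A assume A: "A \<in> sets P"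
    then have A': "A \<in> sets P'" using s by simp
    have "emeasure P A = emeasure (P \<Otimes>\<^sub>M Q) (A \<times> space Q)"
      using A by (simp add: Q.emeasure_pair_measure_Times Q.emeasure_space_1)
    also have "\<dots> = emeasure (P' \<Otimes>\<^sub>M Q') (A \<times> space Q')" by (simp only: eq sp)
    also have "\<dots> = emeasure P' A"
      using A' by (simp add: Q'.emeasure_pair_measure_Times Q'.emeasure_space_1)
    finally show "emeasure P A = emeasure P' A" .
  qed
  show "Q = Q'"
  proof (rule measure_eqI[OF s(2)])
    fix A assume A: "A \<in> sets Q"
    then have A': "A \<in> sets Q'" using s by simp
    have "emeasure Q A = emeasure (P \<Otimes>\<^sub>M Q) (space P \<times> A)"
      using A by (simp add: Q.emeasure_pair_measure_Times P.emeasure_space_1)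
    also have "\<dots> = emeasure (P' \<Otimes>\<^sub>M Q') (space P' \<times> A)" by (simp only: eq sp)
    also have "\<dots> = emeasure Q' A"
      using A' by (simp add: Q'.emeasure_pair_measure_Times P'.emeasure_space_1)
    finally show "emeasure Q A = emeasure Q' A" .
  qed
qed

section \<open>Curves and local sequences in the product family\<close>

lemma product_curve_marginals:
  assumes fam: "\<And>P. P \<in> \<P> \<Longrightarrow> prob_space P \<and> sets P = sets M1"
      "\<And>Q. Q \<in> \<Q> \<Longrightarrow> prob_space Q \<and> sets Q = sets M2"
    and P0: "P0 \<in> \<P>" and Q0: "Q0 \<in> \<Q>"
    and f: "L2_differentiable_curve_in (product_family \<P> \<Q>) (P0 \<Otimes>\<^sub>M Q0) \<epsilon> f g"
  obtains P Q a b g1 g2 where "\<forall>t. P t \<in> \<P>" "\<forall>t. Q t \<in> \<Q>" "P 0 = P0" "Q 0 = Q0"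
    "\<forall>t. \<bar>t\<bar> < \<epsilon> \<longrightarrow> f t = P t \<Otimes>\<^sub>M Q t"
    "sqrt_differentiable P0 (at 0) (\<lambda>t. t) P a g1" "sqrt_differentiable Q0 (at 0) (\<lambda>t. t) Q b g2"
    "g1 \<in> L2_centered P0" "g2 \<in> L2_centered Q0"
    "AE \<omega> in P0 \<Otimes>\<^sub>M Q0. g \<omega> = g1 (fst \<omega>) + g2 (snd \<omega>)"
proof -
  have f_in: "\<And>t. \<bar>t\<bar> < \<epsilon> \<Longrightarrow> f t \<in> product_family \<P> \<Q>" and f0: "f 0 = P0 \<Otimes>\<^sub>M Q0"
    and fd: "L2_differentiable \<epsilon> f g"
    using f by (auto simp: L2_differentiable_curve_in_def)
  \<comment> \<open>The factors of \<open>f t\<close> exist only pointwise and are selected by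
    choice. Prescribing \<open>(P0, Q0)\<close> at 0 makes both factor curves start at the right
    point, and prescribing it outside the interval makes them defined for all
    \<open>t\<close>.\<close>
  have "\<forall>t. \<exists>p. fst p \<in> \<P> \<and> snd p \<in> \<Q> \<and> (t = 0 \<or> \<not> \<bar>t\<bar> < \<epsilon> \<longrightarrow> p = (P0, Q0)) \<and> (\<bar>t\<bar> < \<epsilon> \<longrightarrow> f t = fst p \<Otimes>\<^sub>M snd p)"
  proof
    fix t
    show "\<exists>p. fst p \<in> \<P> \<and> snd p \<in> \<Q> \<and> (t = 0 \<or> \<not> \<bar>t\<bar> < \<epsilon> \<longrightarrow> p = (P0, Q0)) \<and> (\<bar>t\<bar> < \<epsilon> \<longrightarrow> f t = fst p \<Otimes>\<^sub>M snd p)"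
    proof (cases "t = 0 \<or> \<not> \<bar>t\<bar> < \<epsilon>")
      case True
      then show ?thesis using P0 Q0 f0 by (intro exI[of _ "(P0, Q0)"]) auto
    next
      case False
      then obtain P Q where "P \<in> \<P>" "Q \<in> \<Q>" "f t = P \<Otimes>\<^sub>M Q"
        using f_in[of t] by (auto simp: product_family_def)
      with False show ?thesis by (intro exI[of _ "(P, Q)"]) auto
    qed
  qed
  from choice[OF this] obtain p where p0: "\<forall>t. fst (p t) \<in> \<P> \<and> snd (p t) \<in> \<Q> \<and>
      (t = 0 \<or> \<not> \<bar>t\<bar> < \<epsilon> \<longrightarrow> p t = (P0, Q0)) \<and> (\<bar>t\<bar> < \<epsilon> \<longrightarrow> f t = fst (p t) \<Otimes>\<^sub>M snd (p t))"
    by (rule exE)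
  then have p: "fst (p t) \<in> \<P>" "snd (p t) \<in> \<Q>"
    "t = 0 \<or> \<not> \<bar>t\<bar> < \<epsilon> \<Longrightarrow> p t = (P0, Q0)"
    "\<bar>t\<bar> < \<epsilon> \<Longrightarrow> f t = fst (p t) \<Otimes>\<^sub>M snd (p t)" for t
    by blast+
  define P where "P t = fst (p t)" for t
  define Q where "Q t = snd (p t)" for t
  have P: "P t \<in> \<P>" "prob_space (P t)" "sets (P t) = sets P0"
    and Q: "Q t \<in> \<Q>" "prob_space (Q t)" "sets (Q t) = sets Q0" for t
    using p(1,2)[of t] fam P0 Q0 by (auto simp: P_def Q_def)
  have pr: "prob_space P0" "prob_space Q0" using fam P0 Q0 by auto
  have f': "P t \<Otimes>\<^sub>M Q t = (if \<bar>t\<bar> < \<epsilon> then f t else P0 \<Otimes>\<^sub>M Q0)" for t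
    using p(3,4)[of t] by (auto simp: P_def Q_def)
  obtain c where c: "sqrt_differentiable (P0 \<Otimes>\<^sub>M Q0) (at 0) (\<lambda>t. t) (\<lambda>t. P t \<Otimes>\<^sub>M Q t) c g"
  proof (rule L2_differentiable_imp_sqrt_differentiable[OF fd f0 _ f'])
    fix t assume "\<bar>t\<bar> < \<epsilon>"
    then have "f t = P t \<Otimes>\<^sub>M Q t" using f'[of t] by simp
    then show "prob_space (f t) \<and> sets (f t) = sets (P0 \<Otimes>\<^sub>M Q0)"
      using prob_space_pair[OF P(2) Q(2)] sets_pair_measure_cong[OF P(3) Q(3)] by metis
  qed
  have nz: "\<forall>\<^sub>F t in at 0. t \<noteq> (0::real)" by (simp add: eventually_at_filter)
  have bot: "at (0::real) \<noteq> bot" by simp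
  obtain a b g1 g2 where ab: "sqrt_differentiable P0 (at 0) (\<lambda>t. t) P a g1"
    "sqrt_differentiable Q0 (at 0) (\<lambda>t. t) Q b g2" "AE \<omega> in P0 \<Otimes>\<^sub>M Q0. g \<omega> = g1 (fst \<omega>) + g2 (snd \<omega>)"
    by (rule sqrt_differentiable_marginals[OF c pr(1) P(2,3) pr(2) Q(2,3) tendsto_ident_at nz bot], rule that; assumption)
  have fams: "\<forall>t. P t \<in> \<P>" "\<forall>t. Q t \<in> \<Q>" using P Q by auto
  have at0: "P 0 = P0" "Q 0 = Q0" using p(3)[of 0] by (auto simp: P_def Q_def)
  have ft: "\<forall>t. \<bar>t\<bar> < \<epsilon> \<longrightarrow> f t = P t \<Otimes>\<^sub>M Q t" using f' by simp
  have cg: "g1 \<in> L2_centered P0" "g2 \<in> L2_centered Q0"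
    using sqrt_differentiable_centered(1)[OF ab(1) tendsto_ident_at nz bot]
      sqrt_differentiable_centered(1)[OF ab(2) tendsto_ident_at nz bot] by auto
  show ?thesis by (rule that[OF fams at0 ft ab(1,2) cg ab(3)])
qed

text \<open>Freezing one factor at its value for \<open>t = 0\<close> keeps the curve inside the
  product family and leaves only the other component of the tangent. This is the place where the
  product form of the model is used to separate \<open>k1\<close> from \<open>k2\<close>.\<close>

lemma tangent_cone_components:
  assumes fam: "\<And>P. P \<in> \<P> \<Longrightarrow> prob_space P \<and> sets P = sets M1"
      "\<And>Q. Q \<in> \<Q> \<Longrightarrow> prob_space Q \<and> sets Q = sets M2"
    and P0: "P0 \<in> \<P>" and Q0: "Q0 \<in> \<Q>"
    and g: "g \<in> tangent_cone (P0 \<Otimes>\<^sub>M Q0) (product_family \<P> \<Q>)"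
  obtains g1 g2 where "g1 \<in> L2_centered P0" "g2 \<in> L2_centered Q0"
    "AE \<omega> in P0 \<Otimes>\<^sub>M Q0. g \<omega> = g1 (fst \<omega>) + g2 (snd \<omega>)"
    "(\<lambda>\<omega>. g1 (fst \<omega>)) \<in> tangent_cone (P0 \<Otimes>\<^sub>M Q0) (product_family \<P> \<Q>)"
    "(\<lambda>\<omega>. g2 (snd \<omega>)) \<in> tangent_cone (P0 \<Otimes>\<^sub>M Q0) (product_family \<P> \<Q>)"
proof -
  obtain \<epsilon> f where f: "L2_differentiable_curve_in (product_family \<P> \<Q>) (P0 \<Otimes>\<^sub>M Q0) \<epsilon> f g"
    using g by (auto simp: tangent_cone_def)
  obtain P Q a b g1 g2 where PQ: "\<forall>t. P t \<in> \<P>" "\<forall>t. Q t \<in> \<Q>" "P 0 = P0" "Q 0 = Q0"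
    "\<forall>t. \<bar>t\<bar> < \<epsilon> \<longrightarrow> f t = P t \<Otimes>\<^sub>M Q t"
    and d1: "sqrt_differentiable P0 (at 0) (\<lambda>t. t) P a g1" and d2: "sqrt_differentiable Q0 (at 0) (\<lambda>t. t) Q b g2"
    and cg: "g1 \<in> L2_centered P0" "g2 \<in> L2_centered Q0"
      "AE \<omega> in P0 \<Otimes>\<^sub>M Q0. g \<omega> = g1 (fst \<omega>) + g2 (snd \<omega>)"
    by (rule product_curve_marginals[OF fam P0 Q0 f])
  have pr: "prob_space P0" "prob_space Q0" using fam P0 Q0 by auto
  show ?thesis
  proof (rule that[OF cg])
    have "sqrt_differentiable (P0 \<Otimes>\<^sub>M Q0) (at 0) (\<lambda>t. t) (\<lambda>t. P t \<Otimes>\<^sub>M Q0) (\<lambda>t \<omega>. a t (fst \<omega>) * 1) (\<lambda>\<omega>. g1 (fst \<omega>) + 0)"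
      by (rule sqrt_differentiable_product[OF d1 sqrt_differentiable_const[OF pr(2)] tendsto_ident_at])
    then have "L2_differentiable_curve_in (product_family \<P> \<Q>) (P0 \<Otimes>\<^sub>M Q0) 1 (\<lambda>t. P t \<Otimes>\<^sub>M Q0) (\<lambda>\<omega>. g1 (fst \<omega>) + 0)"
      by (rule sqrt_differentiable_imp_curve) (use PQ Q0 in \<open>auto simp: product_family_def\<close>)
    then show "(\<lambda>\<omega>. g1 (fst \<omega>)) \<in> tangent_cone (P0 \<Otimes>\<^sub>M Q0) (product_family \<P> \<Q>)"
      unfolding tangent_cone_def add_0_right by blast
    have "sqrt_differentiable (P0 \<Otimes>\<^sub>M Q0) (at 0) (\<lambda>t. t) (\<lambda>t. P0 \<Otimes>\<^sub>M Q t) (\<lambda>t \<omega>. 1 * b t (snd \<omega>)) (\<lambda>\<omega>. 0 + g2 (snd \<omega>))"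
      by (rule sqrt_differentiable_product[OF sqrt_differentiable_const[OF pr(1)] d2 tendsto_ident_at])
    then have "L2_differentiable_curve_in (product_family \<P> \<Q>) (P0 \<Otimes>\<^sub>M Q0) 1 (\<lambda>t. P0 \<Otimes>\<^sub>M Q t) (\<lambda>\<omega>. 0 + g2 (snd \<omega>))"
      by (rule sqrt_differentiable_imp_curve) (use PQ P0 in \<open>auto simp: product_family_def\<close>)
    then show "(\<lambda>\<omega>. g2 (snd \<omega>)) \<in> tangent_cone (P0 \<Otimes>\<^sub>M Q0) (product_family \<P> \<Q>)"
      unfolding tangent_cone_def add_0_left by blast
  qed
qed

text \<open>All that the asymptotics need to know about a local sequence. The tangents are taken at
  scale \<open>1 / sqrt n\<close>, so the limit of \<open>t n * sqrt n\<close> is already absorbed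
  in \<open>G1\<close> and \<open>G2\<close>.\<close>

definition local_expansion where
  "local_expansion P0 Q0 s a b G1 G2 \<longleftrightarrow>
     sqrt_differentiable P0 sequentially (\<lambda>n. 1 / sqrt (real n)) (fst s) a G1 \<and>
     sqrt_differentiable Q0 sequentially (\<lambda>n. 1 / sqrt (real n)) (snd s) b G2 \<and>
     G1 \<in> L2_centered P0 \<and> G2 \<in> L2_centered Q0"

lemma curve_sequence_expansion:
  assumes fam: "\<And>P. P \<in> \<P> \<Longrightarrow> prob_space P \<and> sets P = sets M1"
      "\<And>Q. Q \<in> \<Q> \<Longrightarrow> prob_space Q \<and> sets Q = sets M2"
    and P0: "P0 \<in> \<P>" and Q0: "Q0 \<in> \<Q>"
    and f: "L2_differentiable_curve_in (product_family \<P> \<Q>) (P0 \<Otimes>\<^sub>M Q0) \<epsilon> f g"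
    and grad: "is_gradient k (P0 \<Otimes>\<^sub>M Q0) (product_family \<P> \<Q>) kt"
    and s: "\<And>n. fst s n \<in> \<P>" "\<And>n. snd s n \<in> \<Q>" "\<And>n. f (t n) = fst s n \<Otimes>\<^sub>M snd s n"
    and t: "t \<longlonglongrightarrow> 0" "(\<lambda>n. t n * sqrt (real n)) \<longlonglongrightarrow> \<tau>" "\<tau> > 0" "\<And>n. \<bar>t n\<bar> < \<epsilon>"
  obtains a b g1 g2 where "local_expansion P0 Q0 s a b (\<lambda>x. \<tau> * g1 x) (\<lambda>y. \<tau> * g2 y)"
    "g1 \<in> L2_centered P0" "g2 \<in> L2_centered Q0"
    "AE \<omega> in P0 \<Otimes>\<^sub>M Q0. g \<omega> = g1 (fst \<omega>) + g2 (snd \<omega>)"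
    "local_parameter k P0 Q0 s = \<tau> * (\<integral>\<omega>. kt \<omega> * g \<omega> \<partial>(P0 \<Otimes>\<^sub>M Q0))"
proof -
  obtain P Q a b g1 g2 where PQ: "\<forall>t. P t \<in> \<P>" "\<forall>t. Q t \<in> \<Q>" "P 0 = P0" "Q 0 = Q0"
    "\<forall>t. \<bar>t\<bar> < \<epsilon> \<longrightarrow> f t = P t \<Otimes>\<^sub>M Q t"
    and d1: "sqrt_differentiable P0 (at 0) (\<lambda>t. t) P a g1" and d2: "sqrt_differentiable Q0 (at 0) (\<lambda>t. t) Q b g2"
    and cg: "g1 \<in> L2_centered P0" "g2 \<in> L2_centered Q0"
      "AE \<omega> in P0 \<Otimes>\<^sub>M Q0. g \<omega> = g1 (fst \<omega>) + g2 (snd \<omega>)"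
    by (rule product_curve_marginals[OF fam P0 Q0 f])
  \<comment> \<open>The sequence and the selected factor curves agree only as products; uniqueness
    of factors upgrades this.\<close>
  have eq: "fst s n = P (t n)" "snd s n = Q (t n)" for n
  proof -
    have "fst s n \<Otimes>\<^sub>M snd s n = P (t n) \<Otimes>\<^sub>M Q (t n)" using s(3)[of n] PQ(5) t(4)[of n] by simp
    then show "fst s n = P (t n)" "snd s n = Q (t n)"
      using fam(1)[OF s(1)[of n]] fam(2)[OF s(2)[of n]] fam(1)[of "P (t n)"] fam(2)[of "Q (t n)"] PQ(1,2)
        pair_measure_factors_unique[of "fst s n" "P (t n)" "snd s n" "Q (t n)"] by simp_all
  qed
  have le: "local_expansion P0 Q0 s (\<lambda>n. a (t n)) (\<lambda>n. b (t n)) (\<lambda>x. \<tau> * g1 x) (\<lambda>y. \<tau> * g2 y)"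
    unfolding local_expansion_def
  proof (intro conjI)
    show "sqrt_differentiable P0 sequentially (\<lambda>n. 1 / sqrt (real n)) (fst s) (\<lambda>n. a (t n)) (\<lambda>x. \<tau> * g1 x)"
      using sqrt_differentiable_subsequence[OF d1 t(1-3)] by (simp only: eq(1)[symmetric])
    show "sqrt_differentiable Q0 sequentially (\<lambda>n. 1 / sqrt (real n)) (snd s) (\<lambda>n. b (t n)) (\<lambda>x. \<tau> * g2 x)"
      using sqrt_differentiable_subsequence[OF d2 t(1-3)] by (simp only: eq(2)[symmetric])
    show "(\<lambda>x. \<tau> * g1 x) \<in> L2_centered P0" "(\<lambda>x. \<tau> * g2 x) \<in> L2_centered Q0"
      using cg by (auto simp: L2_centered_def L2_scale)
  qed
  \<comment> \<open>Gradients are defined by a limit from the right, and a positive limit of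
    \<open>t n * sqrt n\<close> places \<open>t n\<close> there.\<close>
  have pos: "\<forall>\<^sub>F n in sequentially. t n > 0"
    using order_tendstoD(1)[OF t(2,3)] by eventually_elim (auto simp: zero_less_mult_iff)
  then have fl: "filterlim t (at_right 0) sequentially"
    using t(1) by (auto simp: filterlim_at elim: eventually_mono)
  have "((\<lambda>t. (k (f t) - k (P0 \<Otimes>\<^sub>M Q0)) / t) \<longlongrightarrow> (\<integral>\<omega>. kt \<omega> * g \<omega> \<partial>(P0 \<Otimes>\<^sub>M Q0))) (at_right 0)"
    using grad f by (simp add: is_gradient_def)
  from tendsto_mult[OF t(2) filterlim_compose[OF this fl]]
  have "(\<lambda>n. t n * sqrt (real n) * ((k (f (t n)) - k (P0 \<Otimes>\<^sub>M Q0)) / t n))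
      \<longlonglongrightarrow> \<tau> * (\<integral>\<omega>. kt \<omega> * g \<omega> \<partial>(P0 \<Otimes>\<^sub>M Q0))" .
  then have "(\<lambda>n. sqrt (real n) * (k (fst s n \<Otimes>\<^sub>M snd s n) - k (P0 \<Otimes>\<^sub>M Q0)))
      \<longlonglongrightarrow> \<tau> * (\<integral>\<omega>. kt \<omega> * g \<omega> \<partial>(P0 \<Otimes>\<^sub>M Q0))"
  proof (rule Lim_transform_eventually)
    show "\<forall>\<^sub>F n in sequentially. t n * sqrt (real n) * ((k (f (t n)) - k (P0 \<Otimes>\<^sub>M Q0)) / t n)
        = sqrt (real n) * (k (fst s n \<Otimes>\<^sub>M snd s n) - k (P0 \<Otimes>\<^sub>M Q0))"
      using pos by eventually_elim (simp add: s(3))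
  qed
  then have "local_parameter k P0 Q0 s = \<tau> * (\<integral>\<omega>. kt \<omega> * g \<omega> \<partial>(P0 \<Otimes>\<^sub>M Q0))"
    unfolding local_parameter_def by (rule limI)
  from that[OF le cg this] show ?thesis .
qed

lemma tangent_local_sequence:
  assumes fam: "\<And>P. P \<in> \<P> \<Longrightarrow> prob_space P \<and> sets P = sets M1"
      "\<And>Q. Q \<in> \<Q> \<Longrightarrow> prob_space Q \<and> sets Q = sets M2"
    and P0: "P0 \<in> \<P>" and Q0: "Q0 \<in> \<Q>"
    and grad: "is_gradient k (P0 \<Otimes>\<^sub>M Q0) (product_family \<P> \<Q>) kt"
    and g: "(\<lambda>\<omega>. h1 (fst \<omega>) + h2 (snd \<omega>)) \<in> tangent_cone (P0 \<Otimes>\<^sub>M Q0) (product_family \<P> \<Q>)"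
    and h: "h1 \<in> L2_centered P0" "h2 \<in> L2_centered Q0"
  obtains s a b where "s \<in> local_sequences \<P> \<Q> P0 Q0" "local_expansion P0 Q0 s a b h1 h2"
    "local_parameter k P0 Q0 s = (\<integral>\<omega>. kt \<omega> * (h1 (fst \<omega>) + h2 (snd \<omega>)) \<partial>(P0 \<Otimes>\<^sub>M Q0))"
proof -
  let ?h = "\<lambda>\<omega>. h1 (fst \<omega>) + h2 (snd \<omega>)"
  obtain \<epsilon> f where f: "L2_differentiable_curve_in (product_family \<P> \<Q>) (P0 \<Otimes>\<^sub>M Q0) \<epsilon> f ?h"
    using g by (auto simp: tangent_cone_def)
  have \<epsilon>: "\<epsilon> > 0" using f by (auto simp: L2_differentiable_curve_in_def L2_differentiable_def)
  \<comment> \<open>The value 0 replaces the finitely many points that fall outside the domain of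
    the curve. The limit of \<open>t n * sqrt n\<close> is 1, so the tangent is reproduced without a
    factor.\<close>
  define t where "t n = (if 1 / sqrt (real n) < \<epsilon> then 1 / sqrt (real n) else 0)" for n
  have small: "\<bar>t n\<bar> < \<epsilon>" for n using \<epsilon> by (auto simp: t_def)
  have lim: "(\<lambda>n. 1 / sqrt (real n)) \<longlonglongrightarrow> 0" by real_asymp
  have ev: "\<forall>\<^sub>F n in sequentially. t n = 1 / sqrt (real n)"
    using order_tendstoD(2)[OF lim \<epsilon>] by eventually_elim (simp add: t_def)
  have t0: "t \<longlonglongrightarrow> 0"
    by (rule Lim_transform_eventually[OF lim]) (use ev in eventually_elim, simp)
  have t1: "(\<lambda>n. t n * sqrt (real n)) \<longlonglongrightarrow> 1"
    by (rule tendsto_eventually) (use ev eventually_gt_at_top[of 0] in eventually_elim, simp)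
  have "\<forall>n. \<exists>p. fst p \<in> \<P> \<and> snd p \<in> \<Q> \<and> f (t n) = fst p \<Otimes>\<^sub>M snd p"
    using f small by (fastforce simp: L2_differentiable_curve_in_def product_family_def)
  from choice[OF this] obtain p where "\<forall>n. fst (p n) \<in> \<P> \<and> snd (p n) \<in> \<Q> \<and> f (t n) = fst (p n) \<Otimes>\<^sub>M snd (p n)"
    by (rule exE)
  then have p: "fst (p n) \<in> \<P>" "snd (p n) \<in> \<Q>" "f (t n) = fst (p n) \<Otimes>\<^sub>M snd (p n)" for n
    by blast+
  define s where "s = (\<lambda>n. fst (p n), \<lambda>n. snd (p n))"
  have s: "\<And>n. fst s n \<in> \<P>" "\<And>n. snd s n \<in> \<Q>" "\<And>n. f (t n) = fst s n \<Otimes>\<^sub>M snd s n"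
    using p by (auto simp: s_def)
  have ex: "\<exists>t \<tau> \<epsilon> f g. t \<longlonglongrightarrow> 0 \<and> (\<lambda>n. t n * sqrt (real n)) \<longlonglongrightarrow> \<tau> \<and> \<tau> > 0 \<and>
      L2_differentiable_curve_in (product_family \<P> \<Q>) (P0 \<Otimes>\<^sub>M Q0) \<epsilon> f g \<and>
      (\<forall>n. \<bar>t n\<bar> < \<epsilon> \<and> f (t n) = fst (p n) \<Otimes>\<^sub>M snd (p n))"
    by (rule exI[of _ t], rule exI[of _ 1], rule exI[of _ \<epsilon>], rule exI[of _ f], rule exI[of _ ?h])
       (use f small t0 t1 p(3) in simp)
  have mem: "s \<in> local_sequences \<P> \<Q> P0 Q0"
    unfolding local_sequences_def
    by (simp only: mem_Collect_eq prod.case s_def) (use ex p(1,2) in blast)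
  obtain a b g1 g2 where le: "local_expansion P0 Q0 s a b (\<lambda>x. 1 * g1 x) (\<lambda>y. 1 * g2 y)"
    and g: "g1 \<in> L2_centered P0" "g2 \<in> L2_centered Q0"
      "AE \<omega> in P0 \<Otimes>\<^sub>M Q0. ?h \<omega> = g1 (fst \<omega>) + g2 (snd \<omega>)"
    and lp: "local_parameter k P0 Q0 s = 1 * (\<integral>\<omega>. kt \<omega> * ?h \<omega> \<partial>(P0 \<Otimes>\<^sub>M Q0))"
    by (rule curve_sequence_expansion[OF fam P0 Q0 f grad s t0 t1 zero_less_one small])
  have pr: "prob_space P0" "prob_space Q0" using fam P0 Q0 by auto
  \<comment> \<open>The curve returns some decomposition of its tangent; centering makes it agree
    with the prescribed one almost everywhere.\<close>
  have eq: "AE x in P0. g1 x = h1 x" "AE y in Q0. g2 y = h2 y"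
    using centered_decomposition_unique[OF pr h g] by (auto elim: eventually_mono)
  have "local_expansion P0 Q0 s a b h1 h2"
    using le h eq sqrt_differentiable_cong_AE[of P0 _ _ _ a "\<lambda>x. 1 * g1 x" h1]
      sqrt_differentiable_cong_AE[of Q0 _ _ _ b "\<lambda>x. 1 * g2 x" h2]
    by (auto simp: local_expansion_def L2_centered_def dest: L2_measurable)
  with mem lp that show ?thesis by simp
qed

section \<open>Asymptotic normality under local sequences\<close>

lemma norm_iexp_minus_1: "norm (iexp x - 1) \<le> \<bar>x\<bar>"
  using iexp_approx1[of x 0] by simp

lemma norm_iexp_minus_2: "norm (iexp x - 1 - \<i> * x) \<le> x\<^sup>2 / 2"
  using iexp_approx1[of x 1] by (simp add: power2_eq_square algebra_simps)

lemma norm_iexp_minus_3: "norm (iexp x - 1 - \<i> * x + x\<^sup>2 / 2) \<le> \<bar>x\<bar> ^ 3 / 6"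
proof -
  have "(\<Sum>k\<le>2. (\<i> * x) ^ k / fact k) = 1 + \<i> * x + (\<i> * x)\<^sup>2 / 2"
    by (simp add: numeral_2_eq_2)
  also have "\<dots> = 1 + \<i> * x - x\<^sup>2 / 2" by (simp add: power_mult_distrib)
  finally have "(\<Sum>k\<le>2. (\<i> * x) ^ k / fact k) = 1 + \<i> * x - x\<^sup>2 / 2" .
  then show ?thesis using iexp_approx1[of x 2] by (simp add: algebra_simps eval_nat_numeral)
qed

text \<open>The characteristic function is expanded under \<open>P n\<close> itself: the density
  contributes the drift \<open>u * (\<integral>x. h x * G x \<partial>P0)\<close>, and the variance
  is the one under \<open>P0\<close>. Only second moments of \<open>h\<close> and \<open>G\<close>
  exist, so remainders are controlled by dominated convergence and not by third moments.\<close>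

lemma one_sample_char_expansion:
  assumes R: "sqrt_differentiable P0 sequentially (\<lambda>n. 1 / sqrt (real n)) P a G"
    and h: "h \<in> L2_centered P0"
    and w: "(\<lambda>n. w n * sqrt (real n)) \<longlonglongrightarrow> u"
  shows "(\<lambda>n. of_nat n * ((\<integral>x. iexp (w n * h x) \<partial>P n) - 1)) \<longlonglongrightarrow>
    of_real (- u\<^sup>2 / 2 * (\<integral>x. (h x)\<^sup>2 \<partial>P0)) + \<i> * of_real (u * (\<integral>x. h x * G x \<partial>P0))"
proof -
  note r = sqrt_differentiableD[OF R]
  interpret prob_space P0 by (rule r(1))
  define D where "D n x = 2 * (sqrt (a n x) - 1) / (1 / sqrt (real n))" for n x
  have DG: "L2_tendsto P0 sequentially D G" using r(4) by (simp add: D_def[abs_def])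
  note DL = L2_tendstoD(1)[OF DG] and GL = L2_tendstoD(2)[OF DG]
  have hL: "h \<in> L2 P0" and h0: "expectation h = 0" using h by (auto simp: L2_centered_def)
  note [measurable] = L2_measurable[OF hL] L2_measurable[OF GL] L2_measurable[OF DL] ac_densityD(2)[OF r(3)]
  define e where "e n x = iexp (w n * h x) - 1" for n x
  have [measurable]: "e n \<in> borel_measurable P0" for n unfolding e_def by measurable
  have e1: "norm (e n x) \<le> \<bar>w n\<bar> * \<bar>h x\<bar>" for n x
    unfolding e_def using norm_iexp_minus_1[of "w n * h x"] by (simp add: abs_mult)
  have e2: "norm (e n x) \<le> 2" for n x
    unfolding e_def using norm_triangle_ineq4[of "iexp (w n * h x)" 1] by simp
  obtain C where C: "\<And>n. \<bar>w n * sqrt (real n)\<bar> \<le> C"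
    using convergent_imp_Bseq[of "\<lambda>n. w n * sqrt (real n)"] w by (auto simp: convergent_def Bseq_def)
  have C0: "0 \<le> C" using C[of 0] by simp
  have C2: "real n * (w n)\<^sup>2 \<le> C\<^sup>2" for n
  proof -
    have "real n * (w n)\<^sup>2 = \<bar>w n * sqrt (real n)\<bar>\<^sup>2" by (simp add: power_mult_distrib mult.commute)
    also have "\<dots> \<le> C\<^sup>2" by (intro power_mono C) simp
    finally show ?thesis .
  qed
  have nw2: "(\<lambda>n. real n * (w n)\<^sup>2) \<longlonglongrightarrow> u\<^sup>2"
    using tendsto_power[OF w, of 2] by (simp add: power_mult_distrib mult.commute)
  have "(\<lambda>n. (w n * sqrt (real n)) * (1 / sqrt (real n))) \<longlonglongrightarrow> u * 0"
    by (intro tendsto_mult w) real_asymp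
  moreover have "\<forall>\<^sub>F n in sequentially. (w n * sqrt (real n)) * (1 / sqrt (real n)) = w n"
    using eventually_gt_at_top[of 0] by eventually_elim simp
  ultimately have "w \<longlonglongrightarrow> u * 0" by (rule Lim_transform_eventually)
  then have w0: "w \<longlonglongrightarrow> 0" by simp
  have nw3: "(\<lambda>n. real n * \<bar>w n\<bar> ^ 3) \<longlonglongrightarrow> 0"
    using tendsto_mult[OF nw2 tendsto_rabs_zero[OF w0]] by (simp add: eval_nat_numeral mult_ac)
  text \<open>The three terms of \<open>n * e n * a n\<close> with \<open>a n = 1 + D n / sqrt n + (D n)\<^sup>2 / (4 * n)\<close>.\<close>
  have A: "(\<lambda>n. \<integral>x. of_nat n * (e n x - \<i> * (w n * h x)) \<partial>P0) \<longlonglongrightarrow> (\<integral>x. of_real (- u\<^sup>2 / 2 * (h x)\<^sup>2) \<partial>P0)"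
  proof (rule integral_dominated_convergence)
    show "integrable P0 (\<lambda>x. C\<^sup>2 * (h x)\<^sup>2)" using L2_integrable_square[OF hL] by simp
    show "AE x in P0. norm (of_nat n * (e n x - \<i> * (w n * h x))) \<le> C\<^sup>2 * (h x)\<^sup>2" for n
    proof (rule AE_I2)
      fix x
      have "norm (of_nat n * (e n x - \<i> * (w n * h x))) \<le> real n * ((w n * h x)\<^sup>2 / 2)"
        unfolding e_def norm_mult norm_of_nat
        using norm_iexp_minus_2[of "w n * h x"] by (intro mult_left_mono) auto
      also have "\<dots> = (real n * (w n)\<^sup>2) * ((h x)\<^sup>2 / 2)" by (simp add: power_mult_distrib)
      also have "\<dots> \<le> C\<^sup>2 * ((h x)\<^sup>2 / 2)" by (intro mult_right_mono C2) simp
      also have "\<dots> \<le> C\<^sup>2 * (h x)\<^sup>2" by (intro mult_left_mono) auto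
      finally show "norm (of_nat n * (e n x - \<i> * (w n * h x))) \<le> C\<^sup>2 * (h x)\<^sup>2" .
    qed
    show "AE x in P0. (\<lambda>n. of_nat n * (e n x - \<i> * (w n * h x))) \<longlonglongrightarrow> of_real (- u\<^sup>2 / 2 * (h x)\<^sup>2)"
    proof (rule AE_I2)
      fix x
      have "(\<lambda>n. of_real (- ((real n * (w n)\<^sup>2) / 2 * (h x)\<^sup>2)) :: complex) \<longlonglongrightarrow> of_real (- (u\<^sup>2 / 2 * (h x)\<^sup>2))"
        by (intro tendsto_intros nw2) simp
      moreover have "(\<lambda>n. of_nat n * (e n x - \<i> * (w n * h x)) - of_real (- ((real n * (w n)\<^sup>2) / 2 * (h x)\<^sup>2))) \<longlonglongrightarrow> 0"
      proof (rule Lim_null_comparison)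
        show "(\<lambda>n. (real n * \<bar>w n\<bar> ^ 3) * (\<bar>h x\<bar> ^ 3 / 6)) \<longlonglongrightarrow> 0"
          using tendsto_mult_right[OF nw3, of "\<bar>h x\<bar> ^ 3 / 6"] by simp
        show "\<forall>\<^sub>F n in sequentially. norm (of_nat n * (e n x - \<i> * (w n * h x)) - of_real (- ((real n * (w n)\<^sup>2) / 2 * (h x)\<^sup>2)))
            \<le> (real n * \<bar>w n\<bar> ^ 3) * (\<bar>h x\<bar> ^ 3 / 6)"
        proof (intro always_eventually allI)
          fix n
          have "of_nat n * (e n x - \<i> * (w n * h x)) - of_real (- ((real n * (w n)\<^sup>2) / 2 * (h x)\<^sup>2))
              = of_nat n * (iexp (w n * h x) - 1 - \<i> * (w n * h x) + (w n * h x)\<^sup>2 / 2)"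
            by (simp add: e_def power_mult_distrib algebra_simps)
          also have "norm \<dots> \<le> real n * (\<bar>w n * h x\<bar> ^ 3 / 6)"
            unfolding norm_mult norm_of_nat
            using norm_iexp_minus_3[of "w n * h x"] by (intro mult_left_mono) auto
          finally show "norm (of_nat n * (e n x - \<i> * (w n * h x)) - of_real (- ((real n * (w n)\<^sup>2) / 2 * (h x)\<^sup>2)))
            \<le> (real n * \<bar>w n\<bar> ^ 3) * (\<bar>h x\<bar> ^ 3 / 6)"
            by (simp add: abs_mult power_mult_distrib)
        qed
      qed
      ultimately show "(\<lambda>n. of_nat n * (e n x - \<i> * (w n * h x))) \<longlonglongrightarrow> of_real (- u\<^sup>2 / 2 * (h x)\<^sup>2)"
        using Lim_transform by fastforce
    qed
  qed measurable
  \<comment> \<open>First with the limit \<open>G\<close> in place of \<open>D n\<close>, because a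
    dominating function is available only for a fixed tangent.\<close>
  have B1: "(\<lambda>n. \<integral>x. sqrt (real n) * e n x * G x \<partial>P0) \<longlonglongrightarrow> (\<integral>x. \<i> * of_real (u * (h x * G x)) \<partial>P0)"
  proof (rule integral_dominated_convergence)
    show "integrable P0 (\<lambda>x. C * \<bar>h x * G x\<bar>)" using L2_integrable_mult[OF hL GL] by simp
    show "AE x in P0. norm (sqrt (real n) * e n x * G x) \<le> C * \<bar>h x * G x\<bar>" for n
    proof (rule AE_I2)
      fix x
      have "norm (sqrt (real n) * e n x * G x) \<le> sqrt (real n) * (\<bar>w n\<bar> * \<bar>h x\<bar>) * \<bar>G x\<bar>"
        unfolding norm_mult by (intro mult_mono e1) auto
      also have "\<dots> = \<bar>w n * sqrt (real n)\<bar> * \<bar>h x * G x\<bar>" by (simp add: abs_mult)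
      also have "\<dots> \<le> C * \<bar>h x * G x\<bar>" by (intro mult_right_mono C) simp
      finally show "norm (sqrt (real n) * e n x * G x) \<le> C * \<bar>h x * G x\<bar>" .
    qed
    show "AE x in P0. (\<lambda>n. sqrt (real n) * e n x * G x) \<longlonglongrightarrow> \<i> * of_real (u * (h x * G x))"
    proof (rule AE_I2)
      fix x
      have "(\<lambda>n. \<i> * of_real (w n * sqrt (real n) * (h x * G x))) \<longlonglongrightarrow> \<i> * of_real (u * (h x * G x))"
        by (intro tendsto_intros w)
      moreover have "(\<lambda>n. sqrt (real n) * e n x * G x - \<i> * of_real (w n * sqrt (real n) * (h x * G x))) \<longlonglongrightarrow> 0"
      proof (rule Lim_null_comparison)
        have "(\<lambda>n. \<bar>w n * sqrt (real n)\<bar> * \<bar>w n\<bar> * ((h x)\<^sup>2 * \<bar>G x\<bar>)) \<longlonglongrightarrow> \<bar>u\<bar> * 0 * ((h x)\<^sup>2 * \<bar>G x\<bar>)"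
          by (intro tendsto_intros w tendsto_rabs_zero[OF w0])
        then show "(\<lambda>n. \<bar>w n * sqrt (real n)\<bar> * \<bar>w n\<bar> * ((h x)\<^sup>2 * \<bar>G x\<bar>)) \<longlonglongrightarrow> 0" by simp
        show "\<forall>\<^sub>F n in sequentially. norm (sqrt (real n) * e n x * G x - \<i> * of_real (w n * sqrt (real n) * (h x * G x)))
            \<le> \<bar>w n * sqrt (real n)\<bar> * \<bar>w n\<bar> * ((h x)\<^sup>2 * \<bar>G x\<bar>)"
        proof (intro always_eventually allI)
          fix n
          have "sqrt (real n) * e n x * G x - \<i> * of_real (w n * sqrt (real n) * (h x * G x))
             = sqrt (real n) * (iexp (w n * h x) - 1 - \<i> * (w n * h x)) * G x"
            by (simp add: e_def algebra_simps)
          also have "norm \<dots> \<le> sqrt (real n) * ((w n * h x)\<^sup>2 / 2) * \<bar>G x\<bar>"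
            unfolding norm_mult using norm_iexp_minus_2[of "w n * h x"] by (intro mult_mono) auto
          also have "\<dots> \<le> sqrt (real n) * (w n * h x)\<^sup>2 * \<bar>G x\<bar>" by (intro mult_right_mono mult_left_mono) auto
          also have "\<dots> = \<bar>w n * sqrt (real n)\<bar> * \<bar>w n\<bar> * ((h x)\<^sup>2 * \<bar>G x\<bar>)"
            by (simp add: abs_mult power2_eq_square abs_mult_self_eq algebra_simps)
          finally show "norm (sqrt (real n) * e n x * G x - \<i> * of_real (w n * sqrt (real n) * (h x * G x)))
            \<le> \<bar>w n * sqrt (real n)\<bar> * \<bar>w n\<bar> * ((h x)\<^sup>2 * \<bar>G x\<bar>)" .
        qed
      qed
      ultimately show "(\<lambda>n. sqrt (real n) * e n x * G x) \<longlonglongrightarrow> \<i> * of_real (u * (h x * G x))"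
        using Lim_transform by fastforce
    qed
  qed measurable
  \<comment> \<open>Cauchy-Schwarz with
    \<open>norm (e n x) \<le> \<bar>w n\<bar> * \<bar>h x\<bar>\<close>, uniformly in
    \<open>n\<close>; used with \<open>F = D n - G\<close> it passes from \<open>G\<close> to
    \<open>D n\<close>.\<close>
  have ieD: "integrable P0 (\<lambda>x. sqrt (real n) * e n x * of_real (F x))"
    and beD: "norm (\<integral>x. sqrt (real n) * e n x * of_real (F x) \<partial>P0) \<le> C * (L2_norm P0 h * L2_norm P0 F)" if F: "F \<in> L2 P0" for n F
  proof -
    note [measurable] = L2_measurable[OF F]
    have ah: "(\<lambda>x. \<bar>h x\<bar>) \<in> L2 P0" "(\<lambda>x. \<bar>F x\<bar>) \<in> L2 P0" using hL F by (auto simp: L2_def)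
    have i: "integrable P0 (\<lambda>x. C * (\<bar>h x\<bar> * \<bar>F x\<bar>))" using L2_integrable_mult[OF ah] by simp
    have le: "norm (sqrt (real n) * e n x * of_real (F x)) \<le> C * (\<bar>h x\<bar> * \<bar>F x\<bar>)" for x
    proof -
      have "norm (sqrt (real n) * e n x * of_real (F x)) \<le> sqrt (real n) * (\<bar>w n\<bar> * \<bar>h x\<bar>) * \<bar>F x\<bar>"
        unfolding norm_mult by (intro mult_mono e1) auto
      also have "\<dots> = \<bar>w n * sqrt (real n)\<bar> * (\<bar>h x\<bar> * \<bar>F x\<bar>)" by (simp add: abs_mult)
      also have "\<dots> \<le> C * (\<bar>h x\<bar> * \<bar>F x\<bar>)" by (intro mult_right_mono C) simp
      finally show ?thesis .
    qed
    show i': "integrable P0 (\<lambda>x. sqrt (real n) * e n x * of_real (F x))"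
      by (rule Bochner_Integration.integrable_bound[OF i]) (use le order_trans[OF le abs_ge_self] in auto)
    have "norm (\<integral>x. sqrt (real n) * e n x * of_real (F x) \<partial>P0) \<le> (\<integral>x. C * (\<bar>h x\<bar> * \<bar>F x\<bar>) \<partial>P0)"
      by (rule order_trans[OF integral_norm_bound integral_mono[OF integrable_norm[OF i'] i le]])
    also have "\<dots> \<le> C * (L2_norm P0 h * L2_norm P0 F)"
      using L2_Cauchy_Schwarz[OF ah] C0 by (auto intro!: mult_left_mono simp: L2_norm_def)
    finally show "norm (\<integral>x. sqrt (real n) * e n x * of_real (F x) \<partial>P0) \<le> C * (L2_norm P0 h * L2_norm P0 F)" .
  qed
  have "(\<lambda>n. (\<integral>x. sqrt (real n) * e n x * G x \<partial>P0) + (\<integral>x. sqrt (real n) * e n x * of_real (D n x - G x) \<partial>P0))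
     \<longlonglongrightarrow> (\<integral>x. \<i> * of_real (u * (h x * G x)) \<partial>P0) + 0"
  proof (rule tendsto_add[OF B1], rule Lim_null_comparison)
    show "(\<lambda>n. C * (L2_norm P0 h * L2_norm P0 (\<lambda>x. D n x - G x))) \<longlonglongrightarrow> 0"
      using tendsto_mult_left[OF tendsto_mult_left[OF L2_tendstoD(3)[OF DG], of "L2_norm P0 h"], of C] by simp
  qed (intro always_eventually allI beD L2_diff DL GL)
  moreover have "(\<integral>x. sqrt (real n) * e n x * D n x \<partial>P0) =
      (\<integral>x. sqrt (real n) * e n x * G x \<partial>P0) + (\<integral>x. sqrt (real n) * e n x * of_real (D n x - G x) \<partial>P0)" for n
    unfolding Bochner_Integration.integral_add[OF ieD[OF GL] ieD[OF L2_diff[OF DL GL]], symmetric]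
    by (rule Bochner_Integration.integral_cong[OF refl]) (simp add: algebra_simps)
  ultimately have B: "(\<lambda>n. \<integral>x. sqrt (real n) * e n x * D n x \<partial>P0) \<longlonglongrightarrow> (\<integral>x. \<i> * of_real (u * (h x * G x)) \<partial>P0)"
    by simp
  \<comment> \<open>\<open>e n\<close> is bounded by 2 and tends to 0 pointwise. The quadratic term
    with \<open>D n\<close> is then reduced to this one by
    \<open>D\<^sup>2 \<le> 2 * (D - G)\<^sup>2 + 2 * G\<^sup>2\<close>.\<close>
  have Cg: "(\<lambda>n. \<integral>x. norm (e n x) * (G x)\<^sup>2 \<partial>P0) \<longlonglongrightarrow> (\<integral>x. 0 \<partial>P0)"
  proof (rule integral_dominated_convergence)
    show "integrable P0 (\<lambda>x. 2 * (G x)\<^sup>2)" using L2_integrable_square[OF GL] by simp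
    show "AE x in P0. norm (norm (e n x) * (G x)\<^sup>2) \<le> 2 * (G x)\<^sup>2" for n
    proof (rule AE_I2)
      fix x
      have "norm (e n x) * (G x)\<^sup>2 \<le> 2 * (G x)\<^sup>2" by (rule mult_right_mono[OF e2]) simp
      then show "norm (norm (e n x) * (G x)\<^sup>2) \<le> 2 * (G x)\<^sup>2" by simp
    qed
    show "AE x in P0. (\<lambda>n. norm (e n x) * (G x)\<^sup>2) \<longlonglongrightarrow> 0"
    proof (rule AE_I2)
      fix x
      have "(\<lambda>n. \<bar>w n\<bar> * \<bar>h x\<bar>) \<longlonglongrightarrow> 0"
        using tendsto_mult_right[OF tendsto_rabs_zero[OF w0], of "\<bar>h x\<bar>"] by simp
      then have "(\<lambda>n. e n x) \<longlonglongrightarrow> 0"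
        by (rule Lim_null_comparison[OF always_eventually[OF allI[OF e1]]])
      from tendsto_mult_right[OF tendsto_norm_zero[OF this], of "(G x)\<^sup>2"]
      show "(\<lambda>n. norm (e n x) * (G x)\<^sup>2) \<longlonglongrightarrow> 0" by simp
    qed
  qed measurable
  have ie2: "integrable P0 (\<lambda>x. e n x * of_real ((D n x)\<^sup>2))" for n
  proof (rule Bochner_Integration.integrable_bound)
    show "integrable P0 (\<lambda>x. 2 * (D n x)\<^sup>2)" using L2_integrable_square[OF DL] by simp
    show "AE x in P0. norm (e n x * of_real ((D n x)\<^sup>2)) \<le> norm (2 * (D n x)\<^sup>2)"
    proof (rule AE_I2)
      fix x
      have "norm (e n x) * (D n x)\<^sup>2 \<le> 2 * (D n x)\<^sup>2" by (rule mult_right_mono[OF e2]) simp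
      then show "norm (e n x * of_real ((D n x)\<^sup>2)) \<le> norm (2 * (D n x)\<^sup>2)"
        by (simp only: norm_mult norm_of_real abs_power2) simp
    qed
  qed measurable
  have C: "(\<lambda>n. \<integral>x. e n x * of_real ((D n x)\<^sup>2) \<partial>P0) \<longlonglongrightarrow> 0"
  proof (rule Lim_null_comparison)
    have "(\<lambda>n. 4 * (L2_norm P0 (\<lambda>x. D n x - G x))\<^sup>2 + 2 * (\<integral>x. norm (e n x) * (G x)\<^sup>2 \<partial>P0)) \<longlonglongrightarrow> 4 * 0\<^sup>2 + 2 * (\<integral>x. 0 \<partial>P0)"
      by (intro tendsto_intros Cg L2_tendstoD(3)[OF DG])
    then show "(\<lambda>n. 4 * (L2_norm P0 (\<lambda>x. D n x - G x))\<^sup>2 + 2 * (\<integral>x. norm (e n x) * (G x)\<^sup>2 \<partial>P0)) \<longlonglongrightarrow> 0" by simp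
    show "\<forall>\<^sub>F n in sequentially. norm (\<integral>x. e n x * of_real ((D n x)\<^sup>2) \<partial>P0)
        \<le> 4 * (L2_norm P0 (\<lambda>x. D n x - G x))\<^sup>2 + 2 * (\<integral>x. norm (e n x) * (G x)\<^sup>2 \<partial>P0)"
    proof (intro always_eventually allI)
      fix n
      have i1: "integrable P0 (\<lambda>x. (D n x - G x)\<^sup>2)" using L2_integrable_square[OF L2_diff[OF DL GL]] .
      have i2: "integrable P0 (\<lambda>x. norm (e n x) * (G x)\<^sup>2)"
      proof (rule Bochner_Integration.integrable_bound)
        show "integrable P0 (\<lambda>x. 2 * (G x)\<^sup>2)" using L2_integrable_square[OF GL] by simp
        show "AE x in P0. norm (norm (e n x) * (G x)\<^sup>2) \<le> norm (2 * (G x)\<^sup>2)"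
        proof (rule AE_I2)
          fix x
          have "norm (e n x) * (G x)\<^sup>2 \<le> 2 * (G x)\<^sup>2" by (rule mult_right_mono[OF e2]) simp
          then show "norm (norm (e n x) * (G x)\<^sup>2) \<le> norm (2 * (G x)\<^sup>2)" by simp
        qed
      qed measurable
      have le: "norm (e n x * of_real ((D n x)\<^sup>2)) \<le> 4 * (D n x - G x)\<^sup>2 + 2 * (norm (e n x) * (G x)\<^sup>2)" for x
      proof -
        have "(D n x)\<^sup>2 \<le> 2 * (D n x - G x)\<^sup>2 + 2 * (G x)\<^sup>2"
          using sum_squares_bound[of "D n x - G x" "G x"] zero_le_power2[of "D n x - 2 * G x"]
          by (simp add: power2_eq_square algebra_simps)
        then have "norm (e n x) * (D n x)\<^sup>2 \<le> norm (e n x) * (2 * (D n x - G x)\<^sup>2 + 2 * (G x)\<^sup>2)"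
          by (intro mult_left_mono) auto
        also have "\<dots> = norm (e n x) * (2 * (D n x - G x)\<^sup>2) + 2 * (norm (e n x) * (G x)\<^sup>2)"
          by (simp add: algebra_simps)
        also have "norm (e n x) * (2 * (D n x - G x)\<^sup>2) \<le> 2 * (2 * (D n x - G x)\<^sup>2)"
          by (intro mult_right_mono e2) auto
        finally show ?thesis by (simp only: norm_mult norm_of_real abs_power2) simp
      qed
      have "norm (\<integral>x. e n x * of_real ((D n x)\<^sup>2) \<partial>P0) \<le> (\<integral>x. 4 * (D n x - G x)\<^sup>2 + 2 * (norm (e n x) * (G x)\<^sup>2) \<partial>P0)"
        by (rule order_trans[OF integral_norm_bound integral_mono[OF integrable_norm[OF ie2] _ le]]) (use i1 i2 in auto)
      then show "norm (\<integral>x. e n x * of_real ((D n x)\<^sup>2) \<partial>P0)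
        \<le> 4 * (L2_norm P0 (\<lambda>x. D n x - G x))\<^sup>2 + 2 * (\<integral>x. norm (e n x) * (G x)\<^sup>2 \<partial>P0)"
        using i1 i2 by (simp add: L2_norm_power2)
    qed
  qed
  have ie: "integrable P0 (e n)" for n
    by (rule integrable_const_bound[where B = 2]) (use e2 in auto)
  define S where "S n = (\<integral>x. of_nat n * (e n x - \<i> * (w n * h x)) \<partial>P0) + (\<integral>x. sqrt (real n) * e n x * D n x \<partial>P0)
      + (\<integral>x. e n x * of_real ((D n x)\<^sup>2) \<partial>P0) / 4" for n
  have S: "S \<longlonglongrightarrow> (\<integral>x. of_real (- u\<^sup>2 / 2 * (h x)\<^sup>2) \<partial>P0) + (\<integral>x. \<i> * of_real (u * (h x * G x)) \<partial>P0) + 0 / 4"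
    unfolding S_def by (intro tendsto_intros A B C) simp
  have lim_eq: "(\<integral>x. of_real (- u\<^sup>2 / 2 * (h x)\<^sup>2) \<partial>P0) + (\<integral>x. \<i> * of_real (u * (h x * G x)) \<partial>P0) + 0 / 4
      = of_real (- u\<^sup>2 / 2 * (\<integral>x. (h x)\<^sup>2 \<partial>P0)) + \<i> * of_real (u * (\<integral>x. h x * G x \<partial>P0))"
    by (simp only: integral_complex_of_real integral_mult_right_zero) simp
  \<comment> \<open>The singular mass enters twice: when \<open>P n\<close> is replaced by its
    absolutely continuous part, and when 1 is replaced by the mass of \<open>a n\<close>.\<close>
  have mass: "(\<lambda>n. 2 * (real n * (1 - (\<integral>x. a n x \<partial>P0)))) \<longlonglongrightarrow> 0"
    using tendsto_mult_left[OF r(5), of 2] by (simp add: power_divide mult.commute)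
  show ?thesis
  proof (rule Lim_transform2[OF S[unfolded lim_eq]], rule Lim_null_comparison[OF _ mass])
    show "\<forall>\<^sub>F n in sequentially. norm (S n - of_nat n * ((\<integral>x. iexp (w n * h x) \<partial>P n) - 1))
        \<le> 2 * (real n * (1 - (\<integral>x. a n x \<partial>P0)))"
      using eventually_gt_at_top[of 0]
    proof eventually_elim
      case (elim n)
      have t: "norm ((\<integral>x. iexp (w n * h x) \<partial>P n) - (\<integral>x. a n x *\<^sub>R iexp (w n * h x) \<partial>P0)) \<le> 1 - (\<integral>x. a n x \<partial>P0)"
        "integrable P0 (\<lambda>x. a n x *\<^sub>R iexp (w n * h x))"
        by (rule ac_density_test_integral[OF r(3) r(2)]; simp)+
      have ia: "integrable P0 (\<lambda>x. complex_of_real (a n x))"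
        using ac_density_integrable(1)[OF r(3,2)] by simp
      have iae: "integrable P0 (\<lambda>x. a n x *\<^sub>R e n x)"
        unfolding e_def using Bochner_Integration.integrable_diff[OF t(2) ia]
        by (simp only: scaleR_conv_of_real right_diff_distrib mult_1_right)
      have an: "of_nat n * (a n x *\<^sub>R e n x) = of_nat n * e n x + sqrt (real n) * e n x * D n x + e n x * of_real ((D n x)\<^sup>2) / 4" for x
      proof -
        have "real n * a n x = real n + sqrt (real n) * D n x + (D n x)\<^sup>2 / 4"
          using elim ac_densityD(3)[OF r(3), of n x] by (simp add: D_def power2_eq_square field_simps)
        then have "of_real (real n * a n x) * e n x = of_real (real n + sqrt (real n) * D n x + (D n x)\<^sup>2 / 4) * e n x"
          by simp
        then show ?thesis by (simp add: scaleR_conv_of_real algebra_simps)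
      qed
      \<comment> \<open>Centering of \<open>h\<close> again: the linear term subtracted above
        integrates to 0, so the subtraction is free.\<close>
      have ih: "(\<integral>x. of_nat n * (e n x - \<i> * (w n * h x)) \<partial>P0) = (\<integral>x. of_nat n * e n x \<partial>P0)"
      proof -
        have "integrable P0 (\<lambda>x. \<i> * complex_of_real (w n * h x))" using L2_imp_integrable[OF hL] by simp
        moreover have "(\<integral>x. \<i> * complex_of_real (w n * h x) \<partial>P0) = 0"
          using h0 by (simp only: integral_mult_right_zero integral_complex_of_real) simp
        ultimately show ?thesis using ie by simp
      qed
      have "of_nat n * (\<integral>x. a n x *\<^sub>R e n x \<partial>P0) = (\<integral>x. of_nat n * (a n x *\<^sub>R e n x) \<partial>P0)"
        by (simp only: integral_mult_right_zero)
      also have "\<dots> = S n"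
        unfolding an S_def ih
        using ie ieD[OF DL] ie2 by simp
      finally have Sn: "S n = of_nat n * (\<integral>x. a n x *\<^sub>R e n x \<partial>P0)" ..
      have X: "(\<integral>x. a n x *\<^sub>R e n x \<partial>P0) = (\<integral>x. a n x *\<^sub>R iexp (w n * h x) \<partial>P0) - of_real (\<integral>x. a n x \<partial>P0)"
        unfolding e_def integral_complex_of_real[symmetric] Bochner_Integration.integral_diff[OF t(2) ia, symmetric]
        by (simp only: scaleR_conv_of_real right_diff_distrib mult_1_right)
      have "S n - of_nat n * ((\<integral>x. iexp (w n * h x) \<partial>P n) - 1) =
          of_nat n * (of_real (1 - (\<integral>x. a n x \<partial>P0)) - ((\<integral>x. iexp (w n * h x) \<partial>P n) - (\<integral>x. a n x *\<^sub>R iexp (w n * h x) \<partial>P0)))"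
        unfolding Sn X of_real_diff of_real_1 by (simp only: right_diff_distrib) simp
      also have "norm \<dots> \<le> real n * ((1 - (\<integral>x. a n x \<partial>P0)) + (1 - (\<integral>x. a n x \<partial>P0)))"
        unfolding norm_mult norm_of_nat
      proof (rule mult_left_mono[OF order_trans[OF norm_triangle_ineq4 add_mono[OF _ t(1)]]])
        show "norm (complex_of_real (1 - (\<integral>x. a n x \<partial>P0))) \<le> 1 - (\<integral>x. a n x \<partial>P0)"
          unfolding norm_of_real using ac_density_integrable(2)[OF r(3,2), of n] by simp
      qed simp
      also have "\<dots> = 2 * (real n * (1 - (\<integral>x. a n x \<partial>P0)))" by (simp only: distrib_left mult_2)
      finally show "norm (S n - of_nat n * ((\<integral>x. iexp (w n * h x) \<partial>P n) - 1))
        \<le> 2 * (real n * (1 - (\<integral>x. a n x \<partial>P0)))" .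
    qed
  qed
qed

lemma exp_minus_one_scaled: "(\<lambda>n. of_nat n * (exp (z / of_nat n) - 1)) \<longlonglongrightarrow> (z::complex)"
proof -
  have "((\<lambda>h. exp (h * z)) has_field_derivative z) (at 0)"
    by (auto intro!: derivative_eq_intros)
  then have d: "((\<lambda>h. (exp (h * z) - 1) / h) \<longlongrightarrow> z) (at 0)"
    by (simp add: has_field_derivative_iff)
  have "filterlim (\<lambda>n. inverse (of_nat n :: complex)) (at 0) sequentially"
    using tendsto_inverse_0_at_top[OF filterlim_real_sequentially]
    by (auto simp: filterlim_at intro!: eventually_mono[OF eventually_gt_at_top[of 0]] tendsto_of_real[where 'a = complex, THEN tendsto_eq_rhs, of _ 0, simplified] lim_inverse_n[simplified])
  from filterlim_compose[OF d this] show ?thesis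
    by (simp add: field_simps)
qed

text \<open>The power is compared with that of \<open>exp (z / n)\<close>. Both bases lie in the
  unit disc, since \<open>Re z \<le> 0\<close>, so the difference of the powers is at most
  \<open>m n\<close> times the difference of the bases. This avoids complex logarithms.\<close>

lemma one_sample_char_power:
  assumes R: "sqrt_differentiable P0 sequentially (\<lambda>n. 1 / sqrt (real n)) P a G"
    and h: "h \<in> L2_centered P0"
    and w: "(\<lambda>n. w n * sqrt (real n)) \<longlonglongrightarrow> u"
    and m: "(\<lambda>n. real (m n) / real n) \<longlonglongrightarrow> \<rho>"
  shows "(\<lambda>n. (\<integral>x. iexp (w n * h x) \<partial>P n) ^ m n) \<longlonglongrightarrow>
    exp (of_real \<rho> * (of_real (- u\<^sup>2 / 2 * (\<integral>x. (h x)\<^sup>2 \<partial>P0)) + \<i> * of_real (u * (\<integral>x. h x * G x \<partial>P0))))"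
proof -
  define z where "z = of_real (- u\<^sup>2 / 2 * (\<integral>x. (h x)\<^sup>2 \<partial>P0)) + \<i> * of_real (u * (\<integral>x. h x * G x \<partial>P0))"
  define \<phi> where "\<phi> n = (\<integral>x. iexp (w n * h x) \<partial>P n)" for n
  have \<phi>: "(\<lambda>n. of_nat n * (\<phi> n - 1)) \<longlonglongrightarrow> z"
    unfolding \<phi>_def z_def by (rule one_sample_char_expansion[OF R h w])
  have \<phi>1: "norm (\<phi> n) \<le> 1" for n
  proof -
    interpret prob_space "P n" by (rule sqrt_differentiableD(2)[OF R])
    have "norm (\<phi> n) \<le> (\<integral>x. norm (iexp (w n * h x)) \<partial>P n)" unfolding \<phi>_def by (rule integral_norm_bound)
    then show ?thesis by (simp add: prob_space)
  qed
  have Rez: "Re z \<le> 0" by (simp add: z_def mult_nonneg_nonneg)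
  have e1: "norm (exp (z / of_nat n)) \<le> 1" for n
    using Rez by (simp add: divide_nonpos_nonneg)
  have "(\<lambda>n. norm (of_real (real (m n) / real n) * (of_nat n * (\<phi> n - 1) - of_nat n * (exp (z / of_nat n) - 1))))
      \<longlonglongrightarrow> norm (of_real \<rho> * (z - z))"
    by (intro tendsto_intros m \<phi> exp_minus_one_scaled)
  then have lim0: "(\<lambda>n. norm (of_real (real (m n) / real n) * (of_nat n * (\<phi> n - 1) - of_nat n * (exp (z / of_nat n) - 1)))) \<longlonglongrightarrow> 0"
    by simp
  have "(\<lambda>n. exp (of_real (real (m n) / real n) * z)) \<longlonglongrightarrow> exp (of_real \<rho> * z)"
    by (intro tendsto_intros m)
  then show ?thesis
    unfolding z_def[symmetric] \<phi>_def[symmetric]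
  proof (rule Lim_transform2, intro Lim_null_comparison[OF _ lim0])
    show "\<forall>\<^sub>F n in sequentially. norm (exp (of_real (real (m n) / real n) * z) - \<phi> n ^ m n)
        \<le> norm (of_real (real (m n) / real n) * (of_nat n * (\<phi> n - 1) - of_nat n * (exp (z / of_nat n) - 1)))"
      using eventually_gt_at_top[of 0]
    proof eventually_elim
      case (elim n)
      have "exp (of_real (real (m n) / real n) * z) = exp (z / of_nat n) ^ m n"
        by (simp add: exp_of_nat_mult[symmetric] field_simps)
      then have "norm (exp (of_real (real (m n) / real n) * z) - \<phi> n ^ m n) \<le> m n * norm (exp (z / of_nat n) - \<phi> n)"
        using norm_power_diff[OF e1 \<phi>1] by simp
      also have "\<dots> = norm (of_nat (m n) * (\<phi> n - exp (z / of_nat n)))"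
        by (simp add: norm_mult norm_minus_commute)
      also have "of_nat (m n) * (\<phi> n - exp (z / of_nat n)) =
          of_real (real (m n) / real n) * (of_nat n * (\<phi> n - 1) - of_nat n * (exp (z / of_nat n) - 1))"
        using elim by (simp add: field_simps)
      finally show ?case .
    qed
  qed
qed

section \<open>Linear statistics of two samples\<close>

lemma PiM_integral_power:
  fixes f :: "'a \<Rightarrow> 'c :: {real_normed_field, banach, second_countable_topology}"
  assumes P: "prob_space P" and f: "integrable P f" and I: "finite I"
  shows "integrable (PiM I (\<lambda>_. P)) (\<lambda>\<omega>. \<Prod>i\<in>I. f (\<omega> i))"
    "(\<integral>\<omega>. (\<Prod>i\<in>I. f (\<omega> i)) \<partial>PiM I (\<lambda>_. P)) = (\<integral>x. f x \<partial>P) ^ card I"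
proof -
  interpret P: prob_space P by fact
  interpret product_sigma_finite "\<lambda>_. P"
    by (simp add: product_sigma_finite_def P.sigma_finite_measure)
  show "integrable (PiM I (\<lambda>_. P)) (\<lambda>\<omega>. \<Prod>i\<in>I. f (\<omega> i))"
    by (rule product_integrable_prod[OF I f])
  show "(\<integral>\<omega>. (\<Prod>i\<in>I. f (\<omega> i)) \<partial>PiM I (\<lambda>_. P)) = (\<integral>x. f x \<partial>P) ^ card I"
    by (subst product_integral_prod[OF I f]) simp
qed

lemma prob_space_PiM_const: "prob_space P \<Longrightarrow> prob_space (PiM I (\<lambda>_. P))"
  by (rule prob_space_PiM) simp

lemma prob_space_two_sample_product:
  "prob_space P \<Longrightarrow> prob_space Q \<Longrightarrow> prob_space (two_sample_product m1 m2 P Q)"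
  unfolding two_sample_product_def by (intro prob_space_pair prob_space_PiM_const)

lemma sets_two_sample_product:
  assumes "sets P = sets P'" "sets Q = sets Q'"
  shows "sets (two_sample_product m1 m2 P Q) = sets (two_sample_product m1 m2 P' Q')"
  unfolding two_sample_product_def by (intro sets_pair_measure_cong sets_PiM_cong refl assms)

lemma two_sample_integral_prod:
  fixes f :: "'a \<Rightarrow> 'c :: {real_normed_field, banach, second_countable_topology}" and g :: "'b \<Rightarrow> 'c"
  assumes P: "prob_space P" and Q: "prob_space Q" and f: "integrable P f" and g: "integrable Q g"
  shows "integrable (two_sample_product m1 m2 P Q) (\<lambda>\<omega>. (\<Prod>i=1..m1. f (fst \<omega> i)) * (\<Prod>j=1..m2. g (snd \<omega> j)))"
    "(\<integral>\<omega>. (\<Prod>i=1..m1. f (fst \<omega> i)) * (\<Prod>j=1..m2. g (snd \<omega> j)) \<partial>two_sample_product m1 m2 P Q)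
      = (\<integral>x. f x \<partial>P) ^ m1 * (\<integral>y. g y \<partial>Q) ^ m2"
  unfolding two_sample_product_def
  using pair_integral_mult[OF prob_space_PiM_const[OF P] prob_space_PiM_const[OF Q]
      PiM_integral_power(1)[OF P f, of "{1..m1}"] PiM_integral_power(1)[OF Q g, of "{1..m2}"]]
    PiM_integral_power(2)[OF P f, of "{1..m1}"] PiM_integral_power(2)[OF Q g, of "{1..m2}"]
  by simp_all

text \<open>Common form of the test statistic, with coefficients \<open>sqrt n / n1\<close> and
  \<open>sqrt n / n2\<close>, and of the log-likelihood ratio of the tilt up to a constant, with
  both coefficients \<open>1 / sqrt n\<close>.\<close>

definition linear_statistic ::
    "real \<Rightarrow> ('a \<Rightarrow> real) \<Rightarrow> nat \<Rightarrow> real \<Rightarrow> ('b \<Rightarrow> real) \<Rightarrow> nat \<Rightarrow> (nat \<Rightarrow> 'a) \<times> (nat \<Rightarrow> 'b) \<Rightarrow> real" where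
  "linear_statistic c1 h1 m1 c2 h2 m2 \<omega> = c1 * (\<Sum>i=1..m1. h1 (fst \<omega> i)) + c2 * (\<Sum>j=1..m2. h2 (snd \<omega> j))"

lemma measurable_linear_statistic [measurable]:
  assumes [measurable]: "h1 \<in> borel_measurable P" "h2 \<in> borel_measurable Q"
  shows "linear_statistic c1 h1 m1 c2 h2 m2 \<in> borel_measurable (two_sample_product m1 m2 P Q)"
  unfolding linear_statistic_def two_sample_product_def by measurable

lemma linear_statistic_char:
  assumes P: "prob_space P" and Q: "prob_space Q"
    and h: "h1 \<in> borel_measurable P" "h2 \<in> borel_measurable Q"
  shows "(\<integral>\<omega>. iexp (\<theta> * linear_statistic c1 h1 m1 c2 h2 m2 \<omega>) \<partial>two_sample_product m1 m2 P Q)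
    = (\<integral>x. iexp ((\<theta> * c1) * h1 x) \<partial>P) ^ m1 * (\<integral>y. iexp ((\<theta> * c2) * h2 y) \<partial>Q) ^ m2"
proof -
  interpret P: prob_space P by fact
  interpret Q: prob_space Q by fact
  note [measurable] = h
  have i: "integrable P (\<lambda>x. iexp ((\<theta> * c1) * h1 x))" "integrable Q (\<lambda>y. iexp ((\<theta> * c2) * h2 y))"
    by (rule P.integrable_const_bound[where B = 1] Q.integrable_const_bound[where B = 1]; simp)+
  have "iexp (\<theta> * linear_statistic c1 h1 m1 c2 h2 m2 \<omega>) =
      (\<Prod>i=1..m1. iexp ((\<theta> * c1) * h1 (fst \<omega> i))) * (\<Prod>j=1..m2. iexp ((\<theta> * c2) * h2 (snd \<omega> j)))" for \<omega>
    by (simp add: linear_statistic_def exp_sum[symmetric] exp_add[symmetric] sum_distrib_left algebra_simps)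
  then show ?thesis by (simp only: two_sample_integral_prod(2)[OF P Q i])
qed

section \<open>The standard normal distribution function\<close>

abbreviation std_normal_cdf :: "real \<Rightarrow> real" where
  "std_normal_cdf \<equiv> cdf std_normal_distribution"

lemma isCont_std_normal_cdf: "isCont std_normal_cdf x"
proof -
  interpret real_distribution std_normal_distribution by (rule real_dist_normal_dist)
  have "emeasure std_normal_distribution {x} = (\<integral>\<^sup>+y. 0 \<partial>lborel)"
    by (subst emeasure_density) (auto intro!: nn_integral_cong_AE AE_mp[OF AE_lborel_singleton[of x]] AE_I2 simp del: nn_integral_const split: split_indicator, simp)
  then show ?thesis by (simp add: isCont_cdf measure_def)
qed

text \<open>The characteristic function is even, so the distribution is invariant under reflection.
  The identity serves to pass from a test to its complement.\<close>

lemma std_normal_cdf_minus: "std_normal_cdf (- x) = 1 - std_normal_cdf x"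
proof -
  interpret real_distribution std_normal_distribution by (rule real_dist_normal_dist)
  have d: "distr std_normal_distribution borel uminus = std_normal_distribution"
  proof (rule Levy_uniqueness)
    show "real_distribution (distr std_normal_distribution borel uminus)"
      by (rule real_distribution_distr) simp
    show "real_distribution std_normal_distribution" by (rule real_dist_normal_dist)
    have "char (distr std_normal_distribution borel uminus) t = char std_normal_distribution (- t)" for t
      unfolding char_def by (subst integral_distr) auto
    then show "char (distr std_normal_distribution borel uminus) = char std_normal_distribution"
      by (auto simp: char_std_normal_distribution)
  qed
  have "std_normal_cdf (- x) = measure (distr std_normal_distribution borel uminus) {..- x}"
    by (simp add: d cdf_def2)
  also have "\<dots> = measure std_normal_distribution {x..}"
    by (subst measure_distr) (auto intro!: arg_cong[where f = "measure _"])
  also have "\<dots> = measure std_normal_distribution {x<..}"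
  proof -
    have "measure std_normal_distribution {x..} = measure std_normal_distribution {x} + measure std_normal_distribution {x<..}"
      by (subst finite_measure_Union[symmetric]) (auto intro!: arg_cong[where f = "measure _"])
    then show ?thesis using isCont_std_normal_cdf[of x] by (simp add: isCont_cdf)
  qed
  also have "\<dots> = measure std_normal_distribution (space std_normal_distribution - {..x})"
    by (intro arg_cong[where f = "measure _"]) auto
  also have "\<dots> = 1 - std_normal_cdf x"
    by (subst prob_compl) (auto simp: cdf_def2)
  finally show ?thesis .
qed

text \<open>\<open>inv\<close> selects some preimage, so the point is that \<open>p\<close> is
  attained; this follows from the limits at both ends and continuity.\<close>

lemma std_normal_cdf_quantile:
  assumes "0 < p" "p < 1"
  shows "std_normal_cdf (std_normal_quantile p) = p"
proof -
  interpret real_distribution std_normal_distribution by (rule real_dist_normal_dist)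
  have "\<forall>\<^sub>F x in at_bot. std_normal_cdf x < p"
    using order_tendstoD(2)[OF cdf_lim_at_bot assms(1)] .
  then obtain l where l: "\<And>x. x \<le> l \<Longrightarrow> std_normal_cdf x < p" by (auto simp: eventually_at_bot_linorder)
  have "\<forall>\<^sub>F x in at_top. std_normal_cdf x > p"
    using order_tendstoD(1)[OF cdf_lim_at_top_prob assms(2)] .
  then obtain r where r: "\<And>x. r \<le> x \<Longrightarrow> std_normal_cdf x > p" by (auto simp: eventually_at_top_linorder)
  have "\<exists>x\<ge>min l r. x \<le> max l r \<and> std_normal_cdf x = p"
    using l[of "min l r"] r[of "max l r"] isCont_std_normal_cdf by (intro IVT) (auto intro: less_imp_le)
  then have "p \<in> range std_normal_cdf" by auto
  then show ?thesis unfolding std_normal_quantile_def by (rule f_inv_into_f)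
qed

text \<open>The tangents shift the limiting mean and leave the limiting variance unchanged, as in Le
  Cam's third lemma. It is applied to the test statistic and, in the power bound, to the exponent of
  the tilt under both \<open>s\<close> and \<open>s'\<close>.\<close>

lemma linear_statistic_asymptotics:
  assumes le: "local_expansion P0 Q0 s a b G1 G2"
    and h: "h1 \<in> L2_centered P0" "h2 \<in> L2_centered Q0"
    and c: "(\<lambda>n. c1 n * sqrt (real n)) \<longlonglongrightarrow> u1" "(\<lambda>n. c2 n * sqrt (real n)) \<longlonglongrightarrow> u2"
    and m: "(\<lambda>n. real (m1 n) / real n) \<longlonglongrightarrow> \<rho>1" "(\<lambda>n. real (m2 n) / real n) \<longlonglongrightarrow> \<rho>2"
    and \<sigma>: "\<sigma> > 0" "\<sigma>\<^sup>2 = \<rho>1 * u1\<^sup>2 * (\<integral>x. (h1 x)\<^sup>2 \<partial>P0) + \<rho>2 * u2\<^sup>2 * (\<integral>y. (h2 y)\<^sup>2 \<partial>Q0)"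
    and \<mu>: "\<mu> = \<rho>1 * u1 * (\<integral>x. h1 x * G1 x \<partial>P0) + \<rho>2 * u2 * (\<integral>y. h2 y * G2 y \<partial>Q0)"
  shows "(\<lambda>n. measure (two_sample_product (m1 n) (m2 n) (fst s n) (snd s n))
      {\<omega> \<in> space (two_sample_product (m1 n) (m2 n) (fst s n) (snd s n)).
         x < linear_statistic (c1 n) h1 (m1 n) (c2 n) h2 (m2 n) \<omega>}) \<longlonglongrightarrow> 1 - std_normal_cdf ((x - \<mu>) / \<sigma>)"
proof -
  have d1: "sqrt_differentiable P0 sequentially (\<lambda>n. 1 / sqrt (real n)) (fst s) a G1"
    and d2: "sqrt_differentiable Q0 sequentially (\<lambda>n. 1 / sqrt (real n)) (snd s) b G2"
    using le by (auto simp: local_expansion_def)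
  note D1 = sqrt_differentiableD[OF d1] and D2 = sqrt_differentiableD[OF d2]
  let ?R = "\<lambda>n. two_sample_product (m1 n) (m2 n) (fst s n) (snd s n)"
  let ?S = "\<lambda>n. linear_statistic (c1 n) h1 (m1 n) (c2 n) h2 (m2 n)"
  have hm0: "h1 \<in> borel_measurable P0" "h2 \<in> borel_measurable Q0"
    using h by (auto simp: L2_centered_def dest: L2_measurable)
  have hm: "h1 \<in> borel_measurable (fst s n)" "h2 \<in> borel_measurable (snd s n)" for n
    using hm0 by (simp_all add: measurable_cong_sets[OF ac_densityD(1)[OF D1(3)] refl] measurable_cong_sets[OF ac_densityD(1)[OF D2(3)] refl])
  have Sm [measurable]: "?S n \<in> borel_measurable (?R n)" for n
    by (rule measurable_linear_statistic[OF hm])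
  have prR: "prob_space (?R n)" for n by (intro prob_space_two_sample_product D1 D2)
  define M where "M n = distr (?R n) borel (\<lambda>\<omega>. (?S n \<omega> - \<mu>) / \<sigma>)" for n
  have rd: "real_distribution (M n)" for n
  proof -
    interpret prob_space "?R n" by (rule prR)
    show ?thesis unfolding M_def by (rule real_distribution_distr) measurable
  qed
  have "(\<lambda>n. char (M n) \<theta>) \<longlonglongrightarrow> char std_normal_distribution \<theta>" for \<theta>
  proof -
    define \<eta> where "\<eta> = \<theta> / \<sigma>"
    have ch: "char (M n) \<theta> = iexp (- (\<eta> * \<mu>)) *
        ((\<integral>x. iexp ((\<eta> * c1 n) * h1 x) \<partial>fst s n) ^ m1 n * (\<integral>y. iexp ((\<eta> * c2 n) * h2 y) \<partial>snd s n) ^ m2 n)" for n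
    proof -
      have "char (M n) \<theta> = (\<integral>\<omega>. iexp (\<theta> * ((?S n \<omega> - \<mu>) / \<sigma>)) \<partial>?R n)"
        unfolding char_def M_def by (subst integral_distr) auto
      also have "\<dots> = (\<integral>\<omega>. iexp (- (\<eta> * \<mu>)) * iexp (\<eta> * ?S n \<omega>) \<partial>?R n)"
        by (intro Bochner_Integration.integral_cong refl)
           (simp add: \<eta>_def exp_add[symmetric] right_diff_distrib diff_divide_distrib)
      also have "\<dots> = iexp (- (\<eta> * \<mu>)) * (\<integral>\<omega>. iexp (\<eta> * ?S n \<omega>) \<partial>?R n)"
        by (rule integral_mult_right_zero)
      also note linear_statistic_char[OF D1(2) D2(2) hm]
      finally show ?thesis .
    qed
    have w: "(\<lambda>n. (\<eta> * c1 n) * sqrt (real n)) \<longlonglongrightarrow> \<eta> * u1" "(\<lambda>n. (\<eta> * c2 n) * sqrt (real n)) \<longlonglongrightarrow> \<eta> * u2"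
      using tendsto_mult_left[OF c(1), of \<eta>] tendsto_mult_left[OF c(2), of \<eta>] by (simp_all add: mult.assoc)
    have "(\<lambda>n. char (M n) \<theta>) \<longlonglongrightarrow> iexp (- (\<eta> * \<mu>)) *
       (exp (of_real \<rho>1 * (of_real (- (\<eta> * u1)\<^sup>2 / 2 * (\<integral>x. (h1 x)\<^sup>2 \<partial>P0)) + \<i> * of_real (\<eta> * u1 * (\<integral>x. h1 x * G1 x \<partial>P0)))) *
        exp (of_real \<rho>2 * (of_real (- (\<eta> * u2)\<^sup>2 / 2 * (\<integral>x. (h2 x)\<^sup>2 \<partial>Q0)) + \<i> * of_real (\<eta> * u2 * (\<integral>x. h2 x * G2 x \<partial>Q0)))))"
      unfolding ch
      by (intro tendsto_mult tendsto_const one_sample_char_power[OF d1 h(1) w(1) m(1)] one_sample_char_power[OF d2 h(2) w(2) m(2)])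
    also have "iexp (- (\<eta> * \<mu>)) *
       (exp (of_real \<rho>1 * (of_real (- (\<eta> * u1)\<^sup>2 / 2 * (\<integral>x. (h1 x)\<^sup>2 \<partial>P0)) + \<i> * of_real (\<eta> * u1 * (\<integral>x. h1 x * G1 x \<partial>P0)))) *
        exp (of_real \<rho>2 * (of_real (- (\<eta> * u2)\<^sup>2 / 2 * (\<integral>x. (h2 x)\<^sup>2 \<partial>Q0)) + \<i> * of_real (\<eta> * u2 * (\<integral>x. h2 x * G2 x \<partial>Q0)))))
       = exp (of_real (- (\<eta>\<^sup>2 * \<sigma>\<^sup>2) / 2))"
    proof -
      define A1 B1 A2 B2 where "A1 = (\<integral>x. (h1 x)\<^sup>2 \<partial>P0)" and "B1 = (\<integral>x. h1 x * G1 x \<partial>P0)"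
        and "A2 = (\<integral>x. (h2 x)\<^sup>2 \<partial>Q0)" and "B2 = (\<integral>x. h2 x * G2 x \<partial>Q0)"
      show ?thesis
        unfolding \<sigma>(2) \<mu> A1_def[symmetric] B1_def[symmetric] A2_def[symmetric] B2_def[symmetric] exp_add[symmetric]
        by (intro arg_cong[where f = exp]) (simp add: field_simps power_mult_distrib)
    qed
    also have "\<eta>\<^sup>2 * \<sigma>\<^sup>2 = \<theta>\<^sup>2" using \<sigma>(1) by (simp add: \<eta>_def power_divide)
    finally show ?thesis by (simp add: char_std_normal_distribution exp_of_real[symmetric])
  qed
  then have "weak_conv_m M std_normal_distribution"
    by (intro levy_continuity rd real_dist_normal_dist)
  then have "(\<lambda>n. cdf (M n) ((x - \<mu>) / \<sigma>)) \<longlonglongrightarrow> std_normal_cdf ((x - \<mu>) / \<sigma>)"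
    using isCont_std_normal_cdf by (simp add: weak_conv_m_def weak_conv_def)
  then have "(\<lambda>n. 1 - cdf (M n) ((x - \<mu>) / \<sigma>)) \<longlonglongrightarrow> 1 - std_normal_cdf ((x - \<mu>) / \<sigma>)"
    by (intro tendsto_intros)
  moreover have "1 - cdf (M n) ((x - \<mu>) / \<sigma>) = measure (?R n) {\<omega> \<in> space (?R n). x < ?S n \<omega>}" for n
  proof -
    interpret prob_space "?R n" by (rule prR)
    have "cdf (M n) ((x - \<mu>) / \<sigma>) = measure (?R n) {\<omega> \<in> space (?R n). ?S n \<omega> \<le> x}"
      unfolding cdf_def2 M_def using \<sigma>(1)
      by (subst measure_distr) (auto intro!: arg_cong[where f = "measure _"] simp: divide_le_cancel)
    moreover have "{\<omega> \<in> space (?R n). x < ?S n \<omega>} = space (?R n) - {\<omega> \<in> space (?R n). ?S n \<omega> \<le> x}" by auto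
    ultimately show ?thesis by (simp add: prob_compl)
  qed
  ultimately show ?thesis by simp
qed

section \<open>Hellinger bounds for product densities\<close>

lemma L2_norm_sqrt_diff:
  assumes a: "integrable M a" "\<And>x. 0 \<le> a x" and b: "integrable M b" "\<And>x. (0::real) \<le> b x"
  shows "(\<lambda>x. sqrt (a x)) \<in> L2 M" "(\<lambda>x. sqrt (b x)) \<in> L2 M"
    "(L2_norm M (\<lambda>x. sqrt (a x) - sqrt (b x)))\<^sup>2
      = (\<integral>x. a x \<partial>M) + (\<integral>x. b x \<partial>M) - 2 * (\<integral>x. sqrt (a x * b x) \<partial>M)"
    "integrable M (\<lambda>x. sqrt (a x * b x))"
proof -
  show L: "(\<lambda>x. sqrt (a x)) \<in> L2 M" "(\<lambda>x. sqrt (b x)) \<in> L2 M"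
    using a b by (auto simp: L2_def)
  show i: "integrable M (\<lambda>x. sqrt (a x * b x))"
    using L2_integrable_mult[OF L] by (simp add: real_sqrt_mult)
  have "(L2_norm M (\<lambda>x. sqrt (a x) - sqrt (b x)))\<^sup>2 = (\<integral>x. a x + b x - 2 * sqrt (a x * b x) \<partial>M)"
    unfolding L2_norm_power2 using a(2) b(2)
    by (intro Bochner_Integration.integral_cong) (auto simp: power2_diff real_sqrt_mult)
  then show "(L2_norm M (\<lambda>x. sqrt (a x) - sqrt (b x)))\<^sup>2
      = (\<integral>x. a x \<partial>M) + (\<integral>x. b x \<partial>M) - 2 * (\<integral>x. sqrt (a x * b x) \<partial>M)"
    using a b i by simp
qed

text \<open>Write \<open>p - q\<close> as \<open>(sqrt p - sqrt q) * (sqrt p + sqrt q)\<close> and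
  apply Cauchy-Schwarz. The sum of the roots has norm at most 2, and the squared norm of their
  difference is at most 2 minus twice the affinity, since the masses are at most 1.\<close>

lemma hellinger_test_bound:
  assumes p: "integrable M p" "\<And>x. 0 \<le> p x" "(\<integral>x. p x \<partial>M) \<le> 1"
    and q: "integrable M q" "\<And>x. (0::real) \<le> q x" "(\<integral>x. q x \<partial>M) \<le> 1"
    and \<phi>: "\<phi> \<in> borel_measurable M" "\<And>x. x \<in> space M \<Longrightarrow> \<bar>\<phi> x\<bar> \<le> 1"
  shows "\<bar>(\<integral>x. \<phi> x * p x \<partial>M) - (\<integral>x. \<phi> x * q x \<partial>M)\<bar> \<le> 2 * sqrt (2 - 2 * (\<integral>x. sqrt (p x * q x) \<partial>M))"
proof -
  note s = L2_norm_sqrt_diff[OF p(1,2) q(1,2)]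
  note [measurable] = borel_measurable_integrable[OF p(1)] borel_measurable_integrable[OF q(1)] \<phi>(1)
  have n1: "L2_norm M (\<lambda>x. sqrt (p x)) \<le> 1" "L2_norm M (\<lambda>x. sqrt (q x)) \<le> 1"
    using p q by (simp_all add: L2_norm_def)
  have i: "integrable M (\<lambda>x. \<phi> x * p x)" "integrable M (\<lambda>x. \<phi> x * q x)"
    by (rule Bochner_Integration.integrable_bound[OF p(1)], auto intro!: AE_I2 mult_left_le_one_le simp: abs_mult \<phi>(2))
       (rule Bochner_Integration.integrable_bound[OF q(1)], auto intro!: AE_I2 mult_left_le_one_le simp: abs_mult \<phi>(2))
  have ad: "(\<lambda>x. \<bar>sqrt (p x) - sqrt (q x)\<bar>) \<in> L2 M" using L2_diff[OF s(1,2)] by (auto simp: L2_def)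
  have as: "(\<lambda>x. sqrt (p x) + sqrt (q x)) \<in> L2 M" by (rule L2_add[OF s(1,2)])
  have "\<bar>(\<integral>x. \<phi> x * p x \<partial>M) - (\<integral>x. \<phi> x * q x \<partial>M)\<bar> = norm (\<integral>x. \<phi> x * p x - \<phi> x * q x \<partial>M)"
    using i by simp
  also have "\<dots> \<le> (\<integral>x. \<bar>sqrt (p x) - sqrt (q x)\<bar> * (sqrt (p x) + sqrt (q x)) \<partial>M)"
  proof (rule order_trans[OF integral_norm_bound integral_mono])
    show "integrable M (\<lambda>x. norm (\<phi> x * p x - \<phi> x * q x))" using i by auto
    show "integrable M (\<lambda>x. \<bar>sqrt (p x) - sqrt (q x)\<bar> * (sqrt (p x) + sqrt (q x)))"
      by (rule L2_integrable_mult[OF ad as])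
    fix x assume x: "x \<in> space M"
    have "p x - q x = (sqrt (p x) - sqrt (q x)) * (sqrt (p x) + sqrt (q x))"
      using p(2)[of x] q(2)[of x] by (simp add: algebra_simps)
    then have "\<bar>p x - q x\<bar> = \<bar>sqrt (p x) - sqrt (q x)\<bar> * (sqrt (p x) + sqrt (q x))"
      using p(2)[of x] q(2)[of x] by (simp add: abs_mult)
    moreover have "norm (\<phi> x * p x - \<phi> x * q x) \<le> 1 * \<bar>p x - q x\<bar>"
      unfolding right_diff_distrib[symmetric] using \<phi>(2)[OF x] by (simp only: real_norm_def abs_mult) (rule mult_right_mono, auto)
    ultimately show "norm (\<phi> x * p x - \<phi> x * q x) \<le> \<bar>sqrt (p x) - sqrt (q x)\<bar> * (sqrt (p x) + sqrt (q x))" by simp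
  qed
  also have "\<dots> \<le> L2_norm M (\<lambda>x. \<bar>sqrt (p x) - sqrt (q x)\<bar>) * L2_norm M (\<lambda>x. sqrt (p x) + sqrt (q x))"
    using L2_Cauchy_Schwarz[OF ad as] by simp
  also have "L2_norm M (\<lambda>x. \<bar>sqrt (p x) - sqrt (q x)\<bar>) = L2_norm M (\<lambda>x. sqrt (p x) - sqrt (q x))"
    by (simp add: L2_norm_def)
  also have "L2_norm M (\<lambda>x. sqrt (p x) - sqrt (q x)) * L2_norm M (\<lambda>x. sqrt (p x) + sqrt (q x))
      \<le> L2_norm M (\<lambda>x. sqrt (p x) - sqrt (q x)) * 2"
    using L2_norm_triangle[OF s(1,2)] n1 by (intro mult_left_mono L2_norm_nonneg) linarith
  also have "L2_norm M (\<lambda>x. sqrt (p x) - sqrt (q x)) \<le> sqrt (2 - 2 * (\<integral>x. sqrt (p x * q x) \<partial>M))"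
    by (rule real_le_rsqrt) (use s(3) p(3) q(3) in linarith)
  finally show ?thesis by simp
qed

text \<open>The part of \<open>sqrt_differentiable\<close> at scale \<open>1 / sqrt n\<close> that
  concerns densities only, because a tilted density does not come with a measure of the
  family.\<close>

definition density_expansion :: "'a measure \<Rightarrow> (nat \<Rightarrow> 'a \<Rightarrow> real) \<Rightarrow> ('a \<Rightarrow> real) \<Rightarrow> bool" where
  "density_expansion P0 a G \<longleftrightarrow>
     (\<forall>n. integrable P0 (a n) \<and> (\<forall>x. 0 \<le> a n x) \<and> (\<integral>x. a n x \<partial>P0) \<le> 1) \<and>
     L2_tendsto P0 sequentially (\<lambda>n x. 2 * (sqrt (a n x) - 1) / (1 / sqrt (real n))) G \<and>
     (\<lambda>n. real n * (1 - (\<integral>x. a n x \<partial>P0))) \<longlonglongrightarrow> 0"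

lemma density_expansionD:
  assumes "density_expansion P0 a G"
  shows "integrable P0 (a n)" "0 \<le> a n x" "(\<integral>x. a n x \<partial>P0) \<le> 1"
    "L2_tendsto P0 sequentially (\<lambda>n x. 2 * (sqrt (a n x) - 1) / (1 / sqrt (real n))) G"
    "(\<lambda>n. real n * (1 - (\<integral>x. a n x \<partial>P0))) \<longlonglongrightarrow> 0"
  using assms by (auto simp: density_expansion_def)

lemma sqrt_differentiable_imp_density_expansion:
  assumes R: "sqrt_differentiable P0 sequentially (\<lambda>n. 1 / sqrt (real n)) P a G"
  shows "density_expansion P0 a G"
proof -
  note r = sqrt_differentiableD[OF R]
  have "(\<lambda>n. real n * (1 - (\<integral>x. a n x \<partial>P0))) \<longlonglongrightarrow> 0"
    using r(5) by (simp add: power_divide mult.commute)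
  then show ?thesis
    using r(4) ac_density_integrable[OF r(3,2)] ac_densityD(3)[OF r(3)]
    by (simp add: density_expansion_def)
qed

lemma affinity_le_1:
  assumes a: "integrable M a" "\<And>x. 0 \<le> a x" "(\<integral>x. a x \<partial>M) \<le> 1"
    and b: "integrable M b" "\<And>x. (0::real) \<le> b x" "(\<integral>x. b x \<partial>M) \<le> 1"
  shows "0 \<le> (\<integral>x. sqrt (a x * b x) \<partial>M)" "(\<integral>x. sqrt (a x * b x) \<partial>M) \<le> 1"
proof -
  show "0 \<le> (\<integral>x. sqrt (a x * b x) \<partial>M)" using a b by (intro integral_nonneg_AE) auto
  have "0 \<le> (L2_norm M (\<lambda>x. sqrt (a x) - sqrt (b x)))\<^sup>2" by simp
  with L2_norm_sqrt_diff(3)[OF a(1,2) b(1,2)] a(3) b(3)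
  show "(\<integral>x. sqrt (a x * b x) \<partial>M) \<le> 1" by linarith
qed

text \<open>An exact identity before the limit: the difference of the two quotients is
  \<open>2 * sqrt n\<close> times the difference of the roots, so an eighth of its squared norm plus
  half of both scaled mass defects is \<open>n\<close> times one minus the affinity.\<close>

lemma affinity_expansion:
  assumes a: "density_expansion P0 a G" and b: "density_expansion P0 b H"
  shows "(\<lambda>n. real n * (1 - (\<integral>x. sqrt (a n x * b n x) \<partial>P0))) \<longlonglongrightarrow> (L2_norm P0 (\<lambda>x. G x - H x))\<^sup>2 / 8"
proof -
  note A = density_expansionD[OF a] and B = density_expansionD[OF b]
  let ?DA = "\<lambda>n x. 2 * (sqrt (a n x) - 1) / (1 / sqrt (real n))"
  let ?DB = "\<lambda>n x. 2 * (sqrt (b n x) - 1) / (1 / sqrt (real n))"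
  have diff: "L2_tendsto P0 sequentially (\<lambda>n x. ?DA n x + (-1) * ?DB n x) (\<lambda>x. G x + (-1) * H x)"
    by (rule L2_tendsto_add[OF A(4) L2_tendsto_scale[OF B(4) tendsto_const]])
  have eq: "?DA n x + (-1) * ?DB n x = (2 * sqrt (real n)) * (sqrt (a n x) - sqrt (b n x))" for n x
    by (simp add: algebra_simps)
  have "(\<lambda>n. (L2_norm P0 (\<lambda>x. ?DA n x + (-1) * ?DB n x))\<^sup>2 / 8 + (real n * (1 - (\<integral>x. a n x \<partial>P0)) / 2 + real n * (1 - (\<integral>x. b n x \<partial>P0)) / 2))
      \<longlonglongrightarrow> (L2_norm P0 (\<lambda>x. G x + (-1) * H x))\<^sup>2 / 8 + (0 / 2 + 0 / 2)"
    by (intro tendsto_intros L2_tendsto_norm[OF diff] A(5) B(5)) auto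
  moreover have "(L2_norm P0 (\<lambda>x. ?DA n x + (-1) * ?DB n x))\<^sup>2 / 8 + (real n * (1 - (\<integral>x. a n x \<partial>P0)) / 2 + real n * (1 - (\<integral>x. b n x \<partial>P0)) / 2)
      = real n * (1 - (\<integral>x. sqrt (a n x * b n x) \<partial>P0))" for n
    unfolding eq L2_norm_scale power_mult_distrib L2_norm_sqrt_diff(3)[OF A(1,2) B(1,2)]
    by (simp add: power_mult_distrib field_simps)
  ultimately show ?thesis by simp
qed

section \<open>Densities of whole samples\<close>

definition product_density ::
    "('a \<Rightarrow> real) \<Rightarrow> nat \<Rightarrow> ('b \<Rightarrow> real) \<Rightarrow> nat \<Rightarrow> (nat \<Rightarrow> 'a) \<times> (nat \<Rightarrow> 'b) \<Rightarrow> real" where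
  "product_density a m1 b m2 \<omega> = (\<Prod>i=1..m1. a (fst \<omega> i)) * (\<Prod>j=1..m2. b (snd \<omega> j))"

lemma product_density_nonneg: "(\<And>x. 0 \<le> a x) \<Longrightarrow> (\<And>y. 0 \<le> b y) \<Longrightarrow> 0 \<le> product_density a m1 b m2 \<omega>"
  unfolding product_density_def by (intro mult_nonneg_nonneg prod_nonneg) auto

lemma product_density_integral:
  assumes "prob_space P" "prob_space Q" "integrable P a" "integrable Q b"
  shows "integrable (two_sample_product m1 m2 P Q) (product_density a m1 b m2)"
    "(\<integral>\<omega>. product_density a m1 b m2 \<omega> \<partial>two_sample_product m1 m2 P Q) = (\<integral>x. a x \<partial>P) ^ m1 * (\<integral>y. b y \<partial>Q) ^ m2"
  using two_sample_integral_prod[OF assms] unfolding product_density_def[abs_def] by auto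

text \<open>Bernoulli's inequality turns products of affinities, or of masses, into sums of n scaled
  defects, whose limits are known.\<close>

lemma two_power_lower_bound:
  fixes r1 r2 :: real
  assumes "0 \<le> r1" "r1 \<le> 1" "0 \<le> r2" "r2 \<le> 1"
  shows "1 - r1 ^ m1 * r2 ^ m2 \<le> real m1 * (1 - r1) + real m2 * (1 - r2)"
proof -
  have b: "1 - r ^ m \<le> real m * (1 - r)" if "0 \<le> r" for r :: real and m
    using Bernoulli_inequality[of "r - 1" m] that by (simp add: algebra_simps)
  have "0 \<le> (1 - r1 ^ m1) * (1 - r2 ^ m2)" using assms by (intro mult_nonneg_nonneg) (auto simp: power_le_one)
  then have "1 - r1 ^ m1 * r2 ^ m2 \<le> (1 - r1 ^ m1) + (1 - r2 ^ m2)" by (simp add: algebra_simps)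
  with b[OF assms(1), of m1] b[OF assms(3), of m2] show ?thesis by linarith
qed

lemma product_density_le_1:
  assumes "prob_space P" "prob_space Q" "integrable P a" "integrable Q b"
    and "\<And>x. 0 \<le> a x" "\<And>y. 0 \<le> b y" "(\<integral>x. a x \<partial>P) \<le> 1" "(\<integral>y. b y \<partial>Q) \<le> 1"
  shows "(\<integral>\<omega>. product_density a m1 b m2 \<omega> \<partial>two_sample_product m1 m2 P Q) \<le> 1"
  unfolding product_density_integral(2)[OF assms(1-4)]
  using assms(5-8) by (intro mult_le_one power_le_one zero_le_power) (auto intro: integral_nonneg_AE)

lemma sqrt_prod_distrib: "sqrt (\<Prod>i\<in>A. f i) = (\<Prod>i\<in>A. sqrt (f i))"
  by (induction A rule: infinite_finite_induct) (auto simp: real_sqrt_mult)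

text \<open>Affinities multiply over independent observations. The bound is uniform in the test
  because it has to serve a competitor and a rejection indicator at once, and its limit is the
  weighted L2 distance of the tangents; the constants match because
  \<open>2 * sqrt (2 / 8) = 1\<close>.\<close>

lemma product_density_distance:
  assumes P0: "prob_space P0" and Q0: "prob_space Q0"
    and a: "density_expansion P0 a G1" and b: "density_expansion Q0 b G2"
    and a': "density_expansion P0 a' H1" and b': "density_expansion Q0 b' H2"
    and m: "(\<lambda>n. real (m1 n) / real n) \<longlonglongrightarrow> \<rho>1" "(\<lambda>n. real (m2 n) / real n) \<longlonglongrightarrow> \<rho>2"
  obtains \<delta> where
    "\<delta> \<longlonglongrightarrow> sqrt (\<rho>1 * (L2_norm P0 (\<lambda>x. G1 x - H1 x))\<^sup>2 + \<rho>2 * (L2_norm Q0 (\<lambda>y. G2 y - H2 y))\<^sup>2)"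
    "\<forall>\<^sub>F n in sequentially. \<forall>\<phi>\<in>borel_measurable (two_sample_product (m1 n) (m2 n) P0 Q0).
        (\<forall>\<omega>\<in>space (two_sample_product (m1 n) (m2 n) P0 Q0). \<bar>\<phi> \<omega>\<bar> \<le> 1) \<longrightarrow>
       \<bar>(\<integral>\<omega>. \<phi> \<omega> * product_density (a n) (m1 n) (b n) (m2 n) \<omega> \<partial>two_sample_product (m1 n) (m2 n) P0 Q0) -
        (\<integral>\<omega>. \<phi> \<omega> * product_density (a' n) (m1 n) (b' n) (m2 n) \<omega> \<partial>two_sample_product (m1 n) (m2 n) P0 Q0)\<bar> \<le> \<delta> n"
proof -
  note A = density_expansionD[OF a] and B = density_expansionD[OF b]
    and A' = density_expansionD[OF a'] and B' = density_expansionD[OF b']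
  define r1 where "r1 n = (\<integral>x. sqrt (a n x * a' n x) \<partial>P0)" for n
  define r2 where "r2 n = (\<integral>x. sqrt (b n x * b' n x) \<partial>Q0)" for n
  have r: "0 \<le> r1 n" "r1 n \<le> 1" "0 \<le> r2 n" "r2 n \<le> 1" for n
    unfolding r1_def r2_def
    using affinity_le_1[OF A(1,2,3) A'(1,2,3)] affinity_le_1[OF B(1,2,3) B'(1,2,3)] by auto
  define \<delta> where "\<delta> n = 2 * sqrt (2 * (real (m1 n) / real n * (real n * (1 - r1 n)) + real (m2 n) / real n * (real n * (1 - r2 n))))" for n
  have lim: "\<delta> \<longlonglongrightarrow> 2 * sqrt (2 * (\<rho>1 * ((L2_norm P0 (\<lambda>x. G1 x - H1 x))\<^sup>2 / 8) + \<rho>2 * ((L2_norm Q0 (\<lambda>y. G2 y - H2 y))\<^sup>2 / 8)))"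
    unfolding \<delta>_def r1_def r2_def
    by (intro tendsto_intros m affinity_expansion[OF a a'] affinity_expansion[OF b b'])
  have sqeq: "2 * sqrt (2 * (\<rho>1 * (x / 8) + \<rho>2 * (y / 8))) = sqrt (\<rho>1 * x + \<rho>2 * y)" for x y
  proof -
    have "2 * sqrt (2 * (\<rho>1 * (x / 8) + \<rho>2 * (y / 8))) = sqrt 4 * sqrt (2 * (\<rho>1 * (x / 8) + \<rho>2 * (y / 8)))" by simp
    also have "\<dots> = sqrt (\<rho>1 * x + \<rho>2 * y)"
      unfolding real_sqrt_mult[symmetric] by (simp add: algebra_simps)
    finally show ?thesis .
  qed
  from lim have lim': "\<delta> \<longlonglongrightarrow> sqrt (\<rho>1 * (L2_norm P0 (\<lambda>x. G1 x - H1 x))\<^sup>2 + \<rho>2 * (L2_norm Q0 (\<lambda>y. G2 y - H2 y))\<^sup>2)"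
    unfolding sqeq .
  show ?thesis
  proof (rule that[OF lim'])
    show "\<forall>\<^sub>F n in sequentially. \<forall>\<phi>\<in>borel_measurable (two_sample_product (m1 n) (m2 n) P0 Q0).
        (\<forall>\<omega>\<in>space (two_sample_product (m1 n) (m2 n) P0 Q0). \<bar>\<phi> \<omega>\<bar> \<le> 1) \<longrightarrow>
       \<bar>(\<integral>\<omega>. \<phi> \<omega> * product_density (a n) (m1 n) (b n) (m2 n) \<omega> \<partial>two_sample_product (m1 n) (m2 n) P0 Q0) -
        (\<integral>\<omega>. \<phi> \<omega> * product_density (a' n) (m1 n) (b' n) (m2 n) \<omega> \<partial>two_sample_product (m1 n) (m2 n) P0 Q0)\<bar> \<le> \<delta> n"
      using eventually_gt_at_top[of 0]
    proof (eventually_elim, intro ballI impI)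
      fix n :: nat and \<phi> :: "(nat \<Rightarrow> _) \<times> (nat \<Rightarrow> _) \<Rightarrow> real"
      assume n: "0 < n"
      let ?M = "two_sample_product (m1 n) (m2 n) P0 Q0"
      let ?p = "product_density (a n) (m1 n) (b n) (m2 n)" and ?q = "product_density (a' n) (m1 n) (b' n) (m2 n)"
      assume \<phi>: "\<phi> \<in> borel_measurable ?M" "\<forall>\<omega>\<in>space ?M. \<bar>\<phi> \<omega>\<bar> \<le> 1"
      have sq: "sqrt (?p \<omega> * ?q \<omega>) = product_density (\<lambda>x. sqrt (a n x * a' n x)) (m1 n) (\<lambda>x. sqrt (b n x * b' n x)) (m2 n) \<omega>" for \<omega>
        by (simp add: product_density_def real_sqrt_mult sqrt_prod_distrib prod.distrib)
      have af: "(\<integral>\<omega>. sqrt (?p \<omega> * ?q \<omega>) \<partial>?M) = r1 n ^ m1 n * r2 n ^ m2 n"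
        unfolding sq r1_def r2_def
        by (rule product_density_integral(2)[OF P0 Q0 L2_norm_sqrt_diff(4)[OF A(1,2) A'(1,2)] L2_norm_sqrt_diff(4)[OF B(1,2) B'(1,2)]])
      have "\<bar>(\<integral>\<omega>. \<phi> \<omega> * ?p \<omega> \<partial>?M) - (\<integral>\<omega>. \<phi> \<omega> * ?q \<omega> \<partial>?M)\<bar> \<le> 2 * sqrt (2 - 2 * (\<integral>\<omega>. sqrt (?p \<omega> * ?q \<omega>) \<partial>?M))"
        by (rule hellinger_test_bound[OF product_density_integral(1)[OF P0 Q0 A(1) B(1)] product_density_nonneg[OF A(2) B(2)]
            product_density_le_1[OF P0 Q0 A(1) B(1) A(2) B(2) A(3) B(3)]
            product_density_integral(1)[OF P0 Q0 A'(1) B'(1)] product_density_nonneg[OF A'(2) B'(2)]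
            product_density_le_1[OF P0 Q0 A'(1) B'(1) A'(2) B'(2) A'(3) B'(3)] \<phi>(1)])
           (use \<phi>(2) in auto)
      also have "\<dots> \<le> \<delta> n"
        unfolding af \<delta>_def using two_power_lower_bound[OF r, of n "m1 n" n "m2 n"] n
        by (intro mult_left_mono real_sqrt_le_mono) auto
      finally show "\<bar>(\<integral>\<omega>. \<phi> \<omega> * ?p \<omega> \<partial>?M) - (\<integral>\<omega>. \<phi> \<omega> * ?q \<omega> \<partial>?M)\<bar> \<le> \<delta> n" .
    qed
  qed
qed

text \<open>The singular mass of the whole sample is at most the sum of the singular masses of the
  single observations, each of which is o(1/n).\<close>

lemma local_expansion_test_integral:
  assumes le: "local_expansion P0 Q0 s a b G1 G2"
    and m: "(\<lambda>n. real (m1 n) / real n) \<longlonglongrightarrow> \<rho>1" "(\<lambda>n. real (m2 n) / real n) \<longlonglongrightarrow> \<rho>2"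
  obtains \<eta> where "\<eta> \<longlonglongrightarrow> 0"
    "\<forall>\<^sub>F n in sequentially. \<forall>\<phi>\<in>borel_measurable (two_sample_product (m1 n) (m2 n) P0 Q0).
        (\<forall>\<omega>\<in>space (two_sample_product (m1 n) (m2 n) P0 Q0). \<bar>\<phi> \<omega>\<bar> \<le> 1) \<longrightarrow>
       \<bar>(\<integral>\<omega>. \<phi> \<omega> \<partial>two_sample_product (m1 n) (m2 n) (fst s n) (snd s n)) -
        (\<integral>\<omega>. \<phi> \<omega> * product_density (a n) (m1 n) (b n) (m2 n) \<omega> \<partial>two_sample_product (m1 n) (m2 n) P0 Q0)\<bar> \<le> \<eta> n"
proof -
  have d1: "sqrt_differentiable P0 sequentially (\<lambda>n. 1 / sqrt (real n)) (fst s) a G1"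
    and d2: "sqrt_differentiable Q0 sequentially (\<lambda>n. 1 / sqrt (real n)) (snd s) b G2"
    using le by (auto simp: local_expansion_def)
  note D1 = sqrt_differentiableD[OF d1] and D2 = sqrt_differentiableD[OF d2]
  note A = density_expansionD[OF sqrt_differentiable_imp_density_expansion[OF d1]]
    and B = density_expansionD[OF sqrt_differentiable_imp_density_expansion[OF d2]]
  have r: "0 \<le> (\<integral>x. a n x \<partial>P0)" "(\<integral>x. a n x \<partial>P0) \<le> 1" "0 \<le> (\<integral>x. b n x \<partial>Q0)" "(\<integral>x. b n x \<partial>Q0) \<le> 1" for n
    using A(2,3) B(2,3) by (auto intro: integral_nonneg_AE)
  define \<eta> where "\<eta> n = real (m1 n) / real n * (real n * (1 - (\<integral>x. a n x \<partial>P0))) + real (m2 n) / real n * (real n * (1 - (\<integral>x. b n x \<partial>Q0)))" for n :: nat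
  have "\<eta> \<longlonglongrightarrow> \<rho>1 * 0 + \<rho>2 * 0" unfolding \<eta>_def by (intro tendsto_intros m A(5) B(5))
  then have lim: "\<eta> \<longlonglongrightarrow> 0" by simp
  show ?thesis
  proof (rule that[OF lim], use eventually_gt_at_top[of 0] in \<open>eventually_elim, intro ballI impI\<close>)
    fix n :: nat and \<phi> :: "(nat \<Rightarrow> _) \<times> (nat \<Rightarrow> _) \<Rightarrow> real"
    assume n: "0 < n"
    let ?M = "two_sample_product (m1 n) (m2 n) P0 Q0" and ?R = "two_sample_product (m1 n) (m2 n) (fst s n) (snd s n)"
    let ?p = "product_density (a n) (m1 n) (b n) (m2 n)"
    assume \<phi>: "\<phi> \<in> borel_measurable ?M" "\<forall>\<omega>\<in>space ?M. \<bar>\<phi> \<omega>\<bar> \<le> 1"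
    have ac: "ac_density ?R ?M ?p"
      unfolding two_sample_product_def product_density_def[abs_def]
      by (intro ac_density_pair ac_density_PiM prob_space_PiM_const D1 D2 finite_atLeastAtMost)
    have "\<bar>(\<integral>\<omega>. \<phi> \<omega> \<partial>?R) - (\<integral>\<omega>. ?p \<omega> * \<phi> \<omega> \<partial>?M)\<bar> \<le> 1 - (\<integral>\<omega>. ?p \<omega> \<partial>?M)"
      using ac_density_test_integral(1)[OF ac prob_space_two_sample_product[OF D1(2) D2(2)] \<phi>(1)] \<phi>(2) by simp
    also have "\<dots> \<le> \<eta> n"
      unfolding product_density_integral(2)[OF D1(1) D2(1) A(1) B(1)] \<eta>_def
      using two_power_lower_bound[OF r, of n "m1 n" n "m2 n"] n by simp
    finally show "\<bar>(\<integral>\<omega>. \<phi> \<omega> \<partial>?R) - (\<integral>\<omega>. \<phi> \<omega> * ?p \<omega> \<partial>?M)\<bar> \<le> \<eta> n"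
      by (simp add: mult.commute)
  qed
qed

section \<open>Exponential tilting\<close>

text \<open>Normalising a root does not change its tangent: the squared norm is
  \<open>1 + t * (mean of the quotient) + O(t\<^sup>2)\<close>, and that mean tends to the integral
  of \<open>K\<close>, which is 0. Hence the norm itself is \<open>1 + o(t)\<close>.\<close>

lemma normalized_expansion:
  assumes M: "prob_space M" and y: "\<And>i. y i \<in> L2 M" "\<And>i x. 0 \<le> y i x"
    and Y: "L2_tendsto M F (\<lambda>i x. 2 * (y i x - 1) / t i) K" and K: "(\<integral>x. K x \<partial>M) = 0"
    and t: "(t \<longlongrightarrow> 0) F" "\<forall>\<^sub>F i in F. t i \<noteq> 0"
  shows "L2_tendsto M F (\<lambda>i x. 2 * (y i x / L2_norm M (y i) - 1) / t i) K"
    "((\<lambda>i. L2_norm M (y i)) \<longlongrightarrow> 1) F"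
proof -
  interpret prob_space M by fact
  let ?D = "\<lambda>i x. 2 * (y i x - 1) / t i"
  define N where "N i = L2_norm M (y i)" for i
  have N0: "0 \<le> N i" for i by (simp add: N_def)
  have N2: "((N i)\<^sup>2 - 1) / t i = (\<integral>x. ?D i x \<partial>M) + t i / 4 * (L2_norm M (?D i))\<^sup>2" if "t i \<noteq> 0" for i
  proof -
    note D' = L2_tendstoD(1)[OF Y, of i]
    have "(N i)\<^sup>2 = (\<integral>x. 1 + t i * ?D i x + (t i)\<^sup>2 / 4 * (?D i x)\<^sup>2 \<partial>M)"
      unfolding N_def L2_norm_power2
      using that by (intro Bochner_Integration.integral_cong) (auto simp: power2_eq_square field_simps)
    also have "\<dots> = 1 + t i * (\<integral>x. ?D i x \<partial>M) + (t i)\<^sup>2 / 4 * (L2_norm M (?D i))\<^sup>2"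
      using L2_imp_integrable[OF D'] L2_integrable_square[OF D']
      by (simp add: prob_space L2_norm_power2 del: times_divide_eq_right times_divide_eq_left)
    finally show ?thesis using that by (simp add: power2_eq_square field_simps)
  qed
  have "((\<lambda>i. (\<integral>x. ?D i x \<partial>M) + t i / 4 * (L2_norm M (?D i))\<^sup>2) \<longlongrightarrow> (\<integral>x. K x \<partial>M) + 0 / 4 * (L2_norm M K)\<^sup>2) F"
    by (intro tendsto_intros t L2_tendsto_integral[OF Y] L2_tendsto_norm[OF Y]) simp
  moreover have "\<forall>\<^sub>F i in F. (\<integral>x. ?D i x \<partial>M) + t i / 4 * (L2_norm M (?D i))\<^sup>2 = ((N i)\<^sup>2 - 1) / t i"
    using t(2) by eventually_elim (rule N2[symmetric])
  ultimately have "((\<lambda>i. ((N i)\<^sup>2 - 1) / t i) \<longlongrightarrow> (\<integral>x. K x \<partial>M) + 0 / 4 * (L2_norm M K)\<^sup>2) F"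
    by (rule Lim_transform_eventually)
  then have N2t: "((\<lambda>i. ((N i)\<^sup>2 - 1) / t i) \<longlongrightarrow> 0) F" by (simp add: K)
  \<comment> \<open>Norms are nonnegative, so
    \<open>\<bar>N - 1\<bar> \<le> \<bar>N - 1\<bar> * (N + 1)\<close>, the distance of
    \<open>N\<^sup>2\<close> from 1.\<close>
  have Nt: "((\<lambda>i. (N i - 1) / t i) \<longlongrightarrow> 0) F"
  proof (rule Lim_null_comparison[OF always_eventually tendsto_rabs_zero[OF N2t]], rule allI)
    fix i
    have "((N i)\<^sup>2 - 1) / t i = (N i - 1) / t i * (N i + 1)" by (simp add: power2_eq_square algebra_simps)
    moreover have "\<bar>(N i - 1) / t i\<bar> * 1 \<le> \<bar>(N i - 1) / t i\<bar> * \<bar>N i + 1\<bar>"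
      using N0[of i] by (intro mult_left_mono) auto
    ultimately show "norm ((N i - 1) / t i) \<le> \<bar>((N i)\<^sup>2 - 1) / t i\<bar>" by (simp only: abs_mult real_norm_def mult_1_right)
  qed
  have "((\<lambda>i. (N i - 1) / t i * t i + 1) \<longlongrightarrow> 0 * 0 + 1) F" by (intro tendsto_intros Nt t)
  then have "((\<lambda>i. (N i - 1) / t i * t i + 1) \<longlongrightarrow> 1) F" by simp
  moreover have "\<forall>\<^sub>F i in F. (N i - 1) / t i * t i + 1 = N i" using t(2) by eventually_elim simp
  ultimately have N1: "(N \<longlongrightarrow> 1) F" by (rule Lim_transform_eventually)
  then show "((\<lambda>i. L2_norm M (y i)) \<longlongrightarrow> 1) F" by (simp add: N_def[abs_def])
  have Npos: "\<forall>\<^sub>F i in F. 0 < N i" using order_tendstoD(1)[OF N1, of 0] by simp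
  have inv: "((\<lambda>i. 1 / N i) \<longlongrightarrow> 1 / 1) F" by (intro tendsto_intros N1) simp
  have c: "((\<lambda>i. - 2 * ((N i - 1) / t i) * (1 / N i)) \<longlongrightarrow> - 2 * 0 * (1 / 1)) F"
    by (intro tendsto_intros Nt inv)
  have "L2_tendsto M F (\<lambda>i x. 1 / N i * ?D i x + (- 2 * ((N i - 1) / t i) * (1 / N i)) * 1) (\<lambda>x. 1 / 1 * K x + (- 2 * 0 * (1 / 1)) * 1)"
    by (rule L2_tendsto_add[OF L2_tendsto_scale[OF Y inv] L2_tendsto_scale[OF L2_tendsto_const[OF L2_const] c]])
  then have S: "L2_tendsto M F (\<lambda>i x. 1 / N i * ?D i x + (- 2 * ((N i - 1) / t i) * (1 / N i)) * 1) K" by simp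
  show "L2_tendsto M F (\<lambda>i x. 2 * (y i x / L2_norm M (y i) - 1) / t i) K"
    unfolding N_def[symmetric]
  proof (rule L2_tendsto_cong_eventually[OF S])
    show "(\<lambda>x. 2 * (y i x / N i - 1) / t i) \<in> L2 M" for i
      using L2_scale[OF L2_diff[OF L2_scale[OF y(1)[of i], of "1 / N i"] L2_const[of 1]], of "2 / t i"] by simp
    show "\<forall>\<^sub>F i in F. (\<lambda>x. 2 * (y i x / N i - 1) / t i) = (\<lambda>x. 1 / N i * ?D i x + (- 2 * ((N i - 1) / t i) * (1 / N i)) * 1)"
      using Npos t(2) by eventually_elim (auto simp: field_simps)
  qed
qed

lemma abs_exp_minus_1_le: "\<bar>exp x - 1\<bar> \<le> \<bar>x\<bar> * exp \<bar>x :: real\<bar>"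
proof -
  have up: "exp x - 1 \<le> x * exp x"
    using exp_ge_add_one_self[of "- x"] by (simp add: exp_minus field_simps)
  show ?thesis
  proof (cases "x \<ge> 0")
    case True
    then show ?thesis using up by simp
  next
    case False
    then have "\<bar>exp x - 1\<bar> = 1 - exp x" by simp
    with False exp_ge_add_one_self[of x] have "\<bar>exp x - 1\<bar> \<le> \<bar>x\<bar>" by linarith
    also have "\<dots> \<le> \<bar>x\<bar> * exp \<bar>x\<bar>" by (simp add: mult_le_cancel_left1)
    finally show ?thesis .
  qed
qed

lemma abs_exp_minus_2_le: "\<bar>exp x - 1 - x\<bar> \<le> x\<^sup>2 * exp \<bar>x :: real\<bar>"
proof -
  have up: "exp x - 1 \<le> x * exp x"
    using exp_ge_add_one_self[of "- x"] by (simp add: exp_minus field_simps)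
  have "\<bar>exp x - 1 - x\<bar> = exp x - 1 - x" using exp_ge_add_one_self[of x] by linarith
  also have "\<dots> \<le> x * (exp x - 1)" using up by (simp add: algebra_simps)
  also have "\<dots> \<le> \<bar>x\<bar> * \<bar>exp x - 1\<bar>" by (simp add: abs_mult[symmetric])
  also have "\<dots> \<le> \<bar>x\<bar> * (\<bar>x\<bar> * exp \<bar>x\<bar>)" by (intro mult_left_mono abs_exp_minus_1_le) simp
  also have "\<dots> = x\<^sup>2 * exp \<bar>x\<bar>" by (simp add: power2_eq_square flip: mult.assoc abs_mult)
  finally show ?thesis .
qed

text \<open>The tilt multiplies the root by \<open>exp (h / (2 * sqrt n))\<close>, which adds
  \<open>h\<close> to the tangent to first order. Boundedness of \<open>h\<close> makes all
  remainders uniform in \<open>x\<close>, and centering of \<open>G + h\<close> lets the normalising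
  constant \<open>N n\<close> disappear in the limit.\<close>

lemma tilted_expansion:
  assumes P0: "prob_space P0" and a: "density_expansion P0 a G"
    and h: "h \<in> borel_measurable P0" "\<And>x. \<bar>h x\<bar> \<le> B"
    and c: "(\<integral>x. G x + h x \<partial>P0) = 0"
    and N: "\<And>n. N n = (\<integral>x. a n x * exp (h x / sqrt (real n)) \<partial>P0)"
  shows "density_expansion P0 (\<lambda>n x. a n x * exp (h x / sqrt (real n)) / N n) (\<lambda>x. G x + h x)"
    "N \<longlonglongrightarrow> 1"
proof -
  interpret prob_space P0 by fact
  note A = density_expansionD[OF a]
  note [measurable] = h(1) borel_measurable_integrable[OF A(1)]
  have B0: "0 \<le> B" using h(2)[of undefined] by linarith
  have hL: "h \<in> L2 P0" by (rule L2_bounded[OF h])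
  define e where "e n x = exp (h x / (2 * sqrt (real n)))" for n :: nat and x
  have [measurable]: "e n \<in> borel_measurable P0" for n unfolding e_def by measurable
  have arg1: "\<bar>h x / (2 * sqrt (real n))\<bar> \<le> B / (2 * sqrt (real n))" for n :: nat and x
    using h(2)[of x] by (simp add: abs_divide divide_right_mono)
  have arg2: "B / (2 * sqrt (real n)) \<le> B" for n :: nat
  proof (cases "n = 0")
    case False
    then have "1 \<le> 2 * sqrt (real n)" using real_sqrt_ge_one[of "real n"] by linarith
    then have "B / (2 * sqrt (real n)) \<le> B / 1" using B0 False by (intro divide_left_mono) auto
    then show ?thesis by simp
  qed (simp add: B0)
  have arg3: "\<bar>h x / (2 * sqrt (real n))\<bar> \<le> B" for n :: nat and x
    using arg1[of x n] arg2[of n] by linarith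
  have e1: "\<bar>e n x - 1\<bar> \<le> B / (2 * sqrt (real n)) * exp B" for n x
  proof -
    have "\<bar>e n x - 1\<bar> \<le> \<bar>h x / (2 * sqrt (real n))\<bar> * exp \<bar>h x / (2 * sqrt (real n))\<bar>"
      unfolding e_def by (rule abs_exp_minus_1_le)
    also have "\<dots> \<le> B / (2 * sqrt (real n)) * exp B"
      using arg1[of x n] arg3[of x n] B0 by (intro mult_mono) auto
    finally show ?thesis .
  qed
  have ebd: "\<bar>e n x\<bar> \<le> 1 + B / (2 * sqrt (real n)) * exp B" for n x using e1[of n x] by (simp add: e_def)
  define y where "y n x = e n x * sqrt (a n x)" for n x
  have sL: "(\<lambda>x. sqrt (a n x)) \<in> L2 P0" for n using A(1,2) by (auto simp: L2_def)
  have yL: "y n \<in> L2 P0" for n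
    unfolding y_def by (rule L2_bounded_mult(1)[OF sL _ ebd]) simp
  have y0: "0 \<le> y n x" for n x using A(2) by (simp add: y_def e_def)
  have y2: "(y n x)\<^sup>2 = a n x * exp (h x / sqrt (real n))" for n x
  proof -
    have "(e n x)\<^sup>2 = exp (h x / sqrt (real n))"
      unfolding e_def power2_eq_square exp_add[symmetric] by (simp add: field_simps)
    then show ?thesis using A(2)[of n x] by (simp add: y_def power_mult_distrib)
  qed
  have NL: "N n = (L2_norm P0 (y n))\<^sup>2" for n by (simp add: N L2_norm_power2 y2)
  let ?D = "\<lambda>n x. 2 * (sqrt (a n x) - 1) / (1 / sqrt (real n))"
  have lim0: "(\<lambda>n. B / (2 * sqrt (real n)) * exp B) \<longlonglongrightarrow> 0" by real_asymp
  have S: "L2_tendsto P0 sequentially (\<lambda>n x. ?D n x + h x) (\<lambda>x. G x + h x)"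
    by (rule L2_tendsto_add[OF A(4) L2_tendsto_const[OF hL]])
  have "L2_tendsto P0 sequentially (\<lambda>n x. 2 * (y n x - 1) / (1 / sqrt (real n))) (\<lambda>x. G x + h x)"
  proof (rule L2_tendsto_perturb[OF S])
    show "(\<lambda>x. 2 * (y n x - 1) / (1 / sqrt (real n))) \<in> L2 P0" for n
      using L2_scale[OF L2_diff[OF yL[of n] L2_const[of 1]], of "2 / (1 / sqrt (real n))"]
      by (simp add: mult_ac)
    have "(\<lambda>n. B / (2 * sqrt (real n)) * exp B * L2_norm P0 (?D n) + B\<^sup>2 / (2 * sqrt (real n)) * exp B) \<longlonglongrightarrow> 0 * L2_norm P0 G + 0"
    proof (intro tendsto_add tendsto_mult[OF lim0 L2_tendsto_norm[OF A(4)]])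
      show "(\<lambda>n. B\<^sup>2 / (2 * sqrt (real n)) * exp B) \<longlonglongrightarrow> 0" by real_asymp
    qed
    then show "(\<lambda>n. B / (2 * sqrt (real n)) * exp B * L2_norm P0 (?D n) + B\<^sup>2 / (2 * sqrt (real n)) * exp B) \<longlonglongrightarrow> 0" by simp
    show "\<forall>\<^sub>F n in sequentially. L2_norm P0 (\<lambda>x. 2 * (y n x - 1) / (1 / sqrt (real n)) - (?D n x + h x))
       \<le> B / (2 * sqrt (real n)) * exp B * L2_norm P0 (?D n) + B\<^sup>2 / (2 * sqrt (real n)) * exp B"
      using eventually_gt_at_top[of 0]
    proof eventually_elim
      case (elim n)
      \<comment> \<open>The error of the tilted root splits into \<open>(e n - 1) * D n + v\<close>,
        where both \<open>e n - 1\<close> and \<open>v\<close> are uniformly O(1 / sqrt n).\<close>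
      define v where "v x = 2 * sqrt (real n) * (e n x - 1) - h x" for x
      have [measurable]: "v \<in> borel_measurable P0" unfolding v_def by measurable
      have vb: "\<bar>v x\<bar> \<le> B\<^sup>2 / (2 * sqrt (real n)) * exp B" for x
      proof -
        let ?u = "h x / (2 * sqrt (real n))"
        have "v x = 2 * sqrt (real n) * (exp ?u - 1 - ?u)" using elim by (simp add: v_def e_def algebra_simps)
        then have "\<bar>v x\<bar> = 2 * sqrt (real n) * \<bar>exp ?u - 1 - ?u\<bar>" by (simp add: abs_mult)
        also have "\<dots> \<le> 2 * sqrt (real n) * (?u\<^sup>2 * exp \<bar>?u\<bar>)" by (intro mult_left_mono abs_exp_minus_2_le) simp
        also have "\<dots> \<le> 2 * sqrt (real n) * ((B / (2 * sqrt (real n)))\<^sup>2 * exp B)"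
        proof -
          have "?u\<^sup>2 \<le> (B / (2 * sqrt (real n)))\<^sup>2"
            using arg1[of x n] B0 by (intro abs_le_square_iff[THEN iffD1]) simp
          moreover have "exp \<bar>?u\<bar> \<le> exp B" using arg3[of x n] by simp
          ultimately show ?thesis by (intro mult_left_mono mult_mono) auto
        qed
        also have "\<dots> = B\<^sup>2 / (2 * sqrt (real n)) * exp B" using elim by (simp add: power_divide power_mult_distrib field_simps power2_eq_square)
        finally show ?thesis .
      qed
      have vL: "v \<in> L2 P0" by (rule L2_bounded[OF _ vb]) simp
      have vn: "L2_norm P0 v \<le> B\<^sup>2 / (2 * sqrt (real n)) * exp B"
        using L2_bounded_mult(2)[OF L2_const[of 1] _ vb] by (simp add: L2_norm_const)
      have em [measurable]: "(\<lambda>x. e n x - 1) \<in> borel_measurable P0" by measurable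
      note ED = L2_bounded_mult[OF L2_tendstoD(1)[OF A(4), of n] em e1]
      have "2 * (y n x - 1) / (1 / sqrt (real n)) - (?D n x + h x) = (e n x - 1) * ?D n x + v x" for x
        by (simp add: y_def v_def algebra_simps)
      then have "L2_norm P0 (\<lambda>x. 2 * (y n x - 1) / (1 / sqrt (real n)) - (?D n x + h x)) = L2_norm P0 (\<lambda>x. (e n x - 1) * ?D n x + v x)"
        by (simp only:)
      also have "\<dots> \<le> L2_norm P0 (\<lambda>x. (e n x - 1) * ?D n x) + L2_norm P0 v"
        by (rule L2_norm_triangle[OF ED(1) vL])
      also have "\<dots> \<le> B / (2 * sqrt (real n)) * exp B * L2_norm P0 (?D n) + B\<^sup>2 / (2 * sqrt (real n)) * exp B"
        by (intro add_mono ED(2) vn)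
      finally show ?case .
    qed
  qed
  moreover have "(\<lambda>n. 1 / sqrt (real n)) \<longlonglongrightarrow> 0" by real_asymp
  moreover have "\<forall>\<^sub>F n in sequentially. 1 / sqrt (real n) \<noteq> 0"
    using eventually_gt_at_top[of 0] by eventually_elim simp
  ultimately have norm: "L2_tendsto P0 sequentially (\<lambda>n x. 2 * (y n x / L2_norm P0 (y n) - 1) / (1 / sqrt (real n))) (\<lambda>x. G x + h x)"
    "(\<lambda>n. L2_norm P0 (y n)) \<longlonglongrightarrow> 1"
    using normalized_expansion[of P0 y sequentially "\<lambda>n. 1 / sqrt (real n)" "\<lambda>x. G x + h x"] P0 yL y0 c by auto
  show N1: "N \<longlonglongrightarrow> 1" using tendsto_power[OF norm(2), of 2] by (simp add: NL[abs_def])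
  have sq: "sqrt (a n x * exp (h x / sqrt (real n)) / N n) = y n x / L2_norm P0 (y n)" for n x
    using y0[of n x] by (simp add: y2[symmetric] NL real_sqrt_divide)
  have i: "integrable P0 (\<lambda>x. a n x * exp (h x / sqrt (real n)))" for n
    using L2_integrable_square[OF yL[of n]] by (simp add: y2)
  \<comment> \<open>Where \<open>N n = 0\<close>, division by zero makes the normalised density
    vanish; this happens for finitely many \<open>n\<close> only, so the mass is eventually exactly
    1.\<close>
  have I: "(\<integral>x. a n x * exp (h x / sqrt (real n)) / N n \<partial>P0) = (if N n = 0 then 0 else 1)" for n
    using N[of n] by simp
  have N0: "0 \<le> N n" for n by (simp add: NL)
  have mass: "(\<lambda>n. real n * (1 - (\<integral>x. a n x * exp (h x / sqrt (real n)) / N n \<partial>P0))) \<longlonglongrightarrow> 0"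
  proof (rule tendsto_eventually)
    show "\<forall>\<^sub>F n in sequentially. real n * (1 - (\<integral>x. a n x * exp (h x / sqrt (real n)) / N n \<partial>P0)) = 0"
      unfolding I using order_tendstoD(1)[OF N1, of 0] by (auto elim!: eventually_mono)
  qed
  show "density_expansion P0 (\<lambda>n x. a n x * exp (h x / sqrt (real n)) / N n) (\<lambda>x. G x + h x)"
    unfolding density_expansion_def sq
  proof (intro conjI allI norm(1) mass)
    fix n x
    show "integrable P0 (\<lambda>x. a n x * exp (h x / sqrt (real n)) / N n)" using i[of n] by simp
    show "0 \<le> a n x * exp (h x / sqrt (real n)) / N n" using A(2) N0 by simp
    show "(\<integral>x. a n x * exp (h x / sqrt (real n)) / N n \<partial>P0) \<le> 1" unfolding I by simp
  qed
qed

section \<open>The asymptotic power bound\<close>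

text \<open>The likelihood ratio of the tilted sample is an exponential of a linear statistic up to
  a constant. Neyman-Pearson regions are thus exactly the sets where that statistic is large, and
  their limiting probabilities are known.\<close>

lemma tilted_product_density:
  "product_density (\<lambda>x. a x * exp (h1 x / r) / N1) m1 (\<lambda>y. b y * exp (h2 y / r) / N2) m2 \<omega>
    = product_density a m1 b m2 \<omega> * exp (linear_statistic (1 / r) h1 m1 (1 / r) h2 m2 \<omega>) / (N1 ^ m1 * N2 ^ m2)"
  by (simp add: product_density_def linear_statistic_def prod.distrib prod_dividef exp_sum exp_add
      sum_distrib_left sum_divide_distrib[symmetric] flip: exp_sum)

text \<open>Neyman--Pearson for \<open>q = p * exp W / \<kappa>\<close>; the critical value \<open>exp w / \<kappa>\<close> is at most \<open>1 / \<beta>\<close>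
  because \<open>exp w / \<kappa> * p \<le> q\<close> on the rejection region.\<close>

lemma neyman_pearson_exponential:
  fixes p q W \<phi> :: "'a \<Rightarrow> real"
  assumes p: "integrable M p" "\<And>x. 0 \<le> p x" and q: "integrable M q" "(\<integral>x. q x \<partial>M) \<le> 1"
    and pq: "\<And>x. q x = p x * exp (W x) / \<kappa>" and \<kappa>: "\<kappa> > 0"
    and W: "W \<in> borel_measurable M"
    and \<phi>: "\<phi> \<in> borel_measurable M" "\<And>x. x \<in> space M \<Longrightarrow> 0 \<le> \<phi> x \<and> \<phi> x \<le> 1"
    and \<beta>: "0 < \<beta>" "\<beta> \<le> (\<integral>x. (if w < W x then 1 else 0) * p x \<partial>M)"
  shows "(\<integral>x. \<phi> x * q x \<partial>M) \<le> (\<integral>x. (if w < W x then 1 else 0) * q x \<partial>M)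
    + 1 / \<beta> * \<bar>(\<integral>x. \<phi> x * p x \<partial>M) - (\<integral>x. (if w < W x then 1 else 0) * p x \<partial>M)\<bar>"
proof -
  define rej :: "'a \<Rightarrow> real" where "rej x = (if w < W x then 1 else 0)" for x
  define r where "r = exp w / \<kappa>"
  note [measurable] = W \<phi>(1) borel_measurable_integrable[OF p(1)] borel_measurable_integrable[OF q(1)]
  have [measurable]: "rej \<in> borel_measurable M" unfolding rej_def by measurable
  have q0: "0 \<le> q x" for x using p(2)[of x] \<kappa> by (simp add: pq)
  have r0: "0 < r" using \<kappa> by (simp add: r_def)
  have i: "integrable M (\<lambda>x. \<phi> x * p x)" "integrable M (\<lambda>x. \<phi> x * q x)"
    by (rule Bochner_Integration.integrable_bound[OF p(1)], auto intro!: AE_I2 mult_left_le_one_le simp: abs_mult \<phi>(2))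
       (rule Bochner_Integration.integrable_bound[OF q(1)], auto intro!: AE_I2 mult_left_le_one_le simp: abs_mult \<phi>(2))
  have j: "integrable M (\<lambda>x. rej x * p x)" "integrable M (\<lambda>x. rej x * q x)"
    by (rule Bochner_Integration.integrable_bound[OF p(1)], auto simp: rej_def)
       (rule Bochner_Integration.integrable_bound[OF q(1)], auto simp: rej_def)
  have "r * (\<integral>x. rej x * p x \<partial>M) = (\<integral>x. r * (rej x * p x) \<partial>M)" by simp
  also have "\<dots> \<le> (\<integral>x. q x \<partial>M)"
  proof (rule integral_mono)
    fix x
    have "exp w * p x / \<kappa> \<le> q x" if "w < W x"
      unfolding pq using that p(2)[of x] \<kappa> by (intro divide_right_mono) (simp_all add: mult.commute[of "exp w"] mult_left_mono)
    then show "r * (rej x * p x) \<le> q x" using q0[of x] by (auto simp: rej_def r_def)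
  qed (use j q in auto)
  finally have "r * (\<integral>x. rej x * p x \<partial>M) \<le> 1" using q(2) by simp
  moreover have "r * \<beta> \<le> r * (\<integral>x. rej x * p x \<partial>M)" using \<beta>(2) r0 by (simp add: rej_def)
  ultimately have r1: "r \<le> 1 / \<beta>" using \<beta>(1) by (simp add: field_simps)
  have "(\<integral>x. \<phi> x * q x \<partial>M) - (\<integral>x. rej x * q x \<partial>M) = (\<integral>x. \<phi> x * q x - rej x * q x \<partial>M)"
    using i j by simp
  also have "\<dots> \<le> (\<integral>x. r * (\<phi> x * p x - rej x * p x) \<partial>M)"
  proof (rule integral_mono)
    fix x assume x: "x \<in> space M"
    \<comment> \<open>Where \<open>W\<close> exceeds \<open>w\<close> the region has
      \<open>rej = 1\<close>, so the first factor is at most 0; elsewhere \<open>rej = 0\<close> and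
      both signs are reversed.\<close>
    have x1: "(\<phi> x - rej x) * (exp (W x) - exp w) \<le> 0"
      using \<phi>(2)[OF x] by (auto simp: rej_def mult_nonpos_nonneg mult_nonneg_nonpos)
    have "p x / \<kappa> * ((\<phi> x - rej x) * (exp (W x) - exp w)) \<le> 0"
      by (rule mult_nonneg_nonpos[OF _ x1]) (use p(2)[of x] \<kappa> in simp)
    moreover have "p x / \<kappa> * ((\<phi> x - rej x) * (exp (W x) - exp w)) = (\<phi> x * q x - rej x * q x) - r * (\<phi> x * p x - rej x * p x)"
      using \<kappa> by (simp add: pq r_def field_simps)
    ultimately show "\<phi> x * q x - rej x * q x \<le> r * (\<phi> x * p x - rej x * p x)" by simp
  qed (use i j in auto)
  also have "\<dots> = r * ((\<integral>x. \<phi> x * p x \<partial>M) - (\<integral>x. rej x * p x \<partial>M))" using i j by simp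
  also have "\<dots> \<le> r * \<bar>(\<integral>x. \<phi> x * p x \<partial>M) - (\<integral>x. rej x * p x \<partial>M)\<bar>"
    using r0 by (intro mult_left_mono) auto
  also have "\<dots> \<le> 1 / \<beta> * \<bar>(\<integral>x. \<phi> x * p x \<partial>M) - (\<integral>x. rej x * p x \<partial>M)\<bar>"
    by (intro mult_right_mono r1) simp
  finally show ?thesis by (simp add: rej_def)
qed

lemma L2_centered_diff:
  assumes "prob_space M" "f \<in> L2_centered M" "g \<in> L2_centered M"
  shows "(\<lambda>x. f x - g x) \<in> L2_centered M"
proof -
  interpret prob_space M by fact
  show ?thesis using assms(2,3) L2_imp_integrable by (auto simp: L2_centered_def L2_diff)
qed

text \<open>The functional \<open>k\<close> does not enter: a limiting level along \<open>s'\<close>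
  bounds the power along \<open>s\<close> by that of the most powerful test in the Gaussian shift by
  \<open>v\<close>, the weighted distance of the two tangents. The conclusion carries a slack
  \<open>e\<close> because the truncation of the direction is chosen from \<open>e\<close> before
  \<open>n\<close> grows.\<close>

lemma asymptotic_power_bound:
  assumes le: "local_expansion P0 Q0 s a b G1 G2" and le': "local_expansion P0 Q0 s' a' b' G1' G2'"
    and m: "(\<lambda>n. real (m1 n) / real n) \<longlonglongrightarrow> \<rho>1" "(\<lambda>n. real (m2 n) / real n) \<longlonglongrightarrow> \<rho>2"
    and v: "v > 0" "v\<^sup>2 = \<rho>1 * (\<integral>x. (G1 x - G1' x)\<^sup>2 \<partial>P0) + \<rho>2 * (\<integral>y. (G2 y - G2' y)\<^sup>2 \<partial>Q0)"
    and \<phi>: "\<And>n. \<phi> n \<in> borel_measurable (two_sample_product (m1 n) (m2 n) P0 Q0)"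
      "\<And>n \<omega>. \<omega> \<in> space (two_sample_product (m1 n) (m2 n) P0 Q0) \<Longrightarrow> 0 \<le> \<phi> n \<omega> \<and> \<phi> n \<omega> \<le> 1"
    and level: "(\<lambda>n. \<integral>\<omega>. \<phi> n \<omega> \<partial>two_sample_product (m1 n) (m2 n) (fst s' n) (snd s' n)) \<longlonglongrightarrow> 1 - std_normal_cdf z"
    and z: "std_normal_cdf z < 1" and e: "e > 0"
  shows "\<forall>\<^sub>F n in sequentially. (\<integral>\<omega>. \<phi> n \<omega> \<partial>two_sample_product (m1 n) (m2 n) (fst s n) (snd s n))
           < 1 - std_normal_cdf (z - v) + e"
proof -
  have d1: "sqrt_differentiable P0 sequentially (\<lambda>n. 1 / sqrt (real n)) (fst s) a G1"
    and d2: "sqrt_differentiable Q0 sequentially (\<lambda>n. 1 / sqrt (real n)) (snd s) b G2"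
    and G: "G1 \<in> L2_centered P0" "G2 \<in> L2_centered Q0"
    using le by (auto simp: local_expansion_def)
  have d1': "sqrt_differentiable P0 sequentially (\<lambda>n. 1 / sqrt (real n)) (fst s') a' G1'"
    and d2': "sqrt_differentiable Q0 sequentially (\<lambda>n. 1 / sqrt (real n)) (snd s') b' G2'"
    and G': "G1' \<in> L2_centered P0" "G2' \<in> L2_centered Q0"
    using le' by (auto simp: local_expansion_def)
  have P0: "prob_space P0" and Q0: "prob_space Q0"
    by (rule sqrt_differentiableD(1)[OF d1], rule sqrt_differentiableD(1)[OF d2])
  interpret P0: prob_space P0 by fact
  interpret Q0: prob_space Q0 by fact
  define h1 where "h1 x = G1 x - G1' x" for x
  define h2 where "h2 y = G2 y - G2' y" for y
  have hc: "h1 \<in> L2_centered P0" "h2 \<in> L2_centered Q0"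
    unfolding h1_def h2_def by (rule L2_centered_diff P0 Q0 G G')+
  have hL: "h1 \<in> L2 P0" "h2 \<in> L2 Q0" using hc by (auto simp: L2_centered_def)
  obtain f1 where f1: "L2_tendsto P0 sequentially f1 h1" and f1c: "\<And>k. (\<integral>x. f1 k x \<partial>P0) = 0"
    and f1b: "\<And>k. \<exists>B. \<forall>x. \<bar>f1 k x\<bar> \<le> B"
    using P0.L2_centered_bounded_dense[OF hc(1)] by blast
  obtain f2 where f2: "L2_tendsto Q0 sequentially f2 h2" and f2c: "\<And>k. (\<integral>x. f2 k x \<partial>Q0) = 0"
    and f2b: "\<And>k. \<exists>B. \<forall>x. \<bar>f2 k x\<bar> \<le> B"
    using Q0.L2_centered_bounded_dense[OF hc(2)] by blast
  \<comment> \<open>For the truncated direction, \<open>v2\<close> is the limiting variance of the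
    exponent, \<open>\<Delta>\<close> its mean shift between \<open>s'\<close> and \<open>s\<close>,
    and \<open>\<tau>\<close> the limiting bound for the change of a test integral when the tilted
    density replaces that of \<open>s\<close>. As truncation is lifted, both \<open>v2\<close> and
    \<open>\<Delta>\<close> tend to \<open>v\<^sup>2\<close>, so the standardised shift tends to
    \<open>v\<close>.\<close>
  define v2 where "v2 k = \<rho>1 * (\<integral>x. (f1 k x)\<^sup>2 \<partial>P0) + \<rho>2 * (\<integral>y. (f2 k y)\<^sup>2 \<partial>Q0)" for k
  define \<Delta> where "\<Delta> k = \<rho>1 * (\<integral>x. f1 k x * h1 x \<partial>P0) + \<rho>2 * (\<integral>y. f2 k y * h2 y \<partial>Q0)" for k
  define \<tau> where "\<tau> k = sqrt (\<rho>1 * (L2_norm P0 (\<lambda>x. f1 k x - h1 x))\<^sup>2 + \<rho>2 * (L2_norm Q0 (\<lambda>y. f2 k y - h2 y))\<^sup>2)" for k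
  have vv: "v\<^sup>2 = \<rho>1 * (\<integral>x. (h1 x)\<^sup>2 \<partial>P0) + \<rho>2 * (\<integral>y. (h2 y)\<^sup>2 \<partial>Q0)"
    using v(2) by (simp add: h1_def h2_def)
  have v2: "v2 \<longlonglongrightarrow> v\<^sup>2"
    unfolding v2_def vv L2_norm_power2[symmetric]
    by (intro tendsto_intros L2_tendsto_norm[OF f1] L2_tendsto_norm[OF f2])
  have \<Delta>: "\<Delta> \<longlonglongrightarrow> v\<^sup>2"
    unfolding \<Delta>_def vv unfolding power2_eq_square
    by (intro tendsto_intros L2_tendsto_inner[OF f1 L2_tendsto_const[OF hL(1)]] L2_tendsto_inner[OF f2 L2_tendsto_const[OF hL(2)]])
  have "\<tau> \<longlonglongrightarrow> sqrt (\<rho>1 * 0\<^sup>2 + \<rho>2 * 0\<^sup>2)"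
    unfolding \<tau>_def by (intro tendsto_intros L2_tendstoD(3)[OF f1] L2_tendstoD(3)[OF f2])
  then have \<tau>: "\<tau> \<longlonglongrightarrow> 0" by simp
  have sv: "(\<lambda>k. sqrt (v2 k)) \<longlonglongrightarrow> v" using tendsto_real_sqrt[OF v2] v(1) by simp
  have "(\<lambda>k. z - \<Delta> k / sqrt (v2 k)) \<longlonglongrightarrow> z - v\<^sup>2 / v"
    using v(1) by (intro tendsto_intros \<Delta> sv) auto
  then have lim_arg: "(\<lambda>k. z - \<Delta> k / sqrt (v2 k)) \<longlonglongrightarrow> z - v" using v(1) by (simp add: power2_eq_square)
  have "(\<lambda>k. 1 - std_normal_cdf (z - \<Delta> k / sqrt (v2 k)) + 2 * \<tau> k) \<longlonglongrightarrow> 1 - std_normal_cdf (z - v) + 2 * 0"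
    by (intro tendsto_intros \<tau> isCont_tendsto_compose[OF isCont_std_normal_cdf lim_arg])
  moreover have "1 - std_normal_cdf (z - v) + 2 * 0 < 1 - std_normal_cdf (z - v) + e" using e by simp
  ultimately have "\<forall>\<^sub>F k in sequentially. 1 - std_normal_cdf (z - \<Delta> k / sqrt (v2 k)) + 2 * \<tau> k < 1 - std_normal_cdf (z - v) + e"
    by (rule order_tendstoD(2))
  moreover have "\<forall>\<^sub>F k in sequentially. 0 < v2 k" using order_tendstoD(1)[OF v2, of 0] v(1) by simp
  ultimately have "\<forall>\<^sub>F k in sequentially. 0 < v2 k \<and> 1 - std_normal_cdf (z - \<Delta> k / sqrt (v2 k)) + 2 * \<tau> k < 1 - std_normal_cdf (z - v) + e"
    by eventually_elim simp
  \<comment> \<open>The truncation index is fixed here. The error \<open>\<tau> k\<close> counts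
    twice, once for the competitor and once for the rejection indicator.\<close>
  then obtain k where k: "0 < v2 k" "1 - std_normal_cdf (z - \<Delta> k / sqrt (v2 k)) + 2 * \<tau> k < 1 - std_normal_cdf (z - v) + e"
    by (auto simp: eventually_sequentially)
  obtain B1 where B1: "\<And>x. \<bar>f1 k x\<bar> \<le> B1" using f1b by blast
  obtain B2 where B2: "\<And>x. \<bar>f2 k x\<bar> \<le> B2" using f2b by blast
  have fL: "f1 k \<in> L2 P0" "f2 k \<in> L2 Q0" by (rule L2_tendstoD(1)[OF f1] L2_tendstoD(1)[OF f2])+
  have fc: "f1 k \<in> L2_centered P0" "f2 k \<in> L2_centered Q0" using fL f1c f2c by (auto simp: L2_centered_def)
  define \<sigma> where "\<sigma> = sqrt (v2 k)"
  have \<sigma>: "\<sigma> > 0" "\<sigma>\<^sup>2 = \<rho>1 * 1\<^sup>2 * (\<integral>x. (f1 k x)\<^sup>2 \<partial>P0) + \<rho>2 * 1\<^sup>2 * (\<integral>y. (f2 k y)\<^sup>2 \<partial>Q0)"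
    using k(1) by (auto simp: \<sigma>_def v2_def)
  define \<mu>' where "\<mu>' = \<rho>1 * 1 * (\<integral>x. f1 k x * G1' x \<partial>P0) + \<rho>2 * 1 * (\<integral>y. f2 k y * G2' y \<partial>Q0)"
  define \<mu> where "\<mu> = \<rho>1 * 1 * (\<integral>x. f1 k x * G1 x \<partial>P0) + \<rho>2 * 1 * (\<integral>y. f2 k y * G2 y \<partial>Q0)"
  have \<mu>\<Delta>: "\<mu> - \<mu>' = \<Delta> k"
  proof -
    have GL: "G1 \<in> L2 P0" "G2 \<in> L2 Q0" "G1' \<in> L2 P0" "G2' \<in> L2 Q0" using G G' by (auto simp: L2_centered_def)
    have ie: "(\<integral>x. f1 k x * h1 x \<partial>P0) = (\<integral>x. f1 k x * G1 x \<partial>P0) - (\<integral>x. f1 k x * G1' x \<partial>P0)"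
      "(\<integral>x. f2 k x * h2 x \<partial>Q0) = (\<integral>x. f2 k x * G2 x \<partial>Q0) - (\<integral>x. f2 k x * G2' x \<partial>Q0)"
      using L2_integrable_mult[OF fL(1) GL(1)] L2_integrable_mult[OF fL(1) GL(3)]
        L2_integrable_mult[OF fL(2) GL(2)] L2_integrable_mult[OF fL(2) GL(4)]
      by (simp_all add: h1_def h2_def right_diff_distrib)
    show ?thesis unfolding \<Delta>_def \<mu>_def \<mu>'_def ie by (simp add: algebra_simps)
  qed
  \<comment> \<open>The critical value that gives the tilted Neyman-Pearson test the same limiting
    level along \<open>s'\<close> as the competitor.\<close>
  define w where "w = \<mu>' + \<sigma> * z"
  let ?M = "\<lambda>n. two_sample_product (m1 n) (m2 n) P0 Q0"
  let ?R = "\<lambda>n. two_sample_product (m1 n) (m2 n) (fst s n) (snd s n)"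
  let ?R' = "\<lambda>n. two_sample_product (m1 n) (m2 n) (fst s' n) (snd s' n)"
  define W where "W n = linear_statistic (1 / sqrt (real n)) (f1 k) (m1 n) (1 / sqrt (real n)) (f2 k) (m2 n)" for n
  define rej where "rej n \<omega> = (if w < W n \<omega> then 1 else 0 :: real)" for n \<omega>
  have c1: "(\<lambda>n. 1 / sqrt (real n) * sqrt (real n)) \<longlonglongrightarrow> 1" by real_asymp
  have Wm [measurable]: "W n \<in> borel_measurable (?M n)" for n
    unfolding W_def by (rule measurable_linear_statistic L2_measurable fL)+
  have rejm [measurable]: "rej n \<in> borel_measurable (?M n)" for n unfolding rej_def by measurable
  have sets: "sets (?R n) = sets (?M n)" "sets (?R' n) = sets (?M n)" for n
    by (rule sets_two_sample_product[OF ac_densityD(1)[OF sqrt_differentiableD(3)[OF d1]] ac_densityD(1)[OF sqrt_differentiableD(3)[OF d2]]]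
        sets_two_sample_product[OF ac_densityD(1)[OF sqrt_differentiableD(3)[OF d1']] ac_densityD(1)[OF sqrt_differentiableD(3)[OF d2']]])+
  have rej_int: "(\<integral>\<omega>. rej n \<omega> \<partial>R) = measure R {\<omega> \<in> space R. w < W n \<omega>}" if "sets R = sets (?M n)" for n R
  proof -
    have "{\<omega> \<in> space R. w < W n \<omega>} \<in> sets R"
      using sets_eq_imp_space_eq[OF that] that by (simp, measurable)
    moreover have "(\<integral>\<omega>. rej n \<omega> \<partial>R) = (\<integral>\<omega>. indicator {\<omega> \<in> space R. w < W n \<omega>} \<omega> \<partial>R)"
      by (intro Bochner_Integration.integral_cong) (auto simp: rej_def split: split_indicator)
    ultimately show ?thesis by simp
  qed
  have rej_R: "(\<lambda>n. \<integral>\<omega>. rej n \<omega> \<partial>?R n) \<longlonglongrightarrow> 1 - std_normal_cdf ((w - \<mu>) / \<sigma>)"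
    unfolding rej_int[OF sets(1)] W_def
    by (rule linear_statistic_asymptotics[OF le fc c1 c1 m \<sigma> \<mu>_def])
  have rej_R': "(\<lambda>n. \<integral>\<omega>. rej n \<omega> \<partial>?R' n) \<longlonglongrightarrow> 1 - std_normal_cdf ((w - \<mu>') / \<sigma>)"
    unfolding rej_int[OF sets(2)] W_def
    by (rule linear_statistic_asymptotics[OF le' fc c1 c1 m \<sigma> \<mu>'_def])
  have arg': "(w - \<mu>') / \<sigma> = z" using \<sigma>(1) by (simp add: w_def)
  have arg: "(w - \<mu>) / \<sigma> = z - \<Delta> k / sqrt (v2 k)"
    using \<sigma>(1) unfolding \<mu>\<Delta>[symmetric] by (simp add: w_def \<sigma>_def[symmetric] field_simps)
  text \<open>The tilted density \<open>q\<close> has the expansion of \<open>s\<close> up to the truncation error.\<close>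
  define N1 where "N1 n = (\<integral>x. a' n x * exp (f1 k x / sqrt (real n)) \<partial>P0)" for n
  define N2 where "N2 n = (\<integral>y. b' n y * exp (f2 k y / sqrt (real n)) \<partial>Q0)" for n
  note E = sqrt_differentiable_imp_density_expansion[OF d1] sqrt_differentiable_imp_density_expansion[OF d2]
    and E' = sqrt_differentiable_imp_density_expansion[OF d1'] sqrt_differentiable_imp_density_expansion[OF d2']
  \<comment> \<open>Centering is the condition under which normalising the tilted density leaves its
    tangent alone.\<close>
  have cent: "(\<integral>x. G1' x + f1 k x \<partial>P0) = 0" "(\<integral>y. G2' y + f2 k y \<partial>Q0) = 0"
    using G' P0.L2_imp_integrable Q0.L2_imp_integrable fL f1c f2c by (auto simp: L2_centered_def)
  note T1 = tilted_expansion[OF P0 E'(1) L2_measurable[OF fL(1)] B1 cent(1) N1_def]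
    and T2 = tilted_expansion[OF Q0 E'(2) L2_measurable[OF fL(2)] B2 cent(2) N2_def]
  define qa where "qa n x = a' n x * exp (f1 k x / sqrt (real n)) / N1 n" for n x
  define qb where "qb n y = b' n y * exp (f2 k y / sqrt (real n)) / N2 n" for n y
  have q1: "density_expansion P0 qa (\<lambda>x. G1' x + f1 k x)" and q2: "density_expansion Q0 qb (\<lambda>x. G2' x + f2 k x)"
    using T1(1) T2(1) by (simp_all add: qa_def[abs_def] qb_def[abs_def])
  let ?p = "\<lambda>n. product_density (a n) (m1 n) (b n) (m2 n)"
  let ?p' = "\<lambda>n. product_density (a' n) (m1 n) (b' n) (m2 n)"
  let ?q = "\<lambda>n. product_density (qa n) (m1 n) (qb n) (m2 n)"
  define good where "good n \<psi> \<longleftrightarrow> \<psi> \<in> borel_measurable (?M n) \<and> (\<forall>\<omega>\<in>space (?M n). \<bar>\<psi> \<omega>\<bar> \<le> 1)" for n and \<psi> :: "_ \<Rightarrow> real"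
  have good\<phi>: "good n (\<phi> n)" and good_rej: "good n (rej n)" for n
    using \<phi>(1)[of n] \<phi>(2)[of _ n] rejm[of n] by (auto simp: good_def rej_def)
  obtain \<delta> where \<delta>: "\<delta> \<longlonglongrightarrow> sqrt (\<rho>1 * (L2_norm P0 (\<lambda>x. (G1' x + f1 k x) - G1 x))\<^sup>2 + \<rho>2 * (L2_norm Q0 (\<lambda>y. (G2' y + f2 k y) - G2 y))\<^sup>2)"
    and \<delta>_bd0: "\<forall>\<^sub>F n in sequentially. \<forall>\<psi>\<in>borel_measurable (?M n). (\<forall>\<omega>\<in>space (?M n). \<bar>\<psi> \<omega>\<bar> \<le> 1) \<longrightarrow>
       \<bar>(\<integral>\<omega>. \<psi> \<omega> * ?q n \<omega> \<partial>?M n) - (\<integral>\<omega>. \<psi> \<omega> * ?p n \<omega> \<partial>?M n)\<bar> \<le> \<delta> n"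
    by (rule product_density_distance[OF P0 Q0 q1 q2 E m])
  have \<delta>_bd: "\<forall>\<^sub>F n in sequentially. \<forall>\<psi>. good n \<psi> \<longrightarrow> \<bar>(\<integral>\<omega>. \<psi> \<omega> * ?q n \<omega> \<partial>?M n) - (\<integral>\<omega>. \<psi> \<omega> * ?p n \<omega> \<partial>?M n)\<bar> \<le> \<delta> n"
    using \<delta>_bd0 by eventually_elim (auto simp: good_def)
  have "(\<lambda>x. (G1' x + f1 k x) - G1 x) = (\<lambda>x. f1 k x - h1 x)" "(\<lambda>x. (G2' x + f2 k x) - G2 x) = (\<lambda>x. f2 k x - h2 x)"
    by (auto simp: h1_def h2_def)
  with \<delta> have \<delta>\<tau>: "\<delta> \<longlonglongrightarrow> \<tau> k" by (simp add: \<tau>_def)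
  obtain \<eta> where \<eta>: "\<eta> \<longlonglongrightarrow> 0" and \<eta>_bd0: "\<forall>\<^sub>F n in sequentially. \<forall>\<psi>\<in>borel_measurable (?M n). (\<forall>\<omega>\<in>space (?M n). \<bar>\<psi> \<omega>\<bar> \<le> 1) \<longrightarrow>
       \<bar>(\<integral>\<omega>. \<psi> \<omega> \<partial>?R n) - (\<integral>\<omega>. \<psi> \<omega> * ?p n \<omega> \<partial>?M n)\<bar> \<le> \<eta> n"
    by (rule local_expansion_test_integral[OF le m])
  have \<eta>_bd: "\<forall>\<^sub>F n in sequentially. \<forall>\<psi>. good n \<psi> \<longrightarrow> \<bar>(\<integral>\<omega>. \<psi> \<omega> \<partial>?R n) - (\<integral>\<omega>. \<psi> \<omega> * ?p n \<omega> \<partial>?M n)\<bar> \<le> \<eta> n"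
    using \<eta>_bd0 by eventually_elim (auto simp: good_def)
  obtain \<eta>' where \<eta>': "\<eta>' \<longlonglongrightarrow> 0" and \<eta>'_bd0: "\<forall>\<^sub>F n in sequentially. \<forall>\<psi>\<in>borel_measurable (?M n). (\<forall>\<omega>\<in>space (?M n). \<bar>\<psi> \<omega>\<bar> \<le> 1) \<longrightarrow>
       \<bar>(\<integral>\<omega>. \<psi> \<omega> \<partial>?R' n) - (\<integral>\<omega>. \<psi> \<omega> * ?p' n \<omega> \<partial>?M n)\<bar> \<le> \<eta>' n"
    by (rule local_expansion_test_integral[OF le' m])
  have \<eta>'_bd: "\<forall>\<^sub>F n in sequentially. \<forall>\<psi>. good n \<psi> \<longrightarrow> \<bar>(\<integral>\<omega>. \<psi> \<omega> \<partial>?R' n) - (\<integral>\<omega>. \<psi> \<omega> * ?p' n \<omega> \<partial>?M n)\<bar> \<le> \<eta>' n"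
    using \<eta>'_bd0 by eventually_elim (auto simp: good_def)
  \<comment> \<open>Half the limiting level of \<open>rej\<close> along \<open>s'\<close>. Its level
    under the density of \<open>s'\<close> eventually exceeds this, which keeps the Neyman-Pearson
    multiplier at most \<open>1 / \<beta>\<close> for all large \<open>n\<close>.\<close>
  define \<beta> where "\<beta> = (1 - std_normal_cdf z) / 2"
  have \<beta>: "0 < \<beta>" "\<beta> < 1 - std_normal_cdf z" using z by (auto simp: \<beta>_def)
  have "(\<lambda>n. (\<integral>\<omega>. rej n \<omega> \<partial>?R' n) - \<eta>' n) \<longlonglongrightarrow> 1 - std_normal_cdf z - 0"
    using rej_R' unfolding arg' by (intro tendsto_intros \<eta>')
  then have ev\<beta>: "\<forall>\<^sub>F n in sequentially. \<beta> < (\<integral>\<omega>. rej n \<omega> \<partial>?R' n) - \<eta>' n"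
    using \<beta>(2) by (intro order_tendstoD(1)) auto
  \<comment> \<open>Collects the replacements, each made for both the competitor and
    \<open>rej\<close>: measures of \<open>s'\<close> by densities (\<open>\<eta>'\<close>), tilted
    density by the density of \<open>s\<close> (\<open>\<delta>\<close>), and that density by the
    measures of \<open>s\<close> (\<open>\<eta>\<close>). The difference of the two levels along
    \<open>s'\<close> tends to 0.\<close>
  define bound where "bound n = (\<integral>\<omega>. rej n \<omega> \<partial>?R n) + 1 / \<beta> * (\<bar>(\<integral>\<omega>. \<phi> n \<omega> \<partial>?R' n) - (\<integral>\<omega>. rej n \<omega> \<partial>?R' n)\<bar> + 2 * \<eta>' n) + 2 * \<delta> n + 2 * \<eta> n" for n
  have "bound \<longlonglongrightarrow> (1 - std_normal_cdf ((w - \<mu>) / \<sigma>)) + 1 / \<beta> * (\<bar>(1 - std_normal_cdf z) - (1 - std_normal_cdf ((w - \<mu>') / \<sigma>))\<bar> + 2 * 0) + 2 * \<tau> k + 2 * 0"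
    unfolding bound_def by (intro tendsto_intros rej_R rej_R' level \<eta>' \<delta>\<tau> \<eta>)
  then have "bound \<longlonglongrightarrow> 1 - std_normal_cdf (z - \<Delta> k / sqrt (v2 k)) + 2 * \<tau> k"
    by (simp add: arg arg')
  from order_tendstoD(2)[OF this k(2)]
  have "\<forall>\<^sub>F n in sequentially. bound n < 1 - std_normal_cdf (z - v) + e" .
  moreover have "\<forall>\<^sub>F n in sequentially. 0 < N1 n" "\<forall>\<^sub>F n in sequentially. 0 < N2 n"
    using order_tendstoD(1)[OF T1(2), of 0] order_tendstoD(1)[OF T2(2), of 0] by auto
  ultimately show ?thesis
    using \<delta>_bd \<eta>_bd \<eta>'_bd ev\<beta>
  proof eventually_elim
    case (elim n)
    note A' = density_expansionD[OF E'(1)] and B' = density_expansionD[OF E'(2)]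
    note A = density_expansionD[OF q1] and B = density_expansionD[OF q2]
    have pq: "?q n \<omega> = ?p' n \<omega> * exp (W n \<omega>) / (N1 n ^ m1 n * N2 n ^ m2 n)" for \<omega>
      unfolding qa_def qb_def W_def by (rule tilted_product_density)
    have \<kappa>: "0 < N1 n ^ m1 n * N2 n ^ m2 n" using elim(2,3) by simp
    have d': "\<bar>(\<integral>\<omega>. rej n \<omega> \<partial>?R' n) - (\<integral>\<omega>. rej n \<omega> * ?p' n \<omega> \<partial>?M n)\<bar> \<le> \<eta>' n"
      "\<bar>(\<integral>\<omega>. \<phi> n \<omega> \<partial>?R' n) - (\<integral>\<omega>. \<phi> n \<omega> * ?p' n \<omega> \<partial>?M n)\<bar> \<le> \<eta>' n"
      using elim(6) good\<phi>[of n] good_rej[of n] by auto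
    have dq: "\<bar>(\<integral>\<omega>. rej n \<omega> * ?q n \<omega> \<partial>?M n) - (\<integral>\<omega>. rej n \<omega> * ?p n \<omega> \<partial>?M n)\<bar> \<le> \<delta> n"
      "\<bar>(\<integral>\<omega>. \<phi> n \<omega> * ?q n \<omega> \<partial>?M n) - (\<integral>\<omega>. \<phi> n \<omega> * ?p n \<omega> \<partial>?M n)\<bar> \<le> \<delta> n"
      using elim(4) good\<phi>[of n] good_rej[of n] by auto
    have dp: "\<bar>(\<integral>\<omega>. rej n \<omega> \<partial>?R n) - (\<integral>\<omega>. rej n \<omega> * ?p n \<omega> \<partial>?M n)\<bar> \<le> \<eta> n"
      "\<bar>(\<integral>\<omega>. \<phi> n \<omega> \<partial>?R n) - (\<integral>\<omega>. \<phi> n \<omega> * ?p n \<omega> \<partial>?M n)\<bar> \<le> \<eta> n"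
      using elim(5) good\<phi>[of n] good_rej[of n] by auto
    have \<beta>le: "\<beta> \<le> (\<integral>\<omega>. rej n \<omega> * ?p' n \<omega> \<partial>?M n)" using d'(1) elim(7) by linarith
    have np: "(\<integral>\<omega>. \<phi> n \<omega> * ?q n \<omega> \<partial>?M n) \<le> (\<integral>\<omega>. rej n \<omega> * ?q n \<omega> \<partial>?M n)
        + 1 / \<beta> * \<bar>(\<integral>\<omega>. \<phi> n \<omega> * ?p' n \<omega> \<partial>?M n) - (\<integral>\<omega>. rej n \<omega> * ?p' n \<omega> \<partial>?M n)\<bar>"
      unfolding rej_def
      by (rule neyman_pearson_exponential[OF product_density_integral(1)[OF P0 Q0 A'(1) B'(1)] product_density_nonneg[OF A'(2) B'(2)]
          product_density_integral(1)[OF P0 Q0 A(1) B(1)] product_density_le_1[OF P0 Q0 A(1) B(1) A(2) B(2) A(3) B(3)]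
          pq \<kappa> Wm \<phi>(1) \<phi>(2) \<beta>(1) \<beta>le[unfolded rej_def]])
    have "1 / \<beta> * \<bar>(\<integral>\<omega>. \<phi> n \<omega> * ?p' n \<omega> \<partial>?M n) - (\<integral>\<omega>. rej n \<omega> * ?p' n \<omega> \<partial>?M n)\<bar>
        \<le> 1 / \<beta> * (\<bar>(\<integral>\<omega>. \<phi> n \<omega> \<partial>?R' n) - (\<integral>\<omega>. rej n \<omega> \<partial>?R' n)\<bar> + 2 * \<eta>' n)"
      using d' \<beta>(1) by (intro mult_left_mono) auto
    with np dq dp elim(1) show ?case unfolding bound_def by linarith
  qed
qed

section \<open>Optimality\<close>

lemma local_sequence_expansion:
  assumes fam: "\<And>P. P \<in> \<P> \<Longrightarrow> prob_space P \<and> sets P = sets M1"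
      "\<And>Q. Q \<in> \<Q> \<Longrightarrow> prob_space Q \<and> sets Q = sets M2"
    and P0: "P0 \<in> \<P>" and Q0: "Q0 \<in> \<Q>"
    and grad: "is_gradient k (P0 \<Otimes>\<^sub>M Q0) (product_family \<P> \<Q>) kt"
    and cone: "tangent_cone (P0 \<Otimes>\<^sub>M Q0) (product_family \<P> \<Q>) = tangent_space (P0 \<Otimes>\<^sub>M Q0) (product_family \<P> \<Q>)"
    and s: "s \<in> local_sequences \<P> \<Q> P0 Q0"
  obtains a b G1 G2 where "local_expansion P0 Q0 s a b G1 G2"
    "(\<lambda>\<omega>. G1 (fst \<omega>) + G2 (snd \<omega>)) \<in> tangent_space (P0 \<Otimes>\<^sub>M Q0) (product_family \<P> \<Q>)"
    "local_parameter k P0 Q0 s = (\<integral>\<omega>. kt \<omega> * (G1 (fst \<omega>) + G2 (snd \<omega>)) \<partial>(P0 \<Otimes>\<^sub>M Q0))"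
proof -
  obtain t \<tau> \<epsilon> f g where t: "t \<longlonglongrightarrow> 0" "(\<lambda>n. t n * sqrt (real n)) \<longlonglongrightarrow> \<tau>" "\<tau> > 0"
    and f: "L2_differentiable_curve_in (product_family \<P> \<Q>) (P0 \<Otimes>\<^sub>M Q0) \<epsilon> f g"
    and ft: "\<forall>n. \<bar>t n\<bar> < \<epsilon> \<and> f (t n) = fst s n \<Otimes>\<^sub>M snd s n"
    and sm: "\<forall>n. fst s n \<in> \<P> \<and> snd s n \<in> \<Q>"
    using s unfolding local_sequences_def by (auto simp: case_prod_beta)
  have sm': "fst s n \<in> \<P>" "snd s n \<in> \<Q>" "f (t n) = fst s n \<Otimes>\<^sub>M snd s n" "\<bar>t n\<bar> < \<epsilon>" for n
    using sm ft by auto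
  obtain a b g1 g2 where le: "local_expansion P0 Q0 s a b (\<lambda>x. \<tau> * g1 x) (\<lambda>y. \<tau> * g2 y)"
    and g: "g1 \<in> L2_centered P0" "g2 \<in> L2_centered Q0"
      "AE \<omega> in P0 \<Otimes>\<^sub>M Q0. g \<omega> = g1 (fst \<omega>) + g2 (snd \<omega>)"
    and lp: "local_parameter k P0 Q0 s = \<tau> * (\<integral>\<omega>. kt \<omega> * g \<omega> \<partial>(P0 \<Otimes>\<^sub>M Q0))"
    by (rule curve_sequence_expansion[OF fam P0 Q0 f grad sm'(1-3) t sm'(4)])
  have gT: "g \<in> tangent_space (P0 \<Otimes>\<^sub>M Q0) (product_family \<P> \<Q>)"
    unfolding cone[symmetric] tangent_cone_def using f by blast
  have [measurable]: "g1 \<in> borel_measurable P0" "g2 \<in> borel_measurable Q0"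
    using g by (auto simp: L2_centered_def dest: L2_measurable)
  have [measurable]: "g \<in> borel_measurable (P0 \<Otimes>\<^sub>M Q0)" "kt \<in> borel_measurable (P0 \<Otimes>\<^sub>M Q0)"
    using gT grad by (auto simp: tangent_space_def L2_closure_def is_gradient_def L2_centered_def dest: L2_measurable)
  \<comment> \<open>The zero summand casts a scalar multiple in the form of
    \<open>tangent_space_combination\<close>.\<close>
  have ae: "AE \<omega> in P0 \<Otimes>\<^sub>M Q0. \<tau> * g \<omega> + 0 * g \<omega> = \<tau> * g1 (fst \<omega>) + \<tau> * g2 (snd \<omega>)"
    using g(3) by eventually_elim (simp add: algebra_simps)
  have T: "(\<lambda>\<omega>. \<tau> * g1 (fst \<omega>) + \<tau> * g2 (snd \<omega>)) \<in> tangent_space (P0 \<Otimes>\<^sub>M Q0) (product_family \<P> \<Q>)"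
    by (rule tangent_space_cong_AE[OF tangent_space_combination[OF gT gT] _ ae]) measurable
  have "local_parameter k P0 Q0 s = (\<integral>\<omega>. kt \<omega> * (\<tau> * g \<omega>) \<partial>(P0 \<Otimes>\<^sub>M Q0))"
    unfolding lp integral_mult_right_zero[symmetric] by (simp add: mult_ac)
  also have "\<dots> = (\<integral>\<omega>. kt \<omega> * (\<tau> * g1 (fst \<omega>) + \<tau> * g2 (snd \<omega>)) \<partial>(P0 \<Otimes>\<^sub>M Q0))"
    by (rule integral_cong_AE) (measurable, use ae in eventually_elim, simp)
  finally show ?thesis using that[OF le T] by blast
qed

lemma limsup_le_if_eventually_less:
  fixes f :: "nat \<Rightarrow> real"
  assumes "\<And>e. e > 0 \<Longrightarrow> \<forall>\<^sub>F n in sequentially. f n < L + e"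
  shows "limsup (\<lambda>n. ereal (f n)) \<le> ereal L"
proof (rule ereal_le_epsilon2)
  fix e :: real assume "0 < e"
  from assms[OF this] have "\<forall>\<^sub>F n in sequentially. ereal (f n) \<le> ereal L + ereal e"
    by eventually_elim simp
  then show "limsup (\<lambda>n. ereal (f n)) \<le> ereal L + ereal e" by (rule Limsup_bounded)
qed

lemma liminf_ge_if_eventually_greater:
  fixes f :: "nat \<Rightarrow> real"
  assumes "\<And>e. e > 0 \<Longrightarrow> \<forall>\<^sub>F n in sequentially. L - e < f n"
  shows "ereal L \<le> liminf (\<lambda>n. ereal (f n))"
proof (rule ereal_le_epsilon2)
  fix e :: real assume "0 < e"
  from assms[OF this] have "\<forall>\<^sub>F n in sequentially. ereal (L - e) \<le> ereal (f n)"
    by eventually_elim simp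
  then have "ereal (L - e) \<le> liminf (\<lambda>n. ereal (f n))" by (rule Liminf_bounded)
  then have "ereal (L - e) + ereal e \<le> liminf (\<lambda>n. ereal (f n)) + ereal e" by (rule add_right_mono)
  then show "ereal L \<le> liminf (\<lambda>n. ereal (f n)) + ereal e" by simp
qed

theorem mainTheorem12:
  fixes M1 :: "'a measure" and M2 :: "'b measure"
    and \<P> :: "'a measure set" and \<Q> :: "'b measure set"
    and P0 :: "'a measure" and Q0 :: "'b measure"
    and k :: "('a \<times> 'b) measure \<Rightarrow> real"
    and kt :: "'a \<times> 'b \<Rightarrow> real" and k1 :: "'a \<Rightarrow> real" and k2 :: "'b \<Rightarrow> real"
    and n1 n2 :: "nat \<Rightarrow> nat" and \<alpha> d c :: real
    and \<psi> :: "('a, 'b) test_seq"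
  assumes \<P>: "\<And>P. P \<in> \<P> \<Longrightarrow> prob_space P \<and> sets P = sets M1"
    and \<Q>: "\<And>Q. Q \<in> \<Q> \<Longrightarrow> prob_space Q \<and> sets Q = sets M2"
    and P0: "P0 \<in> \<P>" and Q0: "Q0 \<in> \<Q>"
    and gradient: "is_canonical_gradient k (P0 \<Otimes>\<^sub>M Q0) (product_family \<P> \<Q>) kt"
    and k1: "k1 \<in> L2_centered P0" and k2: "k2 \<in> L2_centered Q0"
    and decomposition: "AE \<omega> in P0 \<Otimes>\<^sub>M Q0. kt \<omega> = k1 (fst \<omega>) + k2 (snd \<omega>)"
    and nonzero: "L2_norm (P0 \<Otimes>\<^sub>M Q0) kt \<noteq> 0"
    and \<alpha>: "0 < \<alpha>" "\<alpha> < 1"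
    and sample_sizes: "\<And>n. n \<ge> 1 \<Longrightarrow> n1 n + n2 n = n"
    and d: "(\<lambda>n. real (n2 n) / real n) \<longlonglongrightarrow> d" "0 < d" "d < 1"
    and cone: "tangent_cone (P0 \<Otimes>\<^sub>M Q0) (product_family \<P> \<Q>) =
               tangent_space (P0 \<Otimes>\<^sub>M Q0) (product_family \<P> \<Q>)"
    and c: "c = std_normal_quantile (1 - \<alpha>) *
                sqrt (1 / (1 - d) * (\<integral>x. (k1 x)\<^sup>2 \<partial>P0) + 1 / d * (\<integral>y. (k2 y)\<^sup>2 \<partial>Q0))"
    and \<psi>: "\<And>n \<omega>. \<psi> n \<omega> = (if test_statistic k1 k2 n (n1 n) (n2 n) \<omega> > c then 1 else 0)"
  shows "asymp_optimal n1 n2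
           (implicit_hypotheses k \<P> \<Q> P0 Q0) (implicit_alternatives k \<P> \<Q> P0 Q0)
           (asymp_similar_tests M1 M2 n1 n2 k \<P> \<Q> P0 Q0 \<alpha>) \<psi>"
proof -
  let ?R0 = "P0 \<Otimes>\<^sub>M Q0" and ?T = "tangent_space (P0 \<Otimes>\<^sub>M Q0) (product_family \<P> \<Q>)"
  have pP0: "prob_space P0" and pQ0: "prob_space Q0" and sP0: "sets P0 = sets M1" and sQ0: "sets Q0 = sets M2"
    using \<P>[OF P0] \<Q>[OF Q0] by auto
  have grad: "is_gradient k ?R0 (product_family \<P> \<Q>) kt" and ktT: "kt \<in> ?T"
    using gradient by (auto simp: is_canonical_gradient_def)
  have kL: "k1 \<in> L2 P0" "k2 \<in> L2 Q0" using k1 k2 by (auto simp: L2_centered_def)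
  note [measurable] = L2_measurable[OF kL(1)] L2_measurable[OF kL(2)]
  have ktm [measurable]: "kt \<in> borel_measurable ?R0"
    using grad by (auto simp: is_gradient_def L2_centered_def dest: L2_measurable)
  \<comment> \<open>On centered components the derivative of \<open>k\<close> splits into one inner
    product per sample.\<close>
  have inner: "(\<integral>\<omega>. kt \<omega> * (g1 (fst \<omega>) + g2 (snd \<omega>)) \<partial>?R0) = (\<integral>x. k1 x * g1 x \<partial>P0) + (\<integral>y. k2 y * g2 y \<partial>Q0)"
    if g: "g1 \<in> L2_centered P0" "g2 \<in> L2_centered Q0" for g1 g2
  proof -
    have [measurable]: "g1 \<in> borel_measurable P0" "g2 \<in> borel_measurable Q0"
      using g by (auto simp: L2_centered_def dest: L2_measurable)
    have "(\<integral>\<omega>. kt \<omega> * (g1 (fst \<omega>) + g2 (snd \<omega>)) \<partial>?R0)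
        = (\<integral>\<omega>. (k1 (fst \<omega>) + k2 (snd \<omega>)) * (g1 (fst \<omega>) + g2 (snd \<omega>)) \<partial>?R0)"
      by (rule integral_cong_AE) (measurable, use decomposition in eventually_elim, simp)
    then show ?thesis using pair_centered_inner[OF pP0 pQ0 k1 k2 g] by simp
  qed
  define A where "A = (\<integral>x. (k1 x)\<^sup>2 \<partial>P0)"
  define B where "B = (\<integral>y. (k2 y)\<^sup>2 \<partial>Q0)"
  have AB0: "0 \<le> A" "0 \<le> B" by (auto simp: A_def B_def)
  have "(L2_norm ?R0 kt)\<^sup>2 = (\<integral>\<omega>. kt \<omega> * (k1 (fst \<omega>) + k2 (snd \<omega>)) \<partial>?R0)"
    unfolding L2_norm_power2
    by (rule integral_cong_AE) (measurable, use decomposition in eventually_elim, simp add: power2_eq_square)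
  also have "\<dots> = A + B" unfolding inner[OF k1 k2] A_def B_def power2_eq_square ..
  finally have "A + B \<noteq> 0" using nonzero by auto
  then have AB: "A > 0 \<or> B > 0" using AB0 by linarith
  \<comment> \<open>Limiting standard deviation of the test statistic, and also the norm of
    \<open>(k1 / (1 - d), k2 / d)\<close> for the weights \<open>1 - d\<close> and \<open>d\<close>.
    It is positive because the gradient is not null.\<close>
  define \<sigma> where "\<sigma> = sqrt (1 / (1 - d) * A + 1 / d * B)"
  have \<sigma>2: "\<sigma>\<^sup>2 = 1 / (1 - d) * A + 1 / d * B"
    unfolding \<sigma>_def using AB0 d(2,3) by (intro real_sqrt_pow2) simp
  have \<sigma>0: "\<sigma> > 0"
    unfolding \<sigma>_def using AB AB0 d(2,3)
    by (intro real_sqrt_gt_zero) (auto intro: add_pos_nonneg add_nonneg_pos)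
  define u where "u = std_normal_quantile (1 - \<alpha>)"
  have u: "std_normal_cdf u = 1 - \<alpha>" unfolding u_def using \<alpha> by (intro std_normal_cdf_quantile) auto
  have c\<sigma>: "c = u * \<sigma>" by (simp add: c u_def \<sigma>_def A_def B_def)
  have m1: "(\<lambda>n. real (n1 n) / real n) \<longlonglongrightarrow> 1 - d"
  proof (rule Lim_transform_eventually)
    show "(\<lambda>n. 1 - real (n2 n) / real n) \<longlonglongrightarrow> 1 - d" by (intro tendsto_intros d)
    show "\<forall>\<^sub>F n in sequentially. 1 - real (n2 n) / real n = real (n1 n) / real n"
      using eventually_ge_at_top[of 1]
    proof eventually_elim
      case (elim n)
      then have "real (n1 n) + real (n2 n) = real n" using sample_sizes[of n] by linarith
      with elim show ?case by (simp add: field_simps)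
    qed
  qed
  note m2 = d(1)
  \<comment> \<open>The product is \<open>n / n1 n\<close>, the reciprocal of the first sample
    fraction.\<close>
  have c1: "(\<lambda>n. sqrt (real n) / real (n1 n) * sqrt (real n)) \<longlonglongrightarrow> 1 / (1 - d)"
    using tendsto_divide[OF tendsto_const[of 1] m1] d(3) by simp
  have c2: "(\<lambda>n. sqrt (real n) / real (n2 n) * sqrt (real n)) \<longlonglongrightarrow> 1 / d"
    using tendsto_divide[OF tendsto_const[of 1] m2] d(2) by simp
  have stat: "test_statistic k1 k2 n (n1 n) (n2 n) = linear_statistic (sqrt (real n) / real (n1 n)) k1 (n1 n) (sqrt (real n) / real (n2 n)) k2 (n2 n)" for n
    by (rule ext) (simp add: test_statistic_def linear_statistic_def)
  have sM: "sets (two_sample_product l1 l2 M1 M2) = sets (two_sample_product l1 l2 P0 Q0)" for l1 l2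
    by (rule sets_two_sample_product[OF sP0[symmetric] sQ0[symmetric]])
  have \<psi>m: "\<psi> n \<in> borel_measurable (two_sample_product (n1 n) (n2 n) P0 Q0)" for n
  proof -
    have [measurable]: "linear_statistic (sqrt (real n) / real (n1 n)) k1 (n1 n) (sqrt (real n) / real (n2 n)) k2 (n2 n)
      \<in> borel_measurable (two_sample_product (n1 n) (n2 n) P0 Q0)" by measurable
    show ?thesis unfolding \<psi>[abs_def] stat by measurable
  qed
  have \<psi>_test: "\<psi> \<in> test_sequences M1 M2 n1 n2"
    using \<psi>m by (auto simp: test_sequences_def measurable_cong_sets[OF sM refl] \<psi>)
  have expansion: "\<exists>a b G1 G2. local_expansion P0 Q0 s a b G1 G2 \<and> (\<lambda>\<omega>. G1 (fst \<omega>) + G2 (snd \<omega>)) \<in> ?T \<and>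
      local_parameter k P0 Q0 s = (\<integral>x. k1 x * G1 x \<partial>P0) + (\<integral>y. k2 y * G2 y \<partial>Q0)"
    if s: "s \<in> local_sequences \<P> \<Q> P0 Q0" for s
  proof -
    obtain a b G1 G2 where le: "local_expansion P0 Q0 s a b G1 G2" and T: "(\<lambda>\<omega>. G1 (fst \<omega>) + G2 (snd \<omega>)) \<in> ?T"
      and lp: "local_parameter k P0 Q0 s = (\<integral>\<omega>. kt \<omega> * (G1 (fst \<omega>) + G2 (snd \<omega>)) \<partial>?R0)"
      by (rule local_sequence_expansion[OF \<P> \<Q> P0 Q0 grad cone s])
    have "G1 \<in> L2_centered P0" "G2 \<in> L2_centered Q0" using le by (auto simp: local_expansion_def)
    then have "local_parameter k P0 Q0 s = (\<integral>x. k1 x * G1 x \<partial>P0) + (\<integral>y. k2 y * G2 y \<partial>Q0)"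
      unfolding lp by (rule inner)
    with le T show ?thesis by (intro exI conjI)
  qed
  have sets_s: "sets (two_sample_product l1 l2 (fst s n) (snd s n)) = sets (two_sample_product l1 l2 P0 Q0)"
    "prob_space (two_sample_product l1 l2 (fst s n) (snd s n))"
    if s: "s \<in> local_sequences \<P> \<Q> P0 Q0" for s l1 l2 n
  proof -
    have "fst s n \<in> \<P>" "snd s n \<in> \<Q>" using s by (auto simp: local_sequences_def)
    then show "sets (two_sample_product l1 l2 (fst s n) (snd s n)) = sets (two_sample_product l1 l2 P0 Q0)"
      "prob_space (two_sample_product l1 l2 (fst s n) (snd s n))"
      using \<P> \<Q> sP0 sQ0 by (auto intro!: sets_two_sample_product prob_space_two_sample_product)
  qed
  have power_\<psi>: "power_seq n1 n2 s \<psi> \<longlonglongrightarrow> 1 - std_normal_cdf (u - local_parameter k P0 Q0 s / \<sigma>)"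
    if s: "s \<in> local_sequences \<P> \<Q> P0 Q0" for s
  proof -
    obtain a b G1 G2 where le: "local_expansion P0 Q0 s a b G1 G2"
      and lp: "local_parameter k P0 Q0 s = (\<integral>x. k1 x * G1 x \<partial>P0) + (\<integral>y. k2 y * G2 y \<partial>Q0)"
      using expansion[OF s] by blast
    have sig: "\<sigma>\<^sup>2 = (1 - d) * (1 / (1 - d))\<^sup>2 * (\<integral>x. (k1 x)\<^sup>2 \<partial>P0) + d * (1 / d)\<^sup>2 * (\<integral>y. (k2 y)\<^sup>2 \<partial>Q0)"
      unfolding \<sigma>2 A_def[symmetric] B_def[symmetric] using d(2,3) by (simp add: power2_eq_square)
    \<comment> \<open>The coefficients \<open>1 / (1 - d)\<close> and \<open>1 / d\<close> cancel
      the sample fractions, so the drift of the test statistic is the local parameter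
      itself.\<close>
    have mu: "local_parameter k P0 Q0 s = (1 - d) * (1 / (1 - d)) * (\<integral>x. k1 x * G1 x \<partial>P0) + d * (1 / d) * (\<integral>y. k2 y * G2 y \<partial>Q0)"
      unfolding lp using d(2,3) by simp
    have "power_seq n1 n2 s \<psi> n = measure (two_sample_product (n1 n) (n2 n) (fst s n) (snd s n))
        {\<omega> \<in> space (two_sample_product (n1 n) (n2 n) (fst s n) (snd s n)).
          c < linear_statistic (sqrt (real n) / real (n1 n)) k1 (n1 n) (sqrt (real n) / real (n2 n)) k2 (n2 n) \<omega>}" for n
    proof -
      let ?R = "two_sample_product (n1 n) (n2 n) (fst s n) (snd s n)"
      let ?S = "{\<omega> \<in> space ?R. c < linear_statistic (sqrt (real n) / real (n1 n)) k1 (n1 n) (sqrt (real n) / real (n2 n)) k2 (n2 n) \<omega>}"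
      have "linear_statistic (sqrt (real n) / real (n1 n)) k1 (n1 n) (sqrt (real n) / real (n2 n)) k2 (n2 n)
        \<in> borel_measurable (two_sample_product (n1 n) (n2 n) P0 Q0)" by measurable
      then have [measurable]: "linear_statistic (sqrt (real n) / real (n1 n)) k1 (n1 n) (sqrt (real n) / real (n2 n)) k2 (n2 n)
        \<in> borel_measurable ?R" by (simp add: measurable_cong_sets[OF sets_s(1)[OF s] refl])
      have S: "?S \<in> sets ?R" by measurable
      have "power_seq n1 n2 s \<psi> n = (\<integral>\<omega>. indicator ?S \<omega> \<partial>?R)"
        unfolding power_seq_def \<psi> stat
        by (intro Bochner_Integration.integral_cong) (auto split: split_indicator)
      with S show ?thesis by simp
    qed
    note power_eq = ext[of "power_seq n1 n2 s \<psi>", OF this]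
    have "power_seq n1 n2 s \<psi> \<longlonglongrightarrow> 1 - std_normal_cdf ((c - local_parameter k P0 Q0 s) / \<sigma>)"
      unfolding power_eq by (rule linear_statistic_asymptotics[OF le k1 k2 c1 c2 m1 m2 \<sigma>0 sig mu])
    moreover have "(c - local_parameter k P0 Q0 s) / \<sigma> = u - local_parameter k P0 Q0 s / \<sigma>"
      using \<sigma>0 by (simp add: c\<sigma> field_simps)
    ultimately show ?thesis by simp
  qed
  have H: "s \<in> local_sequences \<P> \<Q> P0 Q0" if "s \<in> implicit_hypotheses k \<P> \<Q> P0 Q0 \<union> implicit_alternatives k \<P> \<Q> P0 Q0" for s
    using that by (auto simp: implicit_hypotheses_def implicit_alternatives_def)
  have \<psi>_class: "\<psi> \<in> asymp_similar_tests M1 M2 n1 n2 k \<P> \<Q> P0 Q0 \<alpha>"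
    unfolding asymp_similar_tests_def
  proof (intro CollectI conjI \<psi>_test ballI impI)
    fix s assume "s \<in> implicit_hypotheses k \<P> \<Q> P0 Q0" "local_parameter k P0 Q0 s = 0"
    with power_\<psi>[OF H, of s] show "power_seq n1 n2 s \<psi> \<longlonglongrightarrow> \<alpha>" by (simp add: u)
  qed
  text \<open>\<open>k1 / (1 - d) + k2 / d\<close> is a least favourable direction; subtracting its multiple with the same
    derivative of \<open>k\<close> from the tangent of \<open>s\<close> gives a companion sequence \<open>s'\<close> with parameter 0.\<close>
  have kT: "(\<lambda>\<omega>. k1 (fst \<omega>)) \<in> ?T" "(\<lambda>\<omega>. k2 (snd \<omega>)) \<in> ?T"
  proof -
    \<comment> \<open>Equality of cone and space makes the canonical gradient, a priori only a limit
      of combinations of tangents, the tangent of an actual product curve, which can be split into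
      its factors.\<close>
    have ktC: "kt \<in> tangent_cone ?R0 (product_family \<P> \<Q>)" using ktT cone by simp
    obtain g1 g2 where g: "g1 \<in> L2_centered P0" "g2 \<in> L2_centered Q0"
      "AE \<omega> in ?R0. kt \<omega> = g1 (fst \<omega>) + g2 (snd \<omega>)"
      and gT: "(\<lambda>\<omega>. g1 (fst \<omega>)) \<in> tangent_cone ?R0 (product_family \<P> \<Q>)"
        "(\<lambda>\<omega>. g2 (snd \<omega>)) \<in> tangent_cone ?R0 (product_family \<P> \<Q>)"
      by (rule tangent_cone_components[OF \<P> \<Q> P0 Q0 ktC])
    have "AE \<omega> in ?R0. g1 (fst \<omega>) + g2 (snd \<omega>) = k1 (fst \<omega>) + k2 (snd \<omega>)"
      using g(3) decomposition by eventually_elim simp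
    note eq = centered_decomposition_unique[OF pP0 pQ0 g(1,2) k1 k2 this]
    \<comment> \<open>The equality on the first coordinate is lifted to the product measure by way
      of the norm, which a function of one coordinate keeps there.\<close>
    have dL: "(\<lambda>x. g1 x - k1 x) \<in> L2 P0" using g(1) kL by (auto simp: L2_centered_def L2_diff)
    have "L2_norm P0 (\<lambda>x. g1 x - k1 x) = L2_norm P0 (\<lambda>x. 0)"
      using eq(1) L2_measurable[OF dL] by (intro L2_norm_cong_AE) (auto elim: eventually_mono)
    then have "L2_norm ?R0 (\<lambda>\<omega>. g1 (fst \<omega>) - k1 (fst \<omega>)) = 0"
      using pair_L2_fst(2)[OF pP0 pQ0 dL] by (simp add: L2_norm_def)
    from L2_norm_zero_AE[OF pair_L2_fst(1)[OF pP0 pQ0 dL] this]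
    have e1: "AE \<omega> in ?R0. g1 (fst \<omega>) = k1 (fst \<omega>)" by simp
    have "AE \<omega> in ?R0. g1 (fst \<omega>) + g2 (snd \<omega>) = k1 (fst \<omega>) + k2 (snd \<omega>)" by fact
    with e1 have e2: "AE \<omega> in ?R0. g2 (snd \<omega>) = k2 (snd \<omega>)" by eventually_elim simp
    show "(\<lambda>\<omega>. k1 (fst \<omega>)) \<in> ?T"
      by (rule tangent_space_cong_AE[OF gT(1)[unfolded cone] _ e1]) measurable
    show "(\<lambda>\<omega>. k2 (snd \<omega>)) \<in> ?T"
      by (rule tangent_space_cong_AE[OF gT(2)[unfolded cone] _ e2]) measurable
  qed
  \<comment> \<open>Stated with an absolute value and a free level \<open>z\<close> so that it
    applies to a competitor with \<open>z = u\<close> on the alternatives and to its complement with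
    \<open>z = - u\<close> on the hypotheses. The parameter must be nonzero for the shift to be
    positive.\<close>
  have bound: "\<forall>\<^sub>F n in sequentially. (\<integral>\<omega>. \<phi> n \<omega> \<partial>two_sample_product (n1 n) (n2 n) (fst s n) (snd s n))
      < 1 - std_normal_cdf (z - \<bar>local_parameter k P0 Q0 s\<bar> / \<sigma>) + e"
    if s: "s \<in> local_sequences \<P> \<Q> P0 Q0" and nz: "local_parameter k P0 Q0 s \<noteq> 0"
      and \<phi>: "\<And>n. \<phi> n \<in> borel_measurable (two_sample_product (n1 n) (n2 n) P0 Q0)"
        "\<And>n \<omega>. \<omega> \<in> space (two_sample_product (n1 n) (n2 n) P0 Q0) \<Longrightarrow> 0 \<le> \<phi> n \<omega> \<and> \<phi> n \<omega> \<le> 1"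
      and level: "\<And>s'. s' \<in> implicit_hypotheses k \<P> \<Q> P0 Q0 \<Longrightarrow> local_parameter k P0 Q0 s' = 0 \<Longrightarrow>
        (\<lambda>n. \<integral>\<omega>. \<phi> n \<omega> \<partial>two_sample_product (n1 n) (n2 n) (fst s' n) (snd s' n)) \<longlonglongrightarrow> 1 - std_normal_cdf z"
      and z: "std_normal_cdf z < 1" and e: "e > 0" for s \<phi> z e
  proof -
    define \<theta> where "\<theta> = local_parameter k P0 Q0 s"
    obtain a b G1 G2 where le: "local_expansion P0 Q0 s a b G1 G2" and T: "(\<lambda>\<omega>. G1 (fst \<omega>) + G2 (snd \<omega>)) \<in> ?T"
      and lp: "\<theta> = (\<integral>x. k1 x * G1 x \<partial>P0) + (\<integral>y. k2 y * G2 y \<partial>Q0)"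
      unfolding \<theta>_def using expansion[OF s] by blast
    have G: "G1 \<in> L2_centered P0" "G2 \<in> L2_centered Q0" using le by (auto simp: local_expansion_def)
    then have GL: "G1 \<in> L2 P0" "G2 \<in> L2 Q0" by (auto simp: L2_centered_def)
    \<comment> \<open>Coefficient of the projection onto the least favourable direction: the
      derivative of \<open>k\<close> along that direction is \<open>\<sigma>\<^sup>2\<close>, so
      subtracting \<open>l\<close> times it leaves parameter 0.\<close>
    define l where "l = \<theta> / \<sigma>\<^sup>2"
    define H1 where "H1 x = G1 x - l / (1 - d) * k1 x" for x
    define H2 where "H2 y = G2 y - l / d * k2 y" for y
    have sc: "(\<lambda>x. r * k1 x) \<in> L2_centered P0" "(\<lambda>x. r * k2 x) \<in> L2_centered Q0" for r
      using k1 k2 by (auto simp: L2_centered_def L2_scale)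
    have Hc: "H1 \<in> L2_centered P0" "H2 \<in> L2_centered Q0"
      unfolding H1_def[abs_def] H2_def[abs_def]
      by (rule L2_centered_diff pP0 pQ0 G sc)+
    have "(\<lambda>\<omega>. 1 * (1 * (G1 (fst \<omega>) + G2 (snd \<omega>)) + (- (l / (1 - d))) * k1 (fst \<omega>)) + (- (l / d)) * k2 (snd \<omega>)) \<in> ?T"
      by (intro tangent_space_combination T kT)
    then have HT: "(\<lambda>\<omega>. H1 (fst \<omega>) + H2 (snd \<omega>)) \<in> tangent_cone ?R0 (product_family \<P> \<Q>)"
      by (simp add: cone H1_def H2_def algebra_simps)
    obtain s' a' b' where s': "s' \<in> local_sequences \<P> \<Q> P0 Q0" and le': "local_expansion P0 Q0 s' a' b' H1 H2"
      and lp': "local_parameter k P0 Q0 s' = (\<integral>\<omega>. kt \<omega> * (H1 (fst \<omega>) + H2 (snd \<omega>)) \<partial>?R0)"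
      by (rule tangent_local_sequence[OF \<P> \<Q> P0 Q0 grad HT Hc])
    have ie: "(\<integral>x. k1 x * H1 x \<partial>P0) = (\<integral>x. k1 x * G1 x \<partial>P0) - l / (1 - d) * A"
      "(\<integral>y. k2 y * H2 y \<partial>Q0) = (\<integral>y. k2 y * G2 y \<partial>Q0) - l / d * B"
    proof -
      have "(\<integral>x. k1 x * H1 x \<partial>P0) = (\<integral>x. k1 x * G1 x - l / (1 - d) * (k1 x)\<^sup>2 \<partial>P0)"
        by (simp add: H1_def right_diff_distrib power2_eq_square mult_ac)
      then show "(\<integral>x. k1 x * H1 x \<partial>P0) = (\<integral>x. k1 x * G1 x \<partial>P0) - l / (1 - d) * A"
        using L2_integrable_mult[OF kL(1) GL(1)] L2_integrable_square[OF kL(1)] by (simp add: A_def)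
      have "(\<integral>x. k2 x * H2 x \<partial>Q0) = (\<integral>x. k2 x * G2 x - l / d * (k2 x)\<^sup>2 \<partial>Q0)"
        by (simp add: H2_def right_diff_distrib power2_eq_square mult_ac)
      then show "(\<integral>y. k2 y * H2 y \<partial>Q0) = (\<integral>y. k2 y * G2 y \<partial>Q0) - l / d * B"
        using L2_integrable_mult[OF kL(2) GL(2)] L2_integrable_square[OF kL(2)] by (simp add: B_def)
    qed
    have "local_parameter k P0 Q0 s' = \<theta> - l * \<sigma>\<^sup>2"
      unfolding lp' inner[OF Hc] ie lp \<sigma>2 by (simp add: algebra_simps)
    then have lp0: "local_parameter k P0 Q0 s' = 0" using \<sigma>0 by (simp add: l_def)
    then have lev: "(\<lambda>n. \<integral>\<omega>. \<phi> n \<omega> \<partial>two_sample_product (n1 n) (n2 n) (fst s' n) (snd s' n)) \<longlonglongrightarrow> 1 - std_normal_cdf z"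
      using s' by (intro level) (auto simp: implicit_hypotheses_def)
    have v: "\<bar>\<theta>\<bar> / \<sigma> > 0" using nz \<sigma>0 by (simp add: \<theta>_def)
    \<comment> \<open>The tangents of \<open>s\<close> and \<open>s'\<close> differ by
      \<open>l\<close> times the least favourable direction, whose weighted norm is
      \<open>\<sigma>\<close>. The shift \<open>\<bar>\<theta>\<bar> / \<sigma>\<close> is the one
      seen in the power of \<open>\<psi>\<close>, which is why the bound is attained.\<close>
    have v2: "(\<bar>\<theta>\<bar> / \<sigma>)\<^sup>2 = (1 - d) * (\<integral>x. (G1 x - H1 x)\<^sup>2 \<partial>P0) + d * (\<integral>y. (G2 y - H2 y)\<^sup>2 \<partial>Q0)"
    proof -
      have GH: "G1 x - H1 x = l / (1 - d) * k1 x" "G2 y - H2 y = l / d * k2 y" for x y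
        by (simp_all add: H1_def H2_def)
      have "(\<integral>x. (G1 x - H1 x)\<^sup>2 \<partial>P0) = (l / (1 - d))\<^sup>2 * A" "(\<integral>y. (G2 y - H2 y)\<^sup>2 \<partial>Q0) = (l / d)\<^sup>2 * B"
        unfolding A_def B_def GH power_mult_distrib by (rule integral_mult_right_zero)+
      moreover have "r * ((l / r)\<^sup>2 * x) = l\<^sup>2 * (1 / r * x)" for r x :: real
        by (simp add: power2_eq_square)
      ultimately have "(1 - d) * (\<integral>x. (G1 x - H1 x)\<^sup>2 \<partial>P0) + d * (\<integral>y. (G2 y - H2 y)\<^sup>2 \<partial>Q0) = l\<^sup>2 * \<sigma>\<^sup>2"
        unfolding \<sigma>2 by (simp only: distrib_left)
      also have "\<dots> = (\<bar>\<theta>\<bar> / \<sigma>)\<^sup>2" using \<sigma>0 by (simp add: l_def power2_eq_square)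
      finally show ?thesis ..
    qed
    show ?thesis
      using asymptotic_power_bound[OF le le' m1 m2 v v2 \<phi> lev z e] by (simp add: \<theta>_def)
  qed
  show ?thesis
    unfolding asymp_optimal_def
  proof (intro conjI ballI \<psi>_class)
    fix s assume s: "s \<in> implicit_hypotheses k \<P> \<Q> P0 Q0 \<union> implicit_alternatives k \<P> \<Q> P0 Q0"
    show "convergent (power_seq n1 n2 s \<psi>)" using power_\<psi>[OF H[OF s]] by (auto simp: convergent_def)
  next
    fix \<phi> s
    assume \<phi>: "\<phi> \<in> asymp_similar_tests M1 M2 n1 n2 k \<P> \<Q> P0 Q0 \<alpha>" and s: "s \<in> implicit_alternatives k \<P> \<Q> P0 Q0"
    have sl: "s \<in> local_sequences \<P> \<Q> P0 Q0" and pos: "local_parameter k P0 Q0 s > 0"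
      using s by (auto simp: implicit_alternatives_def)
    have \<phi>m: "\<phi> n \<in> borel_measurable (two_sample_product (n1 n) (n2 n) P0 Q0)"
      "\<omega> \<in> space (two_sample_product (n1 n) (n2 n) P0 Q0) \<Longrightarrow> 0 \<le> \<phi> n \<omega> \<and> \<phi> n \<omega> \<le> 1" for n \<omega>
      using \<phi> by (auto simp: asymp_similar_tests_def test_sequences_def measurable_cong_sets[OF sM refl] sets_eq_imp_space_eq[OF sM] image_subset_iff)
    have lev: "(\<lambda>n. \<integral>\<omega>. \<phi> n \<omega> \<partial>two_sample_product (n1 n) (n2 n) (fst s' n) (snd s' n)) \<longlonglongrightarrow> 1 - std_normal_cdf u"
      if "s' \<in> implicit_hypotheses k \<P> \<Q> P0 Q0" "local_parameter k P0 Q0 s' = 0" for s'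
      using \<phi> that by (simp add: asymp_similar_tests_def power_seq_def[abs_def] u)
    have ev: "\<forall>\<^sub>F n in sequentially. (\<integral>\<omega>. \<phi> n \<omega> \<partial>two_sample_product (n1 n) (n2 n) (fst s n) (snd s n))
        < 1 - std_normal_cdf (u - \<bar>local_parameter k P0 Q0 s\<bar> / \<sigma>) + e" if e: "e > 0" for e
    proof (rule bound[OF sl _ _ _ _ _ e])
      show "local_parameter k P0 Q0 s \<noteq> 0" using pos by simp
      show "std_normal_cdf u < 1" using u \<alpha> by simp
    qed (fact \<phi>m lev)+
    have "limsup (\<lambda>n. ereal (power_seq n1 n2 s \<phi> n)) \<le> ereal (1 - std_normal_cdf (u - local_parameter k P0 Q0 s / \<sigma>))"
      using ev pos by (intro limsup_le_if_eventually_less) (simp add: power_seq_def)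
    then show "limsup (\<lambda>n. ereal (power_seq n1 n2 s \<phi> n)) \<le> ereal (lim (power_seq n1 n2 s \<psi>))"
      using limI[OF power_\<psi>[OF sl]] by simp
  next
    fix \<phi> s
    assume \<phi>: "\<phi> \<in> asymp_similar_tests M1 M2 n1 n2 k \<P> \<Q> P0 Q0 \<alpha>" and s: "s \<in> implicit_hypotheses k \<P> \<Q> P0 Q0"
    have sl: "s \<in> local_sequences \<P> \<Q> P0 Q0" and neg: "local_parameter k P0 Q0 s \<le> 0"
      using s by (auto simp: implicit_hypotheses_def)
    have \<phi>m: "\<phi> n \<in> borel_measurable (two_sample_product (n1 n) (n2 n) P0 Q0)"
      "\<omega> \<in> space (two_sample_product (n1 n) (n2 n) P0 Q0) \<Longrightarrow> 0 \<le> \<phi> n \<omega> \<and> \<phi> n \<omega> \<le> 1" for n \<omega>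
      using \<phi> by (auto simp: asymp_similar_tests_def test_sequences_def measurable_cong_sets[OF sM refl] sets_eq_imp_space_eq[OF sM] image_subset_iff)
    have lev\<phi>: "power_seq n1 n2 s' \<phi> \<longlonglongrightarrow> \<alpha>"
      if "s' \<in> implicit_hypotheses k \<P> \<Q> P0 Q0" "local_parameter k P0 Q0 s' = 0" for s'
      using \<phi> that by (simp add: asymp_similar_tests_def)
    have lim\<psi>: "lim (power_seq n1 n2 s \<psi>) = 1 - std_normal_cdf (u - local_parameter k P0 Q0 s / \<sigma>)"
      by (rule limI[OF power_\<psi>[OF sl]])
    show "ereal (lim (power_seq n1 n2 s \<psi>)) \<le> liminf (\<lambda>n. ereal (power_seq n1 n2 s \<phi> n))"
    proof (cases "local_parameter k P0 Q0 s = 0")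
      case True
      have "(\<lambda>n. ereal (power_seq n1 n2 s \<phi> n)) \<longlonglongrightarrow> ereal \<alpha>" using lev\<phi>[OF s True] by simp
      from lim_imp_Liminf[OF _ this] show ?thesis by (simp add: lim\<psi> True u)
    next
      case False
      \<comment> \<open>For a negative parameter the complementary test is bounded from above. Along
        sequences with parameter 0 its level tends to \<open>1 - \<alpha>\<close>, which is
        \<open>1 - std_normal_cdf (- u)\<close> by symmetry.\<close>
      have compl: "(\<integral>\<omega>. 1 - \<phi> n \<omega> \<partial>two_sample_product (n1 n) (n2 n) (fst s' n) (snd s' n)) = 1 - power_seq n1 n2 s' \<phi> n"
        if s': "s' \<in> local_sequences \<P> \<Q> P0 Q0" for s' n
      proof -
        interpret prob_space "two_sample_product (n1 n) (n2 n) (fst s' n) (snd s' n)" by (rule sets_s(2)[OF s'])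
        have "integrable (two_sample_product (n1 n) (n2 n) (fst s' n) (snd s' n)) (\<phi> n)"
          by (rule integrable_const_bound[where B = 1])
             (use \<phi>m(1)[of n] \<phi>m(2)[of _ n] in \<open>auto intro!: AE_I2 simp: measurable_cong_sets[OF sets_s(1)[OF s'] refl] sets_eq_imp_space_eq[OF sets_s(1)[OF s']]\<close>)
        then show ?thesis by (simp add: power_seq_def prob_space)
      qed
      have lev: "(\<lambda>n. \<integral>\<omega>. 1 - \<phi> n \<omega> \<partial>two_sample_product (n1 n) (n2 n) (fst s' n) (snd s' n)) \<longlonglongrightarrow> 1 - std_normal_cdf (- u)"
        if s': "s' \<in> implicit_hypotheses k \<P> \<Q> P0 Q0" "local_parameter k P0 Q0 s' = 0" for s'
      proof -
        have sl': "s' \<in> local_sequences \<P> \<Q> P0 Q0" using s' by (simp add: implicit_hypotheses_def)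
        have "(\<lambda>n. 1 - power_seq n1 n2 s' \<phi> n) \<longlonglongrightarrow> 1 - \<alpha>" by (intro tendsto_intros lev\<phi> s')
        then show ?thesis unfolding compl[OF sl'] by (simp add: std_normal_cdf_minus u)
      qed
      have c1m: "(\<lambda>\<omega>. 1 - \<phi> n \<omega>) \<in> borel_measurable (two_sample_product (n1 n) (n2 n) P0 Q0)"
        "\<omega> \<in> space (two_sample_product (n1 n) (n2 n) P0 Q0) \<Longrightarrow> 0 \<le> 1 - \<phi> n \<omega> \<and> 1 - \<phi> n \<omega> \<le> 1" for n \<omega>
        using \<phi>m(1)[of n] \<phi>m(2)[of \<omega> n] by auto
      have b: "\<forall>\<^sub>F n in sequentially. (\<integral>\<omega>. 1 - \<phi> n \<omega> \<partial>two_sample_product (n1 n) (n2 n) (fst s n) (snd s n))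
          < 1 - std_normal_cdf (- u - \<bar>local_parameter k P0 Q0 s\<bar> / \<sigma>) + e" if e: "e > 0" for e
      proof (rule bound[OF sl False _ _ _ _ e])
        show "std_normal_cdf (- u) < 1" using u \<alpha> by (simp add: std_normal_cdf_minus)
      qed (fact c1m lev)+
      \<comment> \<open>Here \<open>\<bar>\<theta>\<bar> = - \<theta>\<close>, and reflection turns
        the bound for the complement into one minus the limiting power of
        \<open>\<psi>\<close>.\<close>
      have arg: "1 - std_normal_cdf (- u - \<bar>local_parameter k P0 Q0 s\<bar> / \<sigma>) = std_normal_cdf (u - local_parameter k P0 Q0 s / \<sigma>)"
        using std_normal_cdf_minus[of "u - local_parameter k P0 Q0 s / \<sigma>"] neg by (simp add: algebra_simps)
      show ?thesis
        unfolding lim\<psi>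
      proof (rule liminf_ge_if_eventually_greater)
        fix e :: real assume "e > 0"
        from b[OF this, unfolded compl[OF sl]] show "\<forall>\<^sub>F n in sequentially. 1 - std_normal_cdf (u - local_parameter k P0 Q0 s / \<sigma>) - e < power_seq n1 n2 s \<phi> n"
          by eventually_elim (use arg in linarith)
      qed
    qed
  qed
qed

end
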